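(* Let $k_1,\dots,k_r\geq 1$ be integers, let $$M = S^{k_1}\times S^{k_2}\times\cdots\times S^{k_r}$$ be the product of $k_i$-dimensional spheres, and let $p$ be an integer with $0\le p\le \sum_{i=1}^r k_i$. Then $$\mathrm{long}^{\,p} M = r - \min l(p),$$ where $\min l(p)$ is the minimum of the numbers $l$ over all subsets $\{i_1,\dots,i_l\}\subset\{1,\dots,r\}$ (with $l$ distinct elements) such that $\sum_{j=1}^{l}k_{i_j}\ge p$.
   Context: **$p$-length.** Let $M$ be an orientable manifold of dimension $m$ and $p\ge0$ an integer. Let $H^*(M;A)$ be the cohomology ring with $A=\mathbb{Z}$ or $\mathbb{R}$. The $p$-length $\mathrm{long}^{\,p}M$ is the largest integer $q$ such that there exist elements $a_1,\dots,a_q\in H^*(M;A)$ with (1) $\dim a_i>0$ for all $i$; (2) the product $a_1\cdots a_q$ in $H^*(M;A)$ is non-zero; (3) $\dim(a_1\cdots a_q)\le m-p$. (The value $q=0$, the empty product being $1$, is allowed.) *)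

theory Defs
  imports "HOL-Homology.Homology" "HOL-Algebra.QuotRing"
begin

section \<open>The singular cohomology ring\<close>

text \<open>
  The coefficients are the elements of a type \<open>'c\<close> of class \<^class>\<open>comm_ring_1\<close>.
  A cochain of degree \<open>n\<close> is a coefficient-valued function on the singular \<open>n\<close>-simplices
  of \<open>X\<close>. So that equality of cochains is equality of functions, it takes the value \<open>0\<close>
  on everything that is not a singular \<open>n\<close>-simplex of \<open>X\<close>.
\<close>

type_synonym ('a, 'c) cochain = "((nat \<Rightarrow> real) \<Rightarrow> 'a) \<Rightarrow> 'c"

definition singular_cochain ::
  "nat \<Rightarrow> 'a topology \<Rightarrow> ('a, 'c::comm_ring_1) cochain \<Rightarrow> bool"
  where "singular_cochain n X c \<longleftrightarrow> (\<forall>\<sigma>. \<not> singular_simplex n X \<sigma> \<longrightarrow> c \<sigma> = 0)"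

text \<open>The coboundary of \<open>c\<close> is \<open>c\<close> composed with the boundary: compare
  the definition of \<^const>\<open>chain_boundary\<close>.\<close>

definition cochain_coboundary ::
  "nat \<Rightarrow> 'a topology \<Rightarrow> ('a, 'c::comm_ring_1) cochain \<Rightarrow> ('a, 'c) cochain"
  where "cochain_coboundary n X c =
    (\<lambda>\<sigma>. if singular_simplex (Suc n) X \<sigma>
          then \<Sum>k\<le>Suc n. (-1) ^ k * c (singular_face (Suc n) k \<sigma>) else 0)"

text \<open>The front \<open>p\<close>-face and the back \<open>q\<close>-face of a singular simplex, that is, its restrictions
  to the first \<open>p + 1\<close> vertices and to the vertices from number \<open>p\<close> on.\<close>

definition front_face :: "nat \<Rightarrow> ((nat \<Rightarrow> real) \<Rightarrow> 'a) \<Rightarrow> (nat \<Rightarrow> real) \<Rightarrow> 'a"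
  where "front_face p \<sigma> = restrict \<sigma> (standard_simplex p)"

definition back_face :: "nat \<Rightarrow> nat \<Rightarrow> ((nat \<Rightarrow> real) \<Rightarrow> 'a) \<Rightarrow> (nat \<Rightarrow> real) \<Rightarrow> 'a"
  where "back_face p q \<sigma> =
    restrict (\<sigma> \<circ> (\<lambda>x i. if i < p then 0 else x (i - p))) (standard_simplex q)"

definition cochain_cup ::
  "nat \<Rightarrow> nat \<Rightarrow> 'a topology \<Rightarrow> ('a, 'c::comm_ring_1) cochain \<Rightarrow> ('a, 'c) cochain \<Rightarrow> ('a, 'c) cochain"
  where "cochain_cup p q X c d =
    (\<lambda>\<sigma>. if singular_simplex (p + q) X \<sigma>
          then c (front_face p \<sigma>) * d (back_face p q \<sigma>) else 0)"

text \<open>The direct sum over all degrees of the singular cochains, with the cup product.\<close>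

definition cochain_ring ::
  "'a topology \<Rightarrow> (nat \<Rightarrow> ('a, 'c::comm_ring_1) cochain) ring"
  where "cochain_ring X =
    \<lparr>carrier = {c. (\<forall>n. singular_cochain n X (c n)) \<and> finite {n. c n \<noteq> (\<lambda>_. 0)}},
     mult = (\<lambda>c d n \<sigma>. \<Sum>p\<le>n. cochain_cup p (n - p) X (c p) (d (n - p)) \<sigma>),
     one = (\<lambda>n \<sigma>. if n = 0 \<and> singular_simplex 0 X \<sigma> then 1 else 0),
     zero = (\<lambda>n \<sigma>. 0),
     add = (\<lambda>c d n \<sigma>. c n \<sigma> + d n \<sigma>)\<rparr>"

definition coboundary ::
  "'a topology \<Rightarrow> (nat \<Rightarrow> ('a, 'c::comm_ring_1) cochain) \<Rightarrow> nat \<Rightarrow> ('a, 'c) cochain"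
  where "coboundary X c n =
    (case n of 0 \<Rightarrow> (\<lambda>_. 0) | Suc k \<Rightarrow> cochain_coboundary k X (c k))"

definition cocycle_ring ::
  "'a topology \<Rightarrow> (nat \<Rightarrow> ('a, 'c::comm_ring_1) cochain) ring"
  where "cocycle_ring X =
    (cochain_ring X)\<lparr>carrier := {c \<in> carrier (cochain_ring X). coboundary X c = (\<lambda>_ _. 0)}\<rparr>"

definition coboundary_ideal ::
  "'a topology \<Rightarrow> (nat \<Rightarrow> ('a, 'c::comm_ring_1) cochain) set"
  where "coboundary_ideal X = coboundary X ` carrier (cochain_ring X)"

definition cohomology_ring ::
  "'a topology \<Rightarrow> (nat \<Rightarrow> ('a, 'c::comm_ring_1) cochain) set ring"
  where "cohomology_ring X = cocycle_ring X Quot coboundary_ideal X"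

text \<open>The homogeneous elements of dimension \<open>n\<close> of the cohomology ring. As usual, the zero
  element counts as homogeneous of every dimension.\<close>

definition cohomology_of_dim ::
  "nat \<Rightarrow> 'a topology \<Rightarrow> (nat \<Rightarrow> ('a, 'c::comm_ring_1) cochain) set set"
  where "cohomology_of_dim n X =
    {coboundary_ideal X +>\<^bsub>cocycle_ring X\<^esub> z |z.
      z \<in> carrier (cocycle_ring X) \<and> (\<forall>j. j \<noteq> n \<longrightarrow> z j = (\<lambda>_. 0))}"

section \<open>The p-length\<close>

text \<open>\<open>X\<close> is meant to be a manifold of dimension \<open>m\<close>; the type argument gives the coefficients.
  Condition (3) is written additively because subtraction of natural numbers truncates.\<close>

definition p_length :: "'c::comm_ring_1 itself \<Rightarrow> nat \<Rightarrow> nat \<Rightarrow> 'a topology \<Rightarrow> nat"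
  where "p_length _ m p X =
    (GREATEST q. \<exists>as :: (nat \<Rightarrow> ('a, 'c) cochain) set list.
       let H = cohomology_ring X; a = foldr (mult H) as (one H)
       in length as = q \<and>
          (\<forall>x \<in> set as. \<exists>n>0. x \<in> cohomology_of_dim n X) \<and>
          a \<noteq> zero H \<and>
          (\<exists>n. a \<in> cohomology_of_dim n X \<and> n + p \<le> m))"

definition min_l :: "nat \<Rightarrow> (nat \<Rightarrow> nat) \<Rightarrow> nat \<Rightarrow> nat"
  where "min_l r k p = Min {card I |I. I \<subseteq> {1..r} \<and> p \<le> (\<Sum>i\<in>I. k i)}"

end

theory Submission
  imports Defs
begin

text \<open>
  Additively, the cohomology of \<open>M\<close> is free on the monomials \<open>s\<^sub>J = (product of s\<^sub>i for i in J)\<close>,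
  \<open>J \<subseteq> {1..r}\<close>, where \<open>s\<^sub>i\<close> is the fundamental class of the \<open>i\<close>-th sphere, and \<open>s\<^sub>i\<^sup>2 = 0\<close>. A product of
  \<open>q\<close> classes of positive dimension is a sum of signed monomials \<open>s\<^sub>J\<close> with \<open>card J \<ge> q\<close>. So, if it is
  non-zero of dimension \<open>n\<close>, there is a set \<open>J\<close> with \<open>card J \<ge> q\<close> and \<open>(\<Sum>i\<in>J. k i) = n\<close>; conversely
  every \<open>J\<close> gives a non-zero product of \<open>card J\<close> classes. Passing to the complement of \<open>J\<close> turns
  \<open>n + p \<le> (\<Sum>i. k i)\<close> into \<open>p \<le> (\<Sum>i\<notin>J. k i)\<close>, and the largest \<open>q\<close> into \<open>r\<close> minus the least \<open>card I\<close>.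

  The two statements about \<open>J\<close> are proved by induction on the number of spheres, comparing
  \<open>X \<times> S\<^sup>k\<close> with \<open>X\<close> for an arbitrary space \<open>X\<close>:

  \<^item> A cocycle \<open>a\<close> on \<open>X \<times> S\<^sup>k\<close> is the sum of one pulled back from \<open>X\<close> and one that vanishes over
    the basepoint of \<open>S\<^sup>k\<close> (\<open>fibre_part\<close>).
  \<^item> A cocycle \<open>f\<close> vanishing over the basepoint is exact or corresponds to a cocycle \<open>v\<close> on \<open>X\<close> of
    degree lower by \<open>k\<close>, and does so as a bimodule element: for \<open>u\<close>, \<open>w\<close> on \<open>X\<close>, the product \<open>u f w\<close> is exact if and
    only if \<open>u v w\<close> is (\<open>ex_corresponding_cocycle\<close>, \<open>exact_or_corresponds\<close>). This is proved by
    induction on \<open>k\<close>. The step is the Mayer-Vietoris connecting map for \<open>S\<^sup>k\<close> covered by two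
    contractible caps that meet in a neighbourhood of the equator; the coboundary is linear over
    the pulled-back cocycles up to sign. The start \<open>k = 0\<close> is \<open>X \<times> S\<^sup>0\<close>, two copies of \<open>X\<close>.
  \<^item> For \<open>k > 0\<close> the product of two cocycles vanishing over the basepoint is exact, since one of
    them can be made to vanish over one cap and the other over the other
    (\<open>exact_cup_basepoint_vanishing\<close>).

  Multiplying out a product of \<open>q\<close> such sums therefore leaves, up to exact terms, the product of the
  pulled-back parts and products with exactly one factor \<open>f\<close> (\<open>product_expansion\<close>). A non-zero
  product on \<open>X \<times> S\<^sup>k\<close> thus yields either a non-zero product of \<open>q\<close> classes on \<open>X\<close> in the same
  dimension, or one of at least \<open>q - 1\<close> classes in dimension lower by \<open>k\<close>
  (\<open>nonzero_product_times_sphere_cases\<close>); both kinds of step can be reversed.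

  All this takes place with cocycles. The exactness statements on which it rests are duals of
  statements on singular chains: iterated subdivision for an open cover, and homotopy invariance
  for a deformation retract. A contraction of the chains modulo the small ones is constructed by
  recursion and then composed with cochains (\<open>exact_rel_if_chain_acyclic\<close>), so the coefficients may
  be any commutative ring. Finally, products in the cohomology ring are products of cocycles modulo
  coboundaries (\<open>p_length_eq\<close>).
\<close>

section \<open>Cochains, coboundary and cup product\<close>

text \<open>
  A function on simplices is regarded as a cochain of every space and of every degree; only its values
  on singular simplices matter, so equality is relative to a degree and a space. Restriction to a
  subspace then leaves the function as it is, a function can be changed on some of the simplices
  without further ado, and neither the coboundary nor the cup product has to mention the space.
\<close>

definition cochain_eq :: "nat \<Rightarrow> 'a topology \<Rightarrow> ('a, 'c) cochain \<Rightarrow> ('a, 'c) cochain \<Rightarrow> bool"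
  where "cochain_eq n X c d \<longleftrightarrow> (\<forall>\<sigma>. singular_simplex n X \<sigma> \<longrightarrow> c \<sigma> = d \<sigma>)"

definition cbd :: "nat \<Rightarrow> ('a, 'c::comm_ring_1) cochain \<Rightarrow> ('a, 'c) cochain"
  where "cbd n c = (\<lambda>\<sigma>. \<Sum>k\<le>Suc n. (-1) ^ k * c (singular_face (Suc n) k \<sigma>))"

definition cup :: "nat \<Rightarrow> nat \<Rightarrow> ('a, 'c::comm_ring_1) cochain \<Rightarrow> ('a, 'c) cochain \<Rightarrow> ('a, 'c) cochain"
  where "cup p q c d = (\<lambda>\<sigma>. c (front_face p \<sigma>) * d (back_face p q \<sigma>))"

definition pull :: "nat \<Rightarrow> ('a \<Rightarrow> 'b) \<Rightarrow> ('b, 'c) cochain \<Rightarrow> ('a, 'c) cochain"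
  where "pull n f c = (\<lambda>\<sigma>. c (simplex_map n f \<sigma>))"

text \<open>
  The family \<open>\<S>\<close> allows one notion to serve three purposes: with \<open>{}\<close> no simplex is small, with \<open>{S}\<close> the
  small simplices are those of the pair \<open>(X, S)\<close>, and with \<open>{U, V}\<close> those of a cover.
\<close>

definition small_simplex :: "nat \<Rightarrow> 'a topology \<Rightarrow> 'a set set \<Rightarrow> ((nat \<Rightarrow> real) \<Rightarrow> 'a) \<Rightarrow> bool"
  where "small_simplex n X \<S> \<sigma> \<longleftrightarrow>
    singular_simplex n X \<sigma> \<and> (\<exists>S\<in>\<S>. \<sigma> ` standard_simplex n \<subseteq> S)"

definition vanishes :: "nat \<Rightarrow> 'a topology \<Rightarrow> 'a set set \<Rightarrow> ('a, 'c::zero) cochain \<Rightarrow> bool"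
  where "vanishes n X \<S> c \<longleftrightarrow> (\<forall>\<sigma>. small_simplex n X \<S> \<sigma> \<longrightarrow> c \<sigma> = 0)"

definition cocycle :: "nat \<Rightarrow> 'a topology \<Rightarrow> ('a, 'c::comm_ring_1) cochain \<Rightarrow> bool"
  where "cocycle n X c \<longleftrightarrow> cochain_eq (Suc n) X (cbd n c) (\<lambda>_. 0)"

text \<open>
  Exactness in the complex of cochains vanishing on small simplices. In degree \<open>0\<close> there are no
  coboundaries, so only a cochain that is zero on \<open>X\<close> is exact.
\<close>

definition exact_rel :: "nat \<Rightarrow> 'a topology \<Rightarrow> 'a set set \<Rightarrow> ('a, 'c::comm_ring_1) cochain \<Rightarrow> bool"
  where "exact_rel n X \<S> c \<longleftrightarrow>
    (case n of 0 \<Rightarrow> cochain_eq 0 X c (\<lambda>_. 0)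
     | Suc m \<Rightarrow> \<exists>d. vanishes m X \<S> d \<and> cochain_eq n X c (cbd m d))"

abbreviation "exact n X \<equiv> exact_rel n X {}"

lemma cochain_eq_refl [simp]: "cochain_eq n X c c"
  by (simp add: cochain_eq_def)

lemma cochain_eq_sym: "cochain_eq n X c d \<Longrightarrow> cochain_eq n X d c"
  by (simp add: cochain_eq_def)

lemma cochain_eq_trans [trans]: "cochain_eq n X c d \<Longrightarrow> cochain_eq n X d e \<Longrightarrow> cochain_eq n X c e"
  by (simp add: cochain_eq_def)

lemma cochain_eq_subtopology: "cochain_eq n X c d \<Longrightarrow> cochain_eq n (subtopology X S) c d"
  by (simp add: cochain_eq_def singular_simplex_subtopology)

lemma exact_rel_0: "exact_rel 0 X \<S> c \<longleftrightarrow> cochain_eq 0 X c (\<lambda>_. 0)"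
  by (simp add: exact_rel_def)

lemma exact_rel_Suc:
  "exact_rel (Suc m) X \<S> c \<longleftrightarrow> (\<exists>d. vanishes m X \<S> d \<and> cochain_eq (Suc m) X c (cbd m d))"
  by (simp add: exact_rel_def)

lemma vanishes_empty [simp]: "vanishes n X {} c"
  by (simp add: vanishes_def small_simplex_def)

lemma exact_Suc: "exact (Suc m) X c \<longleftrightarrow> (\<exists>d. cochain_eq (Suc m) X c (cbd m d))"
  by (simp add: exact_rel_Suc)

lemma singular_simplex_face: "singular_simplex (Suc n) X \<sigma> \<Longrightarrow> k \<le> Suc n \<Longrightarrow> singular_simplex n X (singular_face (Suc n) k \<sigma>)"
  using singular_simplex_singular_face[of "Suc n" X \<sigma> k] by simp

lemma standard_simplex_shift:
  assumes "x \<in> standard_simplex q"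
  shows "(\<lambda>i. if i < p then 0 else x (i - p)) \<in> standard_simplex (p + q)"
proof -
  have "(\<Sum>i\<le>p + q. if i < p then 0 else x (i - p)) = (\<Sum>i=p..q+p. if i < p then 0 else x (i - p))"
    by (rule sum.mono_neutral_right) auto
  also have "\<dots> = (\<Sum>i=0..q. x i)"
    using sum.shift_bounds_cl_nat_ivl[of "\<lambda>i. if i < p then 0 else x (i - p)" 0 p q] by simp
  also have "\<dots> = 1"
    using assms by (simp add: standard_simplex_def atMost_atLeast0)
  finally show ?thesis
    using assms by (auto simp: standard_simplex_def)
qed

lemma front_face_front_face: "p \<le> q \<Longrightarrow> front_face p (front_face q \<sigma>) = front_face p \<sigma>"
  using standard_simplex_mono[of p q] by (auto simp: front_face_def Int_absorb1)

lemma front_face_back_face: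
  assumes "q \<le> r" shows "front_face q (back_face p r \<sigma>) = back_face p q \<sigma>"
  using standard_simplex_mono[OF assms] by (auto simp: front_face_def back_face_def Int_absorb1)

lemma back_face_front_face:
  "back_face p q (front_face (p + q) \<sigma>) = back_face p q \<sigma>"
  by (auto simp: front_face_def back_face_def standard_simplex_shift)

lemma back_face_back_face: "back_face p r (back_face q (p + r) \<sigma>) = back_face (p + q) r \<sigma>"
proof
  fix x :: "nat \<Rightarrow> real"
  have "(\<lambda>i. if i < q then 0 else if i - q < p then 0 else x (i - q - p)) = 
      (\<lambda>i. if i < p + q then 0 else x (i - (p + q)))"
    by (auto simp: fun_eq_iff algebra_simps)
  then show "back_face p r (back_face q (p + r) \<sigma>) x = back_face (p + q) r \<sigma> x"
    by (auto simp: back_face_def standard_simplex_shift)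
qed

text \<open>
  Front and back faces compose strictly, as functions, so that the cup product is associative on the
  nose and not only on the singular simplices of some space.
\<close>

lemma cup_assoc: "cup (p + q) r (cup p q a b) c = cup p (q + r) a (cup q r b c)"
  by (simp add: cup_def fun_eq_iff front_face_front_face front_face_back_face back_face_front_face back_face_back_face mult.assoc add.commute)

lemma back_face_0: "singular_simplex n X \<sigma> \<Longrightarrow> back_face 0 n \<sigma> = \<sigma>"
  by (auto simp: back_face_def singular_simplex_def extensional_def fun_eq_iff)

lemma front_face_self: "singular_simplex n X \<sigma> \<Longrightarrow> front_face n \<sigma> = \<sigma>"
  by (auto simp: front_face_def singular_simplex_def extensional_def fun_eq_iff)

lemma singular_simplex_front:
  assumes "singular_simplex n X \<sigma>" "p \<le> n" shows "singular_simplex p X (front_face p \<sigma>)"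
proof -
  have "continuous_map (subtopology (powertop_real UNIV) (standard_simplex p)) X \<sigma>"
    using assms continuous_map_from_subtopology_mono standard_simplex_mono
    by (metis singular_simplex_def)
  then show ?thesis
    by (auto simp: singular_simplex_def front_face_def)
qed

lemma singular_simplex_back:
  assumes "singular_simplex (p + q) X \<sigma>" shows "singular_simplex q X (back_face p q \<sigma>)"
proof -
  have "continuous_map (powertop_real UNIV) (powertop_real UNIV) (\<lambda>x i. if i < p then 0 else x (i - p))"
    by (auto simp: continuous_map_componentwise_UNIV intro: continuous_map_product_projection)
  then have "continuous_map (subtopology (powertop_real UNIV) (standard_simplex q)) (subtopology (powertop_real UNIV) (standard_simplex (p + q)))
      (\<lambda>x i. if i < p then 0 else x (i - p))"
    by (auto simp: continuous_map_in_subtopology continuous_map_from_subtopology standard_simplex_shift)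
  moreover have "continuous_map (subtopology (powertop_real UNIV) (standard_simplex (p + q))) X \<sigma>"
    using assms by (simp add: singular_simplex_def)
  ultimately show ?thesis
    using continuous_map_compose by (fastforce simp: singular_simplex_def back_face_def)
qed

lemma front_image: "p \<le> n \<Longrightarrow> front_face p \<sigma> ` standard_simplex p \<subseteq> \<sigma> ` standard_simplex n"
  using standard_simplex_mono by (fastforce simp: front_face_def)

lemma back_image: "back_face p q \<sigma> ` standard_simplex q \<subseteq> \<sigma> ` standard_simplex (p + q)"
  using standard_simplex_shift by (fastforce simp: back_face_def)

lemma singular_face_image:
  "k \<le> Suc n \<Longrightarrow> singular_face (Suc n) k \<sigma> ` standard_simplex n \<subseteq> \<sigma> ` standard_simplex (Suc n)"
  using simplical_face_in_standard_simplex[of "Suc n" k] by (fastforce simp: singular_face_def)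

lemma small_simplex_front:
  "small_simplex n X \<S> \<sigma> \<Longrightarrow> p \<le> n \<Longrightarrow> small_simplex p X \<S> (front_face p \<sigma>)"
  unfolding small_simplex_def using singular_simplex_front front_image by (metis dual_order.trans)

lemma small_simplex_back:
  "small_simplex (p + q) X \<S> \<sigma> \<Longrightarrow> small_simplex q X \<S> (back_face p q \<sigma>)"
  unfolding small_simplex_def using singular_simplex_back back_image by (metis dual_order.trans)

lemma small_simplex_face:
  "small_simplex (Suc n) X \<S> \<sigma> \<Longrightarrow> k \<le> Suc n \<Longrightarrow> small_simplex n X \<S> (singular_face (Suc n) k \<sigma>)"
  unfolding small_simplex_def using singular_simplex_face singular_face_image by (metis dual_order.trans)

lemma front_face_singular_face_low:
  assumes "k \<le> Suc p"
  shows "front_face p (singular_face (Suc (p + q)) k \<sigma>) = singular_face (Suc p) k (front_face (Suc p) \<sigma>)"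
proof
  fix x :: "nat \<Rightarrow> real"
  have "x \<in> standard_simplex p \<Longrightarrow> x \<in> standard_simplex (p + q)"
    using standard_simplex_mono[of p "p + q"] by auto
  moreover have "x \<in> standard_simplex p \<Longrightarrow> simplical_face k x \<in> standard_simplex (Suc p)"
    using simplical_face_in_standard_simplex[of "Suc p" k x] assms by simp
  ultimately show "front_face p (singular_face (Suc (p + q)) k \<sigma>) x = singular_face (Suc p) k (front_face (Suc p) \<sigma>) x"
    by (simp add: front_face_def singular_face_def)
qed

lemma front_face_singular_face_high:
  assumes "Suc p \<le> k"
  shows "front_face p (singular_face (Suc (p + q)) k \<sigma>) = front_face p \<sigma>"
proof
  fix x :: "nat \<Rightarrow> real"
  have "x \<in> standard_simplex p \<Longrightarrow> x \<in> standard_simplex (p + q)"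
    using standard_simplex_mono[of p "p + q"] by auto
  moreover have "x \<in> standard_simplex p \<Longrightarrow> simplical_face k x = x"
    using assms by (auto simp: simplical_face_def standard_simplex_def fun_eq_iff)
  ultimately show "front_face p (singular_face (Suc (p + q)) k \<sigma>) x = front_face p \<sigma> x"
    by (simp add: front_face_def singular_face_def)
qed

lemma back_face_singular_face_low:
  assumes "k \<le> p"
  shows "back_face p q (singular_face (Suc (p + q)) k \<sigma>) = back_face (Suc p) q \<sigma>"
proof
  fix x :: "nat \<Rightarrow> real"
  have "simplical_face k (\<lambda>i. if i < p then 0 else x (i - p)) = (\<lambda>i. if i < Suc p then 0 else x (i - Suc p))"
    using assms by (auto simp: simplical_face_def fun_eq_iff)
  then show "back_face p q (singular_face (Suc (p + q)) k \<sigma>) x = back_face (Suc p) q \<sigma> x"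
    by (simp add: back_face_def singular_face_def standard_simplex_shift)
qed

lemma back_face_singular_face_high:
  assumes "j \<le> Suc q"
  shows "back_face p q (singular_face (Suc (p + q)) (p + j) \<sigma>) = singular_face (Suc q) j (back_face p (Suc q) \<sigma>)"
proof
  fix x :: "nat \<Rightarrow> real"
  have "simplical_face (p + j) (\<lambda>i. if i < p then 0 else x (i - p)) = (\<lambda>i. if i < p then 0 else simplical_face j x (i - p))"
    by (auto simp: simplical_face_def fun_eq_iff)
  moreover have "x \<in> standard_simplex q \<Longrightarrow> simplical_face j x \<in> standard_simplex (Suc q)"
    using simplical_face_in_standard_simplex[of "Suc q" j x] assms by simp
  ultimately show "back_face p q (singular_face (Suc (p + q)) (p + j) \<sigma>) x = singular_face (Suc q) j (back_face p (Suc q) \<sigma>) x"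
    by (simp add: back_face_def singular_face_def standard_simplex_shift)
qed

text \<open>
  The Leibniz rule. The face of \<open>\<sigma>\<close> opposite to a vertex up to number \<open>p\<close> splits into a face of the front
  \<open>(p + 1)\<close>-face and the back \<open>q\<close>-face; for a later vertex it splits into the front \<open>p\<close>-face and a face of
  the back \<open>(q + 1)\<close>-face. On the right hand side the last term of the first sum and the first term of the
  second are extra: both are \<open>c (front_face p \<sigma>) * d (back_face (Suc p) q \<sigma>)\<close>, with opposite signs.
\<close>

lemma cbd_cup:
  "cbd (p + q) (cup p q c d) \<sigma> = cup (Suc p) q (cbd p c) d \<sigma> + (-1) ^ p * cup p (Suc q) c (cbd q d) \<sigma>"
proof -
  let ?f = "\<lambda>k. c (singular_face (Suc p) k (front_face (Suc p) \<sigma>))"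
  let ?b = "\<lambda>j. d (singular_face (Suc q) j (back_face p (Suc q) \<sigma>))"
  let ?F = "c (front_face p \<sigma>)" and ?B = "d (back_face (Suc p) q \<sigma>)"
  have f: "?f (Suc p) = ?F"
    using front_face_singular_face_low[of "Suc p" p 0 \<sigma>] front_face_singular_face_high[of p "Suc p" 0 \<sigma>] by simp
  have b: "?b 0 = ?B"
    using back_face_singular_face_high[of 0 q p \<sigma>] back_face_singular_face_low[of p p q \<sigma>] by simp
  have "{..Suc (p + q)} = {..p} \<union> {Suc p..Suc (p + q)}" "{..p} \<inter> {Suc p..Suc (p + q)} = {}"
    by auto
  then have "cbd (p + q) (cup p q c d) \<sigma> =
      (\<Sum>k\<le>p. (-1) ^ k * cup p q c d (singular_face (Suc (p + q)) k \<sigma>)) +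
      (\<Sum>k=Suc p..Suc (p + q). (-1) ^ k * cup p q c d (singular_face (Suc (p + q)) k \<sigma>))"
    unfolding cbd_def by (simp only: sum.union_disjoint[OF finite_atMost finite_atLeastAtMost])
  also have "(\<Sum>k\<le>p. (-1) ^ k * cup p q c d (singular_face (Suc (p + q)) k \<sigma>)) = (\<Sum>k\<le>p. (-1) ^ k * ?f k) * ?B"
    by (simp add: cup_def sum_distrib_right front_face_singular_face_low back_face_singular_face_low mult.assoc)
  also have "(\<Sum>k=Suc p..Suc (p + q). (-1) ^ k * cup p q c d (singular_face (Suc (p + q)) k \<sigma>)) =
      (\<Sum>j=1..Suc q. (-1) ^ (p + j) * cup p q c d (singular_face (Suc (p + q)) (p + j) \<sigma>))"
    using sum.shift_bounds_cl_nat_ivl[of "\<lambda>k. (-1) ^ k * cup p q c d (singular_face (Suc (p + q)) k \<sigma>)" 1 p "Suc q"]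
    by (simp add: add.commute)
  also have "\<dots> = (\<Sum>j=1..Suc q. (-1) ^ p * (?F * ((-1) ^ j * ?b j)))"
    by (rule sum.cong) (simp_all add: cup_def front_face_singular_face_high back_face_singular_face_high power_add mult_ac)
  also have "\<dots> = (-1) ^ p * (?F * (\<Sum>j=1..Suc q. (-1) ^ j * ?b j))"
    by (simp only: sum_distrib_left)
  also have "(\<Sum>j=1..Suc q. (-1) ^ j * ?b j) = (\<Sum>j\<le>Suc q. (-1) ^ j * ?b j) - ?b 0"
    by (simp only: atMost_atLeast0 sum.atLeast_Suc_atMost[of 0 "Suc q"]) simp
  also have "(\<Sum>k\<le>p. (-1) ^ k * ?f k) = (\<Sum>k\<le>Suc p. (-1) ^ k * ?f k) - (-1) ^ Suc p * ?f (Suc p)"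
    by simp
  finally show ?thesis
    unfolding f b by (simp only: cbd_def cup_def) (simp add: algebra_simps)
qed

lemma cbd_add: "cbd n (\<lambda>\<sigma>. c \<sigma> + d \<sigma>) = (\<lambda>\<sigma>. cbd n c \<sigma> + cbd n d \<sigma>)"
  by (simp only: cbd_def distrib_left sum.distrib)

lemma cbd_diff: "cbd n (\<lambda>\<sigma>. c \<sigma> - d \<sigma>) = (\<lambda>\<sigma>. cbd n c \<sigma> - cbd n d \<sigma>)"
  by (simp only: cbd_def right_diff_distrib sum_subtractf)

lemma cbd_scale: "cbd n (\<lambda>\<sigma>. r * c \<sigma>) = (\<lambda>\<sigma>. r * cbd n c \<sigma>)"
  by (simp only: cbd_def sum_distrib_left mult.left_commute)

lemma cbd_zero: "cbd n (\<lambda>\<sigma>. 0) = (\<lambda>\<sigma>. 0)"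
  by (simp add: cbd_def)

lemma cbd_cong:
  assumes "\<And>k. k \<le> Suc n \<Longrightarrow> c (singular_face (Suc n) k \<sigma>) = d (singular_face (Suc n) k \<sigma>)"
  shows "cbd n c \<sigma> = cbd n d \<sigma>"
  unfolding cbd_def by (rule sum.cong) (simp_all add: assms)

lemma cochain_eq_cbd: "cochain_eq n X c d \<Longrightarrow> cochain_eq (Suc n) X (cbd n c) (cbd n d)"
  unfolding cochain_eq_def by (blast intro: cbd_cong singular_simplex_face)

lemma cochain_eq_cup:
  "cochain_eq p X c c' \<Longrightarrow> cochain_eq q X d d' \<Longrightarrow> cochain_eq (p + q) X (cup p q c d) (cup p q c' d')"
  by (simp add: cochain_eq_def cup_def singular_simplex_front singular_simplex_back)

lemma vanishes_cbd: "vanishes n X \<S> c \<Longrightarrow> vanishes (Suc n) X \<S> (cbd n c)"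
  unfolding vanishes_def cbd_def
  by (intro allI impI sum.neutral ballI) (simp add: small_simplex_face)

lemma vanishes_cup_left: "vanishes p X \<S> c \<Longrightarrow> vanishes (p + q) X \<S> (cup p q c d)"
  by (simp add: vanishes_def cup_def small_simplex_front)

lemma vanishes_cup_right: "vanishes q X \<S> d \<Longrightarrow> vanishes (p + q) X \<S> (cup p q c d)"
  by (simp add: vanishes_def cup_def small_simplex_back)

section \<open>From acyclic chains to exact cocycles\<close>

definition evaluate :: "('a, 'c::comm_ring_1) cochain \<Rightarrow> 'a chain \<Rightarrow> 'c"
  where "evaluate c x = (\<Sum>\<sigma>\<in>Poly_Mapping.keys x. of_int (Poly_Mapping.lookup x \<sigma>) * c \<sigma>)"

lemma evaluate_superset:
  "finite A \<Longrightarrow> Poly_Mapping.keys x \<subseteq> A \<Longrightarrow> evaluate c x = (\<Sum>\<sigma>\<in>A. of_int (Poly_Mapping.lookup x \<sigma>) * c \<sigma>)"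
  unfolding evaluate_def by (rule sum.mono_neutral_left) (auto simp: in_keys_iff)

lemma evaluate_0 [simp]: "evaluate c 0 = 0"
  by (simp add: evaluate_def)

lemma evaluate_of [simp]: "evaluate c (frag_of \<sigma>) = c \<sigma>"
  by (simp add: evaluate_def)

lemma evaluate_add: "evaluate c (x + y) = evaluate c x + evaluate c y"
proof -
  let ?A = "Poly_Mapping.keys x \<union> Poly_Mapping.keys y"
  show ?thesis
    using evaluate_superset[of ?A x c] evaluate_superset[of ?A y c] evaluate_superset[of ?A "x + y" c] keys_add[of x y]
    by (simp add: lookup_add sum.distrib algebra_simps)
qed

lemma evaluate_diff: "evaluate c (x - y) = evaluate c x - evaluate c y"
  using evaluate_add[of c "x - y" y] by simp

lemma evaluate_cmul: "evaluate c (frag_cmul a x) = of_int a * evaluate c x"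
  using evaluate_superset[of "Poly_Mapping.keys x" "frag_cmul a x" c] keys_cmul[of a x]
  by (simp add: evaluate_def sum_distrib_left mult.assoc)

lemma evaluate_sum: "evaluate c (sum f I) = (\<Sum>i\<in>I. evaluate c (f i))"
  by (induction I rule: infinite_finite_induct) (simp_all add: evaluate_add)

lemma evaluate_extend: "evaluate c (frag_extend f x) = evaluate (\<lambda>\<sigma>. evaluate c (f \<sigma>)) x"
  by (simp add: frag_extend_def evaluate_sum evaluate_cmul) (simp add: evaluate_def)

lemma evaluate_eq_0: "(\<And>\<sigma>. \<sigma> \<in> Poly_Mapping.keys x \<Longrightarrow> c \<sigma> = 0) \<Longrightarrow> evaluate c x = 0"
  by (simp add: evaluate_def)

lemma evaluate_boundary: "evaluate c (chain_boundary (Suc n) x) = evaluate (cbd n c) x"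
  by (simp add: chain_boundary_def evaluate_extend evaluate_sum evaluate_cmul cbd_def del: sum.atMost_Suc)

text \<open>
  Adjoint to \<open>chain_boundary_boundary\<close>, by evaluation on the simplex.
\<close>

lemma cbd_cbd:
  assumes "singular_simplex (Suc (Suc n)) X \<sigma>"
  shows "cbd (Suc n) (cbd n c) \<sigma> = 0"
proof -
  have "chain_boundary (Suc n) (chain_boundary (Suc (Suc n)) (frag_of \<sigma>)) = 0"
    using assms chain_boundary_boundary_alt[of "Suc n" X "frag_of \<sigma>"] by (simp add: singular_chain_of)
  then show ?thesis
    by (metis evaluate_0 evaluate_boundary evaluate_of)
qed

lemma cocycle_cbd: "cocycle (Suc n) X (cbd n c)"
  by (simp add: cocycle_def cochain_eq_def cbd_cbd)

definition small_chain :: "nat \<Rightarrow> 'a topology \<Rightarrow> 'a set set \<Rightarrow> 'a chain \<Rightarrow> bool"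
  where "small_chain n X \<S> x \<longleftrightarrow> Poly_Mapping.keys x \<subseteq> Collect (small_simplex n X \<S>)"

text \<open>
  The singular chains modulo the small ones have no homology, expressed without the quotient. For
  \<open>n = 0\<close> the boundary is \<open>0\<close> by convention, so every \<open>0\<close>-chain is required to bound modulo small ones.
\<close>

definition chain_acyclic :: "'a topology \<Rightarrow> 'a set set \<Rightarrow> bool"
  where "chain_acyclic X \<S> \<longleftrightarrow>
    (\<forall>n x. singular_chain n X x \<longrightarrow> small_chain (n - 1) X \<S> (chain_boundary n x) \<longrightarrow>
      (\<exists>w. singular_chain (Suc n) X w \<and> small_chain n X \<S> (chain_boundary (Suc n) w - x)))"

lemma small_chain_0 [simp]: "small_chain n X \<S> 0"
  by (simp add: small_chain_def)

lemma small_chain_add: "small_chain n X \<S> x \<Longrightarrow> small_chain n X \<S> y \<Longrightarrow> small_chain n X \<S> (x + y)"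
  unfolding small_chain_def using keys_add[of x y] by blast

lemma small_chain_diff: "small_chain n X \<S> x \<Longrightarrow> small_chain n X \<S> y \<Longrightarrow> small_chain n X \<S> (x - y)"
  unfolding small_chain_def using keys_diff[of x y] by blast

lemma small_chain_uminus: "small_chain n X \<S> x \<Longrightarrow> small_chain n X \<S> (- x)"
  using small_chain_diff[of n X \<S> 0 x] by simp

lemma small_chain_sum: "(\<And>i. i \<in> I \<Longrightarrow> small_chain n X \<S> (f i)) \<Longrightarrow> small_chain n X \<S> (sum f I)"
  by (induction I rule: infinite_finite_induct) (simp_all add: small_chain_add)

lemma small_chain_cmul: "small_chain n X \<S> x \<Longrightarrow> small_chain n X \<S> (frag_cmul a x)"
  by (auto simp: small_chain_def)

lemma small_chain_of: "small_chain n X \<S> (frag_of \<sigma>) \<longleftrightarrow> small_simplex n X \<S> \<sigma>"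
  by (simp add: small_chain_def)

lemma small_chain_boundary_of:
  "small_simplex (Suc n) X \<S> \<sigma> \<Longrightarrow> small_chain n X \<S> (chain_boundary (Suc n) (frag_of \<sigma>))"
  by (auto simp: chain_boundary_of small_simplex_face small_chain_of simp del: sum.atMost_Suc
      intro!: small_chain_sum small_chain_cmul)

text \<open>
  A contracting homotopy \<open>s\<close> of the chains modulo small chains: \<open>\<partial> s + s \<partial> = id\<close> up to small chains, and
  \<open>s = 0\<close> on small chains. The quotient is free on the simplices that are not small, so \<open>s\<close> can be chosen
  simplex by simplex: \<open>\<sigma> - s (\<partial> \<sigma>)\<close> is a cycle modulo small chains, and \<open>s \<sigma>\<close> is any chain bounding it.
\<close>

fun contraction :: "'a topology \<Rightarrow> 'a set set \<Rightarrow> nat \<Rightarrow> ((nat \<Rightarrow> real) \<Rightarrow> 'a) \<Rightarrow> 'a chain"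
  where
    "contraction X \<S> 0 \<sigma> = (if small_simplex 0 X \<S> \<sigma> then 0 else
      (SOME w. singular_chain 1 X w \<and> small_chain 0 X \<S> (chain_boundary 1 w - frag_of \<sigma>)))"
  | "contraction X \<S> (Suc n) \<sigma> = (if small_simplex (Suc n) X \<S> \<sigma> then 0 else
      (SOME w. singular_chain (Suc (Suc n)) X w \<and> small_chain (Suc n) X \<S> (chain_boundary (Suc (Suc n)) w -
        (frag_of \<sigma> - frag_extend (contraction X \<S> n) (chain_boundary (Suc n) (frag_of \<sigma>))))))"

lemma contraction_small: "small_simplex n X \<S> \<sigma> \<Longrightarrow> contraction X \<S> n \<sigma> = 0"
  by (cases n) simp_all

lemma contraction_small_chain: "small_chain n X \<S> x \<Longrightarrow> frag_extend (contraction X \<S> n) x = 0"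
  by (rule frag_extend_eq_0) (auto simp: small_chain_def contraction_small)

lemma contraction_spec_0:
  assumes "chain_acyclic X \<S>" "singular_simplex 0 X \<sigma>"
  shows "singular_chain 1 X (contraction X \<S> 0 \<sigma>) \<and>
    small_chain 0 X \<S> (chain_boundary 1 (contraction X \<S> 0 \<sigma>) - frag_of \<sigma>)"
proof (cases "small_simplex 0 X \<S> \<sigma>")
  case True
  then show ?thesis by (auto simp: small_chain_of intro: small_chain_uminus)
next
  case False
  have "\<exists>w. singular_chain 1 X w \<and> small_chain 0 X \<S> (chain_boundary 1 w - frag_of \<sigma>)"
    using assms unfolding chain_acyclic_def
    by (metis One_nat_def chain_boundary_def singular_chain_of small_chain_0)
  from someI_ex[OF this] False show ?thesis by simp
qed

text \<open>
  The recursion never gets stuck: by the homotopy identity one degree below,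
  \<open>\<partial> (\<sigma> - s (\<partial> \<sigma>)) = \<partial> \<sigma> - (\<partial> \<sigma> - s (\<partial> (\<partial> \<sigma>)))\<close> up to small chains, which is small.
\<close>

lemma contraction_spec_Suc:
  assumes acyc: "chain_acyclic X \<S>" and \<sigma>: "singular_simplex (Suc n) X \<sigma>"
  shows "singular_chain (Suc (Suc n)) X (contraction X \<S> (Suc n) \<sigma>) \<and>
    small_chain (Suc n) X \<S> (chain_boundary (Suc (Suc n)) (contraction X \<S> (Suc n) \<sigma>) -
      (frag_of \<sigma> - frag_extend (contraction X \<S> n) (chain_boundary (Suc n) (frag_of \<sigma>))))"
  using \<sigma>
proof (induction n arbitrary: \<sigma> rule: less_induct)
  case (less n)
  let ?s = "\<lambda>n. frag_extend (contraction X \<S> n)"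
  let ?z = "frag_of \<sigma> - ?s n (chain_boundary (Suc n) (frag_of \<sigma>))"
  show ?case
  proof (cases "small_simplex (Suc n) X \<S> \<sigma>")
    case True
    then show ?thesis
      by (auto simp: contraction_small contraction_small_chain small_chain_boundary_of small_chain_of
          intro: small_chain_uminus)
  next
    case False
    have bd: "singular_chain n X (chain_boundary (Suc n) (frag_of \<sigma>))"
      using less.prems by (simp add: singular_chain_boundary_alt singular_chain_of)
    have sing: "singular_chain (Suc n) X (contraction X \<S> n \<tau>)" if "singular_simplex n X \<tau>" for \<tau>
      using that less.IH contraction_spec_0[OF acyc] by (cases n) auto
    then have "singular_chain (Suc n) X (?s n y)" if "singular_chain n X y" for y
      using that by (auto simp: singular_chain_def[of n] intro!: singular_chain_extend)
    then have z: "singular_chain (Suc n) X ?z"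
      using bd less.prems by (simp add: singular_chain_diff singular_chain_of)
    \<comment> \<open>The homotopy identity in degree \<open>n\<close>, extended linearly from simplices to chains.\<close>
    have homot: "small_chain n X \<S> (chain_boundary (Suc n) (?s n y) - y +
        (case n of 0 \<Rightarrow> 0 | Suc m \<Rightarrow> ?s m (chain_boundary n y)))"
      if y: "singular_chain n X y" for y
      using y[unfolded singular_chain_def]
    proof (induction y rule: frag_induction)
      case (one \<tau>)
      show ?case
      proof (cases n)
        case 0
        then show ?thesis using one contraction_spec_0[OF acyc, of \<tau>] by simp
      next
        case (Suc m)
        then show ?thesis using one less.IH[of m \<tau>] by (simp add: algebra_simps)
      qed
    next
      case (diff a b)
      show ?case
        using small_chain_diff[OF diff.IH]
        by (cases n) (simp_all add: frag_extend_diff chain_boundary_diff algebra_simps)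
    qed (auto split: nat.split)
    have "chain_boundary n (chain_boundary (Suc n) (frag_of \<sigma>)) = 0"
      using less.prems chain_boundary_boundary_alt[of n X "frag_of \<sigma>"] by (simp add: singular_chain_of)
    then have "small_chain n X \<S> (chain_boundary (Suc n) (?s n (chain_boundary (Suc n) (frag_of \<sigma>))) -
        chain_boundary (Suc n) (frag_of \<sigma>))"
      using homot[OF bd] by (simp split: nat.splits)
    then have "small_chain n X \<S> (chain_boundary (Suc n) ?z)"
      by (metis chain_boundary_diff minus_diff_eq small_chain_uminus)
    then have "\<exists>w. singular_chain (Suc (Suc n)) X w \<and> small_chain (Suc n) X \<S> (chain_boundary (Suc (Suc n)) w - ?z)"
      using acyc z unfolding chain_acyclic_def by (metis diff_Suc_1)
    from someI_ex[OF this] False show ?thesis by simp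
  qed
qed

text \<open>
  If \<open>s\<close> is the contraction, then \<open>c = c \<circ> \<partial> \<circ> s + c \<circ> s \<circ> \<partial>\<close> as \<open>c\<close> kills small chains. The first term is
  zero for a cocycle, so \<open>c \<circ> s\<close> is a primitive, and it vanishes on small simplices because \<open>s\<close> does.
\<close>

lemma exact_rel_if_chain_acyclic:
  fixes c :: "('a, 'c::comm_ring_1) cochain"
  assumes acyc: "chain_acyclic X \<S>" and c: "cocycle n X c" and van: "vanishes n X \<S> c"
  shows "exact_rel n X \<S> c"
proof -
  have cyc: "evaluate c (chain_boundary (Suc n) w) = 0" if "singular_chain (Suc n) X w" for w
    using c that by (auto simp: evaluate_boundary cocycle_def cochain_eq_def singular_chain_def intro!: evaluate_eq_0)
  have sm: "evaluate c x = 0" if "small_chain n X \<S> x" for x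
    using van that by (auto simp: vanishes_def small_chain_def intro!: evaluate_eq_0)
  have mod: "evaluate c x = 0" if "singular_chain (Suc n) X w \<and> small_chain n X \<S> (chain_boundary (Suc n) w - x)" for w x
    using sm[of "chain_boundary (Suc n) w - x"] cyc[of w] that by (simp add: evaluate_diff)
  show ?thesis
  proof (cases n)
    case 0
    have "c \<sigma> = 0" if "singular_simplex 0 X \<sigma>" for \<sigma>
      using mod contraction_spec_0[OF acyc that] by (fastforce simp: 0)
    then show ?thesis by (simp add: 0 exact_rel_0 cochain_eq_def)
  next
    case (Suc m)
    let ?d = "\<lambda>\<tau>. evaluate c (contraction X \<S> m \<tau>)"
    have "c \<sigma> = cbd m ?d \<sigma>" if "singular_simplex (Suc m) X \<sigma>" for \<sigma>
    proof -
      have "evaluate c (frag_of \<sigma> - frag_extend (contraction X \<S> m) (chain_boundary (Suc m) (frag_of \<sigma>))) = 0"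
        using mod[unfolded Suc, OF contraction_spec_Suc[OF acyc that]] .
      then show ?thesis
        by (simp add: evaluate_diff evaluate_extend evaluate_boundary)
    qed
    moreover have "vanishes m X \<S> ?d"
      by (simp add: vanishes_def contraction_small)
    ultimately show ?thesis
      unfolding Suc exact_rel_Suc cochain_eq_def by (intro exI[of _ ?d] conjI allI impI) simp_all
  qed
qed

text \<open>
  A chain is homotopic to its iterated subdivision, which becomes small for the cover. The homotopy \<open>h\<close>
  is natural in the space; applied to the subspaces in \<open>\<U>\<close>, this shows that \<open>h\<close> maps small chains to small
  chains. Hence the correction term \<open>h (\<partial> x)\<close> is small when \<open>\<partial> x\<close> is.
\<close>

lemma chain_acyclic_open_cover:
  assumes op: "\<And>U. U \<in> \<U> \<Longrightarrow> openin X U" and cover: "topspace X \<subseteq> \<Union>\<U>"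
  shows "chain_acyclic X \<U>"
  unfolding chain_acyclic_def
proof (intro allI impI)
  fix n and x :: "'a chain"
  assume x: "singular_chain n X x" and bd: "small_chain (n - 1) X \<U> (chain_boundary n x)"
  obtain m where m: "\<And>f. f \<in> Poly_Mapping.keys ((singular_subdivision n ^^ m) x) \<Longrightarrow>
      \<exists>V\<in>\<U>. f \<in> standard_simplex n \<rightarrow> V"
    by (rule sufficient_iterated_singular_subdivision_exists[OF op cover x]) blast+
  obtain h where h0: "\<And>p. h p 0 = (0 :: 'a chain)"
    and hdiff: "\<And>p c1 c2. h p (c1 - c2) = h p c1 - h p c2"
    and hsing: "\<And>p X c. singular_chain p X c \<Longrightarrow> singular_chain (Suc p) X (h p c)"
    and hhom: "\<And>p X c. singular_chain p X c \<Longrightarrow>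
      chain_boundary (Suc p) (h p c) + h (p - Suc 0) (chain_boundary p c) = (singular_subdivision p ^^ m) c - c"
    using chain_homotopic_iterated_singular_subdivision by blast
  have sd: "small_chain n X \<U> ((singular_subdivision n ^^ m) x)"
  proof -
    have "singular_chain n X ((singular_subdivision n ^^ j) x)" for j
      by (induction j) (auto simp: x singular_chain_singular_subdivision)
    then have "f \<in> Collect (small_simplex n X \<U>)" if "f \<in> Poly_Mapping.keys ((singular_subdivision n ^^ m) x)" for f
      using m[OF that] that by (auto simp: singular_chain_def small_simplex_def image_subset_iff_funcset)
    then show ?thesis
      unfolding small_chain_def by blast
  qed
  have hsmall: "small_chain (Suc p) X \<U> (h p y)" if "small_chain p X \<U> y" for p y
    using that[unfolded small_chain_def]
  proof (induction y rule: frag_induction)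
    case (one \<tau>)
    then obtain S where "S \<in> \<U>" "singular_simplex p (subtopology X S) \<tau>"
      by (auto simp: small_simplex_def singular_simplex_subtopology)
    then have "singular_chain (Suc p) (subtopology X S) (h p (frag_of \<tau>))"
      by (simp add: hsing singular_chain_of)
    then have "\<rho> \<in> Collect (small_simplex (Suc p) X \<U>)" if "\<rho> \<in> Poly_Mapping.keys (h p (frag_of \<tau>))" for \<rho>
    proof -
      have "singular_simplex (Suc p) (subtopology X S) \<rho>"
        using \<open>singular_chain (Suc p) (subtopology X S) (h p (frag_of \<tau>))\<close> that
        unfolding singular_chain_def by blast
      then show ?thesis
        using \<open>S \<in> \<U>\<close> by (auto simp: small_simplex_def singular_simplex_subtopology)
    qed
    then show ?case
      unfolding small_chain_def by blast
  next
    case (diff a b)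
    then show ?case by (simp add: hdiff small_chain_diff)
  qed (simp add: h0)
  have hbd: "small_chain n X \<U> (h (n - Suc 0) (chain_boundary n x))"
  proof (cases n)
    case 0
    then show ?thesis by (simp add: chain_boundary_def h0)
  next
    case (Suc k)
    then show ?thesis using hsmall[of k "chain_boundary n x"] bd by simp
  qed
  have "chain_boundary (Suc n) (- h n x) - x = h (n - Suc 0) (chain_boundary n x) - (singular_subdivision n ^^ m) x"
    using hhom[OF x] by (simp add: chain_boundary_minus algebra_simps)
  then have "small_chain n X \<U> (chain_boundary (Suc n) (- h n x) - x)"
    using hbd sd small_chain_diff by metis
  then show "\<exists>w. singular_chain (Suc n) X w \<and> small_chain n X \<U> (chain_boundary (Suc n) w - x)"
    using hsing[OF x] singular_chain_minus by metis
qed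

text \<open>
  The long exact sequence of the pair makes its homology trivial when the inclusion of \<open>S\<close> is a homotopy
  equivalence; the hypotheses say that \<open>f\<close> is a homotopy inverse.
\<close>

lemma chain_acyclic_retract:
  assumes "continuous_map X (subtopology X S) f"
    "homotopic_with (\<lambda>h. True) (subtopology X S) (subtopology X S) f id"
    "homotopic_with (\<lambda>k. True) X X f id"
  shows "chain_acyclic X {S}"
  unfolding chain_acyclic_def
proof (intro allI impI)
  fix n and x :: "'a chain"
  have sm: "small_chain m X {S} y \<longleftrightarrow> singular_chain m (subtopology X S) y" for m y
    by (auto simp: small_chain_def singular_chain_def small_simplex_def singular_simplex_subtopology)
  assume "singular_chain n X x" and "small_chain (n - 1) X {S} (chain_boundary n x)"
  then have x: "singular_relcycle n X S x"
    by (simp add: sm singular_relcycle)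
  have "trivial_group (relative_homology_group (int n) X S)"
    by (rule trivial_relative_homology_group_gen[OF assms])
  then have "homologous_rel_set n X S x = singular_relboundary_set n X S"
    using x imageI[of x "singular_relcycle_set n X S" "homologous_rel_set n X S"]
    unfolding trivial_group_def carrier_relative_homology_group one_relative_homology_group
    by (simp del: homologous_rel_set_eq_relboundary)
  then have "singular_relboundary n X S x"
    by (simp add: homologous_rel_set_eq_relboundary)
  then show "\<exists>w. singular_chain (Suc n) X w \<and> small_chain n X {S} (chain_boundary (Suc n) w - x)"
    by (metis add_diff_cancel_left' singular_relboundary_alt sm)
qed

section \<open>Cocycles and exact cochains\<close>

lemma front_simplex_map: "p \<le> n \<Longrightarrow> front_face p (simplex_map n f \<sigma>) = simplex_map p f (front_face p \<sigma>)"
  using standard_simplex_mono[of p n] by (auto simp: front_face_def simplex_map_def fun_eq_iff)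

lemma back_simplex_map: "back_face p q (simplex_map (p + q) f \<sigma>) = simplex_map q f (back_face p q \<sigma>)"
  by (auto simp: back_face_def simplex_map_def standard_simplex_shift fun_eq_iff)

lemma pull_cup: "pull (p + q) f (cup p q c d) = cup p q (pull p f c) (pull q f d)"
  by (simp add: pull_def cup_def front_simplex_map back_simplex_map)

lemma face_simplex_map:
  "k \<le> Suc n \<Longrightarrow> singular_face (Suc n) k (simplex_map (Suc n) f \<sigma>) = simplex_map n f (singular_face (Suc n) k \<sigma>)"
  using simplical_face_in_standard_simplex[of "Suc n" k]
  by (auto simp: singular_face_def simplex_map_def fun_eq_iff)

lemma pull_cbd: "pull (Suc n) f (cbd n c) = cbd n (pull n f c)"
  unfolding pull_def cbd_def by (intro ext sum.cong) (simp_all add: face_simplex_map)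

lemma cochain_eq_pull:
  "cochain_eq n Y c d \<Longrightarrow> continuous_map X Y f \<Longrightarrow> cochain_eq n X (pull n f c) (pull n f d)"
  by (simp add: cochain_eq_def pull_def singular_simplex_simplex_map)

lemma pull_compose: "pull n f (pull n g c) = pull n (g \<circ> f) c"
  by (simp add: pull_def simplex_map_compose)

lemma pull_cochain_eq_self:
  "(\<And>x. x \<in> topspace X \<Longrightarrow> f x = x) \<Longrightarrow> cochain_eq n X (pull n f c) c"
  by (simp add: pull_def cochain_eq_def simplex_map_id_gen)

lemma small_simplex_subtopology:
  "small_simplex n (subtopology X S) \<S> \<sigma> \<longleftrightarrow> small_simplex n X \<S> \<sigma> \<and> \<sigma> ` standard_simplex n \<subseteq> S"
  by (auto simp: small_simplex_def singular_simplex_subtopology)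

lemma vanishes_subtopology: "vanishes n X \<S> c \<Longrightarrow> vanishes n (subtopology X S) \<S> c"
  by (simp add: vanishes_def small_simplex_subtopology)

lemma vanishes_sing: "vanishes n X {S} c \<longleftrightarrow> cochain_eq n (subtopology X S) c (\<lambda>_. 0)"
  by (simp add: vanishes_def cochain_eq_def small_simplex_def singular_simplex_subtopology)

lemma vanishes_pair: "vanishes n X {S, T} c \<longleftrightarrow> vanishes n X {S} c \<and> vanishes n X {T} c"
  by (auto simp: vanishes_def small_simplex_def)

lemma vanishes_subtopology_iff: "S \<subseteq> T \<Longrightarrow> vanishes n (subtopology X T) {S} c \<longleftrightarrow> vanishes n X {S} c"
  by (auto simp: vanishes_def small_simplex_def singular_simplex_subtopology)

lemma vanishes_diff: "vanishes n X \<S> c \<Longrightarrow> vanishes n X \<S> d \<Longrightarrow> vanishes n X \<S> (\<lambda>\<sigma>. c \<sigma> - (d \<sigma> :: 'c::comm_ring_1))"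
  by (simp add: vanishes_def)

lemma vanishes_add: "vanishes n X \<S> c \<Longrightarrow> vanishes n X \<S> d \<Longrightarrow> vanishes n X \<S> (\<lambda>\<sigma>. c \<sigma> + (d \<sigma> :: 'c::comm_ring_1))"
  by (simp add: vanishes_def)

lemma vanishes_scale: "vanishes n X \<S> c \<Longrightarrow> vanishes n X \<S> (\<lambda>\<sigma>. r * (c \<sigma> :: 'c::comm_ring_1))"
  by (simp add: vanishes_def)

lemma cochain_eq_mono: "cochain_eq n (subtopology X T) c d \<Longrightarrow> S \<subseteq> T \<Longrightarrow> cochain_eq n (subtopology X S) c d"
  by (auto simp: cochain_eq_def singular_simplex_subtopology)

lemma cocycle_cong: "cochain_eq n X c d \<Longrightarrow> cocycle n X c \<longleftrightarrow> cocycle n X d"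
  unfolding cocycle_def using cochain_eq_cbd cochain_eq_trans cochain_eq_sym by metis

lemma cocycle_subtopology: "cocycle n X c \<Longrightarrow> cocycle n (subtopology X S) c"
  unfolding cocycle_def by (rule cochain_eq_subtopology)

lemma cocycle_pull: "cocycle n Y c \<Longrightarrow> continuous_map X Y f \<Longrightarrow> cocycle n X (pull n f c)"
  unfolding cocycle_def using cochain_eq_pull[of "Suc n" Y "cbd n c" "\<lambda>_. 0" X f]
  by (simp add: pull_cbd) (simp add: pull_def)

lemma cocycle_add: "cocycle n X c \<Longrightarrow> cocycle n X d \<Longrightarrow> cocycle n X (\<lambda>\<sigma>. c \<sigma> + d \<sigma>)"
  by (simp add: cocycle_def cochain_eq_def cbd_add)

lemma cocycle_diff: "cocycle n X c \<Longrightarrow> cocycle n X d \<Longrightarrow> cocycle n X (\<lambda>\<sigma>. c \<sigma> - d \<sigma>)"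
  by (simp add: cocycle_def cochain_eq_def cbd_diff)

lemma cocycle_zero: "cocycle n X (\<lambda>_. 0)"
  by (simp add: cocycle_def cbd_zero)

lemma cocycle_one: "cocycle 0 X (\<lambda>_. 1)"
  by (simp add: cocycle_def cbd_def cochain_eq_def)

lemma cbd_cup_cocycle_right:
  assumes "cocycle b X w"
  shows "cochain_eq (Suc (n + b)) X (cbd (n + b) (cup n b g w)) (cup (Suc n) b (cbd n g) w)"
  using assms singular_simplex_back[of n "Suc b" X]
  by (simp add: cochain_eq_def cbd_cup cocycle_def) (simp add: cup_def)

lemma cbd_cup_cocycle_left:
  assumes "cocycle a X u"
  shows "cochain_eq (Suc (a + n)) X (cbd (a + n) (cup a n u g)) (\<lambda>\<sigma>. (-1) ^ a * cup a (Suc n) u (cbd n g) \<sigma>)"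
  using assms singular_simplex_front[of "Suc (a + n)" X _ "Suc a"]
  by (simp add: cochain_eq_def cbd_cup cocycle_def) (simp add: cup_def)

lemma cocycle_cup:
  assumes "cocycle p X c" "cocycle q X d"
  shows "cocycle (p + q) X (cup p q c d)"
proof -
  have "cochain_eq (Suc (p + q)) X (cup (Suc p) q (cbd p c) d) (\<lambda>_. 0)"
    using assms singular_simplex_front[of "Suc (p + q)" X _ "Suc p"]
    by (simp add: cochain_eq_def cocycle_def cup_def)
  then show ?thesis
    unfolding cocycle_def using cbd_cup_cocycle_right[OF assms(2)] cochain_eq_trans by metis
qed

lemma exact_rel_cong:
  assumes "cochain_eq n X c d" shows "exact_rel n X \<S> c \<longleftrightarrow> exact_rel n X \<S> d"
proof -
  have "cochain_eq n X c e \<longleftrightarrow> cochain_eq n X d e" for e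
    using assms by (auto simp: cochain_eq_def)
  then show ?thesis
    by (cases n) (simp_all add: exact_rel_def)
qed

lemma exact_rel_zero: "exact_rel n X \<S> (\<lambda>_. 0)"
proof (cases n)
  case (Suc m)
  have "vanishes m X \<S> (\<lambda>_. 0)" by (simp add: vanishes_def)
  then show ?thesis unfolding Suc exact_rel_Suc by (intro exI[of _ "\<lambda>_. 0"]) (simp add: cbd_zero)
qed (simp add: exact_rel_0)

lemma exact_rel_add:
  assumes "exact_rel n X \<S> c" "exact_rel n X \<S> d"
  shows "exact_rel n X \<S> (\<lambda>\<sigma>. c \<sigma> + d \<sigma>)"
proof (cases n)
  case 0
  with assms show ?thesis by (simp add: exact_rel_0 cochain_eq_def)
next
  case (Suc m)
  then obtain c' d' where *: "vanishes m X \<S> c'" "vanishes m X \<S> d'"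
      "cochain_eq (Suc m) X c (cbd m c')" "cochain_eq (Suc m) X d (cbd m d')"
    using assms by (auto simp: exact_rel_Suc)
  then have "cochain_eq (Suc m) X (\<lambda>\<sigma>. c \<sigma> + d \<sigma>) (cbd m (\<lambda>\<sigma>. c' \<sigma> + d' \<sigma>))"
    by (simp add: cochain_eq_def cbd_add)
  with *(1,2) show ?thesis unfolding Suc exact_rel_Suc using vanishes_add by blast
qed

lemma exact_rel_scale:
  assumes "exact_rel n X \<S> c"
  shows "exact_rel n X \<S> (\<lambda>\<sigma>. r * c \<sigma>)"
proof (cases n)
  case 0
  with assms show ?thesis by (simp add: exact_rel_0 cochain_eq_def)
next
  case (Suc m)
  then obtain c' where *: "vanishes m X \<S> c'" "cochain_eq (Suc m) X c (cbd m c')"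
    using assms by (auto simp: exact_rel_Suc)
  then have "cochain_eq (Suc m) X (\<lambda>\<sigma>. r * c \<sigma>) (cbd m (\<lambda>\<sigma>. r * c' \<sigma>))"
    by (simp add: cochain_eq_def cbd_scale)
  with *(1) show ?thesis unfolding Suc exact_rel_Suc using vanishes_scale by blast
qed

lemma exact_rel_diff:
  "exact_rel n X \<S> c \<Longrightarrow> exact_rel n X \<S> d \<Longrightarrow> exact_rel n X \<S> (\<lambda>\<sigma>. c \<sigma> - d \<sigma>)"
  using exact_rel_add[of n X \<S> c "\<lambda>\<sigma>. (-1) * d \<sigma>"] exact_rel_scale[of n X \<S> d "-1"] by simp

lemma exact_scale_sign: "exact n X (\<lambda>\<sigma>. (-1) ^ a * c \<sigma>) \<longleftrightarrow> exact n X c"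
  using exact_rel_scale[of n X "{}" c "(-1) ^ a"] exact_rel_scale[of n X "{}" "\<lambda>\<sigma>. (-1) ^ a * c \<sigma>" "(-1) ^ a"]
  by (auto simp flip: mult.assoc power_add)

lemma exact_cbd: "exact (Suc n) X (cbd n c)"
  unfolding exact_Suc using cochain_eq_refl by blast

lemma exact_rel_imp_exact: "exact_rel n X \<S> c \<Longrightarrow> exact n X c"
  by (auto simp: exact_rel_def split: nat.splits)

lemma exact_imp_cocycle: "exact n X c \<Longrightarrow> cocycle n X c"
proof (cases n)
  case 0
  then show "exact n X c \<Longrightarrow> cocycle n X c"
    using cocycle_cong[of 0 X c "\<lambda>_. 0"] cocycle_zero[of 0 X] by (simp add: exact_rel_0)
next
  case (Suc m)
  then show "exact n X c \<Longrightarrow> cocycle n X c"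
    using cocycle_cong[of n X c] cocycle_cbd[of m X] by (auto simp: exact_Suc)
qed

lemma exact_subtopology: "exact n X c \<Longrightarrow> exact n (subtopology X S) c"
  by (cases n) (auto simp: exact_rel_0 exact_Suc intro: cochain_eq_subtopology)

lemma exact_mono: "exact n (subtopology X T) c \<Longrightarrow> S \<subseteq> T \<Longrightarrow> exact n (subtopology X S) c"
  using exact_subtopology[of n "subtopology X T" c S] by (simp add: subtopology_subtopology Int_absorb1)

lemma exact_pull:
  assumes "exact n Y c" "continuous_map X Y f" shows "exact n X (pull n f c)"
proof (cases n)
  case 0
  then show ?thesis
    using assms cochain_eq_pull[of 0 Y c "\<lambda>_. 0" X f] by (simp add: exact_rel_0 pull_def)
next
  case (Suc m)
  then obtain d where "cochain_eq (Suc m) Y c (cbd m d)"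
    using assms by (auto simp: exact_Suc)
  from cochain_eq_pull[OF this assms(2)] show ?thesis
    unfolding Suc exact_Suc pull_cbd by blast
qed

text \<open>
  Together with the next lemma: exact cochains form a two-sided ideal among cocycles, since
  \<open>\<delta> (e d) = (\<delta> e) d\<close> and \<open>\<delta> (d e) = \<plusminus> d (\<delta> e)\<close> for a cocycle \<open>d\<close>.
\<close>

lemma exact_cup_left:
  assumes "exact n X c" "cocycle m X d" shows "exact (n + m) X (cup n m c d)"
proof (cases n)
  case 0
  then have "cochain_eq (n + m) X (cup n m c d) (\<lambda>_. 0)"
    using assms singular_simplex_front[of m X _ 0] by (simp add: exact_rel_0 cochain_eq_def cup_def)
  then show ?thesis using exact_rel_cong exact_rel_zero by metis
next
  case (Suc k)
  then obtain e where "cochain_eq (Suc k) X c (cbd k e)" using assms by (auto simp: exact_Suc)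
  then have "cochain_eq (n + m) X (cup n m c d) (cup n m (cbd k e) d)"
    unfolding Suc by (rule cochain_eq_cup) simp
  also have "cochain_eq (n + m) X (cup n m (cbd k e) d) (cbd (k + m) (cup k m e d))"
    using cbd_cup_cocycle_right[OF assms(2), THEN cochain_eq_sym, of k e] by (simp add: Suc)
  finally show ?thesis unfolding Suc using exact_Suc by (metis add_Suc)
qed

lemma exact_cup_right:
  assumes "exact n X c" "cocycle m X d" shows "exact (m + n) X (cup m n d c)"
proof (cases n)
  case 0
  then have "cochain_eq (m + n) X (cup m n d c) (\<lambda>_. 0)"
    using assms singular_simplex_back[of m 0 X] by (simp add: exact_rel_0 cochain_eq_def cup_def)
  then show ?thesis using exact_rel_cong exact_rel_zero by metis
next
  case (Suc k)
  then obtain e where "cochain_eq (Suc k) X c (cbd k e)" using assms by (auto simp: exact_Suc)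
  then have "cochain_eq (m + n) X (cup m n d c) (cup m n d (cbd k e))"
    unfolding Suc by (rule cochain_eq_cup[rotated]) simp
  moreover have "exact (m + n) X (cup m n d (cbd k e))"
  proof -
    have "exact (Suc (m + k)) X (\<lambda>\<sigma>. (-1) ^ m * cup m (Suc k) d (cbd k e) \<sigma>)"
      using exact_rel_cong[OF cbd_cup_cocycle_left[OF assms(2), of k e], of "{}"] exact_cbd by blast
    then show ?thesis by (simp add: exact_scale_sign Suc)
  qed
  ultimately show ?thesis using exact_rel_cong by metis
qed

text \<open>
  A primitive \<open>d\<close> can be replaced by \<open>d - r\<^sup>* d\<close>, which is zero on \<open>S\<close>; its coboundary is still \<open>c\<close>, because
  \<open>r\<^sup>* c\<close> depends only on the values of \<open>c\<close> on \<open>S\<close>.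
\<close>

lemma exact_rel_retract:
  assumes c: "exact n X c" "vanishes n X {S} c"
    and r: "continuous_map X (subtopology X S) r" "\<And>x. x \<in> topspace X \<inter> S \<Longrightarrow> r x = x"
  shows "exact_rel n X {S} c"
proof (cases n)
  case 0
  then show ?thesis using c by (simp add: exact_rel_0)
next
  case (Suc m)
  obtain d where d: "cochain_eq (Suc m) X c (cbd m d)" using c Suc by (auto simp: exact_Suc)
  have "cochain_eq (Suc m) X (pull (Suc m) r c) (\<lambda>_. 0)"
    using cochain_eq_pull[of "Suc m" "subtopology X S" c "\<lambda>_. 0" X r] c r Suc by (simp add: vanishes_sing pull_def)
  moreover have "continuous_map X X r"
    using r(1) by (simp add: continuous_map_in_subtopology)
  then have "cochain_eq (Suc m) X (pull (Suc m) r c) (cbd m (pull m r d))"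
    using cochain_eq_pull[OF d] by (simp add: pull_cbd)
  ultimately have "cochain_eq (Suc m) X c (cbd m (\<lambda>\<sigma>. d \<sigma> - pull m r d \<sigma>))"
    using d by (simp add: cochain_eq_def cbd_diff)
  moreover have "vanishes m X {S} (\<lambda>\<sigma>. d \<sigma> - pull m r d \<sigma>)"
    using pull_cochain_eq_self[of "subtopology X S" r m d] r(2) by (simp add: vanishes_sing cochain_eq_def)
  ultimately show ?thesis unfolding Suc exact_rel_Suc by blast
qed

section \<open>Suspension\<close>

text \<open>
  The situation in which cohomology is shifted by one degree. For the product of \<open>X\<close> with the suspension
  \<open>S\<^sup>k\<^sup>+\<^sup>1\<close> of \<open>S\<^sup>k\<close>, the sets \<open>U\<close> and \<open>V\<close> lie over the two punctured spheres, \<open>Q\<close> lies over the equator \<open>S\<^sup>k\<close>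
  and \<open>P\<close> over a basepoint on it. Relative to \<open>P\<close>, both \<open>U\<close> and \<open>V\<close> have no cohomology, while \<open>U \<inter> V\<close>
  has that of \<open>Q\<close>. The maps \<open>\<rho>\<close> and \<open>\<tau>\<close> are retractions of \<open>U \<inter> V\<close> onto \<open>Q\<close> and of \<open>Y\<close> onto \<open>P\<close>.
\<close>

locale suspension =
  fixes Y :: "'a topology" and U V P Q :: "'a set" and \<rho> \<tau> :: "'a \<Rightarrow> 'a"
  assumes acyclic_cover: "chain_acyclic Y {U, V}"
    and acyclic_U: "chain_acyclic (subtopology Y U) {P}"
    and acyclic_V: "chain_acyclic (subtopology Y V) {P}"
    and acyclic_UV: "chain_acyclic (subtopology Y (U \<inter> V)) {Q}"
    and PQ: "P \<subseteq> Q" and QUV: "Q \<subseteq> U \<inter> V"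
    and \<rho>: "continuous_map (subtopology Y (U \<inter> V)) (subtopology Y Q) \<rho>" "\<And>x. x \<in> topspace Y \<inter> Q \<Longrightarrow> \<rho> x = x"
    and \<tau>: "continuous_map Y (subtopology Y P) \<tau>" "\<And>x. x \<in> topspace Y \<inter> P \<Longrightarrow> \<tau> x = x"
begin

lemma base_subsets: "P \<subseteq> U" "P \<subseteq> V" "Q \<subseteq> U" "Q \<subseteq> V" "P \<subseteq> U \<inter> V"
  using PQ QUV by auto

text \<open>
  The graph of the Mayer-Vietoris connecting map, with \<open>f'\<close> on \<open>Q\<close> as its argument and \<open>f\<close> on \<open>Y\<close> as its
  value. As a relation between cocycles it needs no choice of primitives, and its compatibility with
  products is a computation. The primitives vanish on \<open>P\<close>, which makes them unique up to exact cochains.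
\<close>

definition susp :: "nat \<Rightarrow> ('a, 'c::comm_ring_1) cochain \<Rightarrow> ('a, 'c) cochain \<Rightarrow> bool"
  where "susp n f f' \<longleftrightarrow> (\<exists>gU gV.
    cochain_eq (Suc n) (subtopology Y U) f (cbd n gU) \<and>
    cochain_eq (Suc n) (subtopology Y V) f (cbd n gV) \<and>
    vanishes n Y {P} gU \<and> vanishes n Y {P} gV \<and>
    cochain_eq n (subtopology Y Q) f' (\<lambda>\<sigma>. gU \<sigma> - gV \<sigma>))"

lemma exact_if_exact_rel_cover:
  "cocycle n Y c \<Longrightarrow> vanishes n Y {U, V} c \<Longrightarrow> exact_rel n Y {U, V} c"
  by (rule exact_rel_if_chain_acyclic[OF acyclic_cover])

lemma exact_rel_U:
  assumes "cocycle n Y c" "vanishes n Y {P} c" shows "exact_rel n (subtopology Y U) {P} c"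
  using assms by (intro exact_rel_if_chain_acyclic[OF acyclic_U] cocycle_subtopology vanishes_subtopology)

lemma exact_rel_V:
  assumes "cocycle n Y c" "vanishes n Y {P} c" shows "exact_rel n (subtopology Y V) {P} c"
  using assms by (intro exact_rel_if_chain_acyclic[OF acyclic_V] cocycle_subtopology vanishes_subtopology)

lemma exact_degree_0:
  assumes "cocycle 0 Y f" "vanishes 0 Y {P} f" shows "exact 0 Y f"
proof -
  have "vanishes 0 Y {U, V} f"
    using exact_rel_U[OF assms] exact_rel_V[OF assms] by (simp add: vanishes_pair vanishes_sing exact_rel_0)
  with assms show ?thesis using exact_if_exact_rel_cover exact_rel_imp_exact by blast
qed

lemma primitives:
  assumes f: "cocycle (Suc n) Y f" "vanishes (Suc n) Y {P} f"
  obtains gU gV where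
    "cochain_eq (Suc n) (subtopology Y U) f (cbd n gU)"
    "cochain_eq (Suc n) (subtopology Y V) f (cbd n gV)"
    "vanishes n Y {P} gU" "vanishes n Y {P} gV"
  using exact_rel_U[OF f] exact_rel_V[OF f] unfolding exact_rel_Suc vanishes_subtopology_iff[OF base_subsets(1)] vanishes_subtopology_iff[OF base_subsets(2)] by blast

text \<open>
  A cocycle vanishing on \<open>P\<close> has primitives over \<open>U\<close> and over \<open>V\<close>; their difference on \<open>Q\<close> is \<open>f'\<close>.
\<close>

lemma desuspend:
  assumes f: "cocycle (Suc n) Y f" "vanishes (Suc n) Y {P} f"
  obtains f' where "cocycle n (subtopology Y Q) f'" "vanishes n (subtopology Y Q) {P} f'" "susp n f f'"
proof -
  obtain gU gV where *: "cochain_eq (Suc n) (subtopology Y U) f (cbd n gU)"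
    "cochain_eq (Suc n) (subtopology Y V) f (cbd n gV)"
    "vanishes n Y {P} gU" "vanishes n Y {P} gV"
    using primitives[OF f] .
  let ?f' = "\<lambda>\<sigma>. gU \<sigma> - gV \<sigma>"
  have "cocycle n (subtopology Y Q) ?f'"
    using cochain_eq_mono[OF *(1) base_subsets(3)] cochain_eq_mono[OF *(2) base_subsets(4)]
    by (simp add: cocycle_def cochain_eq_def cbd_diff)
  moreover have "vanishes n (subtopology Y Q) {P} ?f'"
    using *(3,4) by (intro vanishes_subtopology vanishes_diff)
  moreover have "susp n f ?f'"
    unfolding susp_def using * cochain_eq_refl by blast
  ultimately show ?thesis using that by blast
qed

text \<open>
  Take \<open>\<rho>\<^sup>* f'\<close> as the primitive over \<open>U\<close> and \<open>0\<close> as the one over \<open>V\<close>. Their coboundaries agree on \<open>U \<inter> V\<close> as \<open>f'\<close>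
  is a cocycle, so they fit together to a cochain \<open>F\<close> that is a cocycle on the small simplices. By
  acyclicity of the cover \<open>\<delta> F = \<delta> e\<close> with \<open>e\<close> zero on small simplices, and \<open>F - e\<close> is the cocycle sought.
\<close>

lemma suspend:
  assumes f': "cocycle n (subtopology Y Q) f'" "vanishes n (subtopology Y Q) {P} f'"
  obtains f where "cocycle (Suc n) Y f" "vanishes (Suc n) Y {P} f" "susp n f f'"
proof -
  let ?g = "pull n \<rho> f'"
  have g_cocycle: "cocycle n (subtopology Y (U \<inter> V)) ?g"
    by (rule cocycle_pull[OF f'(1) \<rho>(1)])
  have g_Q: "cochain_eq n (subtopology Y Q) ?g f'"
    by (rule pull_cochain_eq_self) (simp add: \<rho>(2))
  define F where "F = (\<lambda>\<sigma>. if \<sigma> ` standard_simplex (Suc n) \<subseteq> U then cbd n ?g \<sigma> else 0)"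
  have FU: "cochain_eq (Suc n) (subtopology Y U) F (cbd n ?g)"
    by (simp add: F_def cochain_eq_def singular_simplex_subtopology)
  have FV: "cochain_eq (Suc n) (subtopology Y V) F (\<lambda>_. 0)"
    using g_cocycle by (simp add: F_def cocycle_def cochain_eq_def singular_simplex_subtopology)
  have "vanishes (Suc (Suc n)) Y {U} (cbd (Suc n) F)"
    using cochain_eq_cbd[OF FU] cbd_cbd by (auto simp: vanishes_sing cochain_eq_def)
  moreover have "vanishes (Suc (Suc n)) Y {V} (cbd (Suc n) F)"
    using cochain_eq_cbd[OF FV] by (simp add: vanishes_sing cbd_zero)
  ultimately have "vanishes (Suc (Suc n)) Y {U, V} (cbd (Suc n) F)"
    by (simp add: vanishes_pair)
  then obtain e where e: "vanishes (Suc n) Y {U, V} e" "cochain_eq (Suc (Suc n)) Y (cbd (Suc n) F) (cbd (Suc n) e)"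
    using exact_if_exact_rel_cover[OF cocycle_cbd] by (auto simp: exact_rel_Suc)
  let ?f = "\<lambda>\<sigma>. F \<sigma> - e \<sigma>"
  have eU: "cochain_eq (Suc n) (subtopology Y U) e (\<lambda>_. 0)" and eV: "cochain_eq (Suc n) (subtopology Y V) e (\<lambda>_. 0)"
    using e(1) by (simp_all add: vanishes_pair vanishes_sing)
  have fU: "cochain_eq (Suc n) (subtopology Y U) ?f (cbd n ?g)"
    using FU eU by (simp add: cochain_eq_def)
  have fV: "cochain_eq (Suc n) (subtopology Y V) ?f (\<lambda>_. 0)"
    using FV eV by (simp add: cochain_eq_def)
  have "cocycle (Suc n) Y ?f"
    using e(2) by (simp add: cocycle_def cochain_eq_def cbd_diff)
  moreover have "vanishes (Suc n) Y {P} ?f"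
    using fV base_subsets(2) cochain_eq_mono by (auto simp: vanishes_sing)
  moreover have "susp n ?f f'"
  proof -
    have "vanishes n Y {P} ?g"
      using f'(2) cochain_eq_mono[OF g_Q PQ] unfolding vanishes_subtopology_iff[OF PQ]
      by (simp add: vanishes_sing cochain_eq_def)
    then show ?thesis
      unfolding susp_def using fU fV g_Q
      by (intro exI[of _ ?g] exI[of _ "\<lambda>_. 0"]) (simp add: cbd_zero cochain_eq_sym vanishes_def)
  qed
  ultimately show ?thesis using that by blast
qed

text \<open>
  If \<open>f = \<delta> h\<close>, then \<open>gU - h\<close> and \<open>gV - h\<close> are cocycles on \<open>U\<close> and \<open>V\<close> that vanish on \<open>P\<close>, hence are exact, and
  \<open>f'\<close> is their difference. The retraction \<open>\<tau>\<close> provides an \<open>h\<close> vanishing on \<open>P\<close>.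
\<close>

lemma exact_desuspend:
  assumes s: "susp n f f'" and f: "exact (Suc n) Y f" "vanishes (Suc n) Y {P} f"
  shows "exact n (subtopology Y Q) f'"
proof -
  obtain gU gV where *: "cochain_eq (Suc n) (subtopology Y U) f (cbd n gU)"
    "cochain_eq (Suc n) (subtopology Y V) f (cbd n gV)"
    "vanishes n Y {P} gU" "vanishes n Y {P} gV"
    "cochain_eq n (subtopology Y Q) f' (\<lambda>\<sigma>. gU \<sigma> - gV \<sigma>)"
    using s unfolding susp_def by blast
  obtain h where h: "vanishes n Y {P} h" "cochain_eq (Suc n) Y f (cbd n h)"
    using exact_rel_retract[OF f \<tau>] by (auto simp: exact_rel_Suc)
  have "exact n (subtopology Y S) (\<lambda>\<sigma>. g \<sigma> - h \<sigma>)"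
    if "chain_acyclic (subtopology Y S) {P}" "cochain_eq (Suc n) (subtopology Y S) f (cbd n g)" "vanishes n Y {P} g" for S g
  proof -
    have "cocycle n (subtopology Y S) (\<lambda>\<sigma>. g \<sigma> - h \<sigma>)"
      using that(2) cochain_eq_subtopology[OF h(2), of S] by (simp add: cocycle_def cochain_eq_def cbd_diff)
    moreover have "vanishes n (subtopology Y S) {P} (\<lambda>\<sigma>. g \<sigma> - h \<sigma>)"
      using that(3) h(1) by (intro vanishes_subtopology vanishes_diff)
    ultimately show ?thesis
      using exact_rel_if_chain_acyclic[OF that(1)] exact_rel_imp_exact by blast
  qed
  then have "exact n (subtopology Y Q) (\<lambda>\<sigma>. gU \<sigma> - h \<sigma>)" "exact n (subtopology Y Q) (\<lambda>\<sigma>. gV \<sigma> - h \<sigma>)"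
    using * acyclic_U acyclic_V exact_mono base_subsets by blast+
  then have "exact n (subtopology Y Q) (\<lambda>\<sigma>. (gU \<sigma> - h \<sigma>) - (gV \<sigma> - h \<sigma>))"
    by (rule exact_rel_diff)
  then show ?thesis
    using exact_rel_cong[OF *(5)] by simp
qed

text \<open>
  If \<open>f'\<close> is exact on \<open>Q\<close>, the difference of the primitives is exact on \<open>U \<inter> V\<close>, of which \<open>Q\<close> is a
  deformation retract. After changing the primitive on \<open>U\<close> by a cocycle \<open>E\<close> the two agree on \<open>U \<inter> V\<close> and
  glue to a primitive of \<open>f\<close> on all small simplices, which is enough by acyclicity of the cover.
\<close>

lemma exact_suspend:
  assumes s: "susp n f f'" and f': "exact n (subtopology Y Q) f'" and f: "cocycle (Suc n) Y f"
  shows "exact (Suc n) Y f"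
proof -
  obtain gU gV where *: "cochain_eq (Suc n) (subtopology Y U) f (cbd n gU)"
    "cochain_eq (Suc n) (subtopology Y V) f (cbd n gV)"
    "cochain_eq n (subtopology Y Q) f' (\<lambda>\<sigma>. gU \<sigma> - gV \<sigma>)"
    using s unfolding susp_def by blast
  let ?W = "subtopology Y (U \<inter> V)" and ?k = "\<lambda>\<sigma>. gU \<sigma> - gV \<sigma>"
  have k: "cocycle n ?W ?k"
    using cochain_eq_mono[OF *(1), of "U \<inter> V"] cochain_eq_mono[OF *(2), of "U \<inter> V"]
    by (simp add: cocycle_def cochain_eq_def cbd_diff)
  have ex: "exact n ?W (pull n \<rho> f')"
    using f' \<rho>(1) by (rule exact_pull)
  have "cochain_eq n (subtopology Y Q) (pull n \<rho> f') f'"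
    by (rule pull_cochain_eq_self) (simp add: \<rho>(2))
  then have "vanishes n ?W {Q} (\<lambda>\<sigma>. ?k \<sigma> - pull n \<rho> f' \<sigma>)"
    unfolding vanishes_subtopology_iff[OF QUV] using *(3) by (simp add: vanishes_sing cochain_eq_def)
  then have "exact n ?W (\<lambda>\<sigma>. ?k \<sigma> - pull n \<rho> f' \<sigma>)"
    using exact_rel_if_chain_acyclic[OF acyclic_UV cocycle_diff[OF k exact_imp_cocycle[OF ex]]]
      exact_rel_imp_exact by blast
  from exact_rel_add[OF this ex] have exk: "exact n ?W ?k"
    by simp
  \<comment> \<open>A coboundary is given by a formula that makes sense on all of \<open>Y\<close>, so a primitive over
    \<open>U \<inter> V\<close> yields a cocycle \<open>E\<close> on the whole space.\<close>
  obtain E where E: "cochain_eq n ?W ?k E" "cocycle n Y E"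
  proof (cases n)
    case 0
    then have "cochain_eq n ?W ?k (\<lambda>_. 0)"
      using exk by (simp add: exact_rel_0)
    then show ?thesis using that cocycle_zero by blast
  next
    case (Suc m)
    then show ?thesis using exk that cocycle_cbd by (auto simp: exact_Suc)
  qed
  define h where "h = (\<lambda>\<sigma>. if \<sigma> ` standard_simplex n \<subseteq> U then gU \<sigma> - E \<sigma> else gV \<sigma>)"
  have hU: "cochain_eq n (subtopology Y U) h (\<lambda>\<sigma>. gU \<sigma> - E \<sigma>)"
    by (simp add: h_def cochain_eq_def singular_simplex_subtopology)
  have hV: "cochain_eq n (subtopology Y V) h gV"
    using E(1) by (auto simp: h_def cochain_eq_def singular_simplex_subtopology algebra_simps)
  let ?d = "\<lambda>\<sigma>. f \<sigma> - cbd n h \<sigma>"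
  have "vanishes (Suc n) Y {U} ?d"
    using cochain_eq_cbd[OF hU] *(1) cocycle_subtopology[OF E(2), of U]
    by (simp add: vanishes_sing cochain_eq_def cbd_diff cocycle_def)
  moreover have "vanishes (Suc n) Y {V} ?d"
    using cochain_eq_cbd[OF hV] *(2) by (simp add: vanishes_sing cochain_eq_def)
  ultimately have "exact (Suc n) Y ?d"
    using exact_if_exact_rel_cover[OF cocycle_diff[OF f cocycle_cbd]] exact_rel_imp_exact
    unfolding vanishes_pair by blast
  from exact_rel_add[OF this exact_cbd[of n Y h]] show ?thesis by simp
qed

text \<open>
  The connecting map is linear, up to sign, for multiplication by cocycles of \<open>Y\<close> on both sides:
  multiplying the primitives of \<open>f\<close> gives primitives of the product. The sign comes from moving the
  coboundary past \<open>u\<close>.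
\<close>

lemma susp_cup:
  assumes s: "susp n f f'" and u: "cocycle a Y u" and w: "cocycle b Y w"
  shows "susp (a + (n + b)) (cup a (Suc n + b) u (cup (Suc n) b f w))
    (\<lambda>\<sigma>. (-1) ^ a * cup a (n + b) u (cup n b f' w) \<sigma>)"
proof -
  obtain gU gV where *: "cochain_eq (Suc n) (subtopology Y U) f (cbd n gU)"
    "cochain_eq (Suc n) (subtopology Y V) f (cbd n gV)"
    "vanishes n Y {P} gU" "vanishes n Y {P} gV"
    "cochain_eq n (subtopology Y Q) f' (\<lambda>\<sigma>. gU \<sigma> - gV \<sigma>)"
    using s unfolding susp_def by blast
  let ?m = "\<lambda>g \<sigma>. (-1) ^ a * cup a (n + b) u (cup n b g w) \<sigma>"
  have 1: "cochain_eq (Suc (a + (n + b))) (subtopology Y S) (cup a (Suc n + b) u (cup (Suc n) b f w)) (cbd (a + (n + b)) (?m g))"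
    if g: "cochain_eq (Suc n) (subtopology Y S) f (cbd n g)" for S g
  proof -
    let ?S = "subtopology Y S"
    have "cochain_eq (Suc n + b) ?S (cup (Suc n) b f w) (cup (Suc n) b (cbd n g) w)"
      using g by (rule cochain_eq_cup) simp
    also have "cochain_eq (Suc n + b) ?S (cup (Suc n) b (cbd n g) w) (cbd (n + b) (cup n b g w))"
      using cbd_cup_cocycle_right[OF cocycle_subtopology[OF w, of S], THEN cochain_eq_sym, of n g] by simp
    finally have "cochain_eq (a + (Suc n + b)) ?S (cup a (Suc n + b) u (cup (Suc n) b f w)) (cup a (Suc n + b) u (cbd (n + b) (cup n b g w)))"
      by (rule cochain_eq_cup[rotated]) simp
    moreover have "cochain_eq (Suc (a + (n + b))) ?S (cbd (a + (n + b)) (?m g)) (cup a (Suc n + b) u (cbd (n + b) (cup n b g w)))"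
      using cbd_cup_cocycle_left[OF cocycle_subtopology[OF u, of S], of "n + b" "cup n b g w"]
      by (simp add: cbd_scale cochain_eq_def flip: mult.assoc power_add)
    ultimately show ?thesis
      by (simp add: cochain_eq_def)
  qed
  have 2: "vanishes (a + (n + b)) Y {P} (?m g)" if "vanishes n Y {P} g" for g
    using that by (intro vanishes_scale vanishes_cup_right vanishes_cup_left)
  have 3: "cochain_eq (a + (n + b)) (subtopology Y Q) (?m f') (\<lambda>\<sigma>. ?m gU \<sigma> - ?m gV \<sigma>)"
  proof -
    have "cochain_eq (a + (n + b)) (subtopology Y Q) (cup a (n + b) u (cup n b f' w)) (cup a (n + b) u (cup n b (\<lambda>\<sigma>. gU \<sigma> - gV \<sigma>) w))"
      using *(5) by (intro cochain_eq_cup) simp_all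
    moreover have "(-1) ^ a * cup a (n + b) u (cup n b (\<lambda>\<sigma>. gU \<sigma> - gV \<sigma>) w) \<sigma> = ?m gU \<sigma> - ?m gV \<sigma>" for \<sigma>
      by (simp add: cup_def algebra_simps)
    ultimately show ?thesis
      by (simp add: cochain_eq_def)
  qed
  show ?thesis
    unfolding susp_def using 1[OF *(1)] 1[OF *(2)] 2[OF *(3)] 2[OF *(4)] 3 by blast
qed

lemma exact_susp_iff:
  assumes s: "susp n f f'" and f: "cocycle (Suc n) Y f" "vanishes (Suc n) Y {P} f"
    and u: "cocycle a Y u" and w: "cocycle b Y w"
  shows "exact (a + (Suc n + b)) Y (cup a (Suc n + b) u (cup (Suc n) b f w)) \<longleftrightarrow>
    exact (a + (n + b)) (subtopology Y Q) (cup a (n + b) u (cup n b f' w))"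
proof -
  let ?F = "cup a (Suc n + b) u (cup (Suc n) b f w)"
  let ?G = "\<lambda>\<sigma>. (-1) ^ a * cup a (n + b) u (cup n b f' w) \<sigma>"
  have deg: "a + (Suc n + b) = Suc (a + (n + b))"
    by simp
  have cF: "cocycle (Suc (a + (n + b))) Y ?F"
    unfolding deg[symmetric] using f u w by (intro cocycle_cup)
  have vF: "vanishes (Suc (a + (n + b))) Y {P} ?F"
    unfolding deg[symmetric] using f by (intro vanishes_cup_right vanishes_cup_left)
  have sF: "susp (a + (n + b)) ?F ?G"
    by (rule susp_cup[OF s u w])
  have "exact (Suc (a + (n + b))) Y ?F \<longleftrightarrow> exact (a + (n + b)) (subtopology Y Q) ?G"
    using exact_suspend[OF sF _ cF] exact_desuspend[OF sF _ vF] by (rule iffI[rotated])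
  then show ?thesis
    unfolding deg exact_scale_sign .
qed

text \<open>
  The reason why a suspension has trivial products: \<open>f - \<delta> x\<close> vanishes over \<open>U\<close> for a primitive \<open>x\<close> of \<open>f\<close>
  over \<open>U\<close>, and likewise \<open>g - \<delta> y\<close> over \<open>V\<close>. The product of these two vanishes on all small simplices and
  is therefore exact, and it differs from \<open>f g\<close> by exact terms.
\<close>

lemma exact_cup_relative:
  assumes f: "cocycle n Y f" "vanishes n Y {P} f" and g: "cocycle m Y g" "vanishes m Y {P} g"
  shows "exact (n + m) Y (cup n m f g)"
proof (cases "n = 0 \<or> m = 0")
  case True
  then show ?thesis
    using f g exact_degree_0 exact_cup_left exact_cup_right by blast
next
  case False
  then obtain n' m' where [simp]: "n = Suc n'" "m = Suc m'"
    by (meson not0_implies_Suc)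
  obtain x where x: "cochain_eq n (subtopology Y U) f (cbd n' x)"
    using primitives f by (metis \<open>n = Suc n'\<close>)
  obtain y where y: "cochain_eq m (subtopology Y V) g (cbd m' y)"
    using primitives g by (metis \<open>m = Suc m'\<close>)
  let ?f = "\<lambda>\<sigma>. f \<sigma> - cbd n' x \<sigma>" and ?g = "\<lambda>\<sigma>. g \<sigma> - cbd m' y \<sigma>"
  have cf: "cocycle n Y ?f" and cg: "cocycle m Y ?g"
    using f g by (simp_all add: cocycle_diff cocycle_cbd)
  have "vanishes n Y {U} ?f" "vanishes m Y {V} ?g"
    using x y by (simp_all add: vanishes_sing cochain_eq_def)
  then have "vanishes (n + m) Y {U, V} (cup n m ?f ?g)"
    unfolding vanishes_pair using vanishes_cup_left vanishes_cup_right by blast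
  then have "exact (n + m) Y (cup n m ?f ?g)"
    using exact_if_exact_rel_cover[OF cocycle_cup[OF cf cg]] exact_rel_imp_exact by blast
  moreover have "exact (n + m) Y (cup n m (cbd n' x) g)"
    using exact_cup_left[OF exact_cbd, of m Y g n' x] g by simp
  moreover have "exact (n + m) Y (cup n m ?f (cbd m' y))"
    using exact_cup_right[OF exact_cbd, of n Y ?f m' y] cf by simp
  ultimately have "exact (n + m) Y (\<lambda>\<sigma>. cup n m ?f ?g \<sigma> + cup n m (cbd n' x) g \<sigma> + cup n m ?f (cbd m' y) \<sigma>)"
    by (intro exact_rel_add)
  then show ?thesis
    by (simp add: cup_def algebra_simps)
qed

end

section \<open>Products with spheres as suspensions\<close>

lemma small_simplex_topspace: "small_simplex n X ((\<inter>) (topspace X) ` \<S>) = small_simplex n X \<S>"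
proof
  fix \<sigma> :: "(nat \<Rightarrow> real) \<Rightarrow> 'a"
  have "\<sigma> ` standard_simplex n \<subseteq> topspace X" if "singular_simplex n X \<sigma>"
    using that continuous_map_image_subset_topspace by (fastforce simp: singular_simplex_def)
  then show "small_simplex n X ((\<inter>) (topspace X) ` \<S>) \<sigma> = small_simplex n X \<S> \<sigma>"
    by (auto simp: small_simplex_def)
qed

text \<open>
  For covers by sets that are not contained in the space, such as the cones over the caps of a sphere.
\<close>

lemma chain_acyclic_relatively_open_cover:
  assumes "\<And>U. U \<in> \<U> \<Longrightarrow> openin X (topspace X \<inter> U)" "topspace X \<subseteq> \<Union>\<U>"
  shows "chain_acyclic X \<U>"
proof -
  have "chain_acyclic X ((\<inter>) (topspace X) ` \<U>)"
    using assms by (intro chain_acyclic_open_cover) auto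
  then show ?thesis
    by (simp add: chain_acyclic_def small_chain_def small_simplex_topspace)
qed

text \<open>
  The factor \<open>UNIV\<close> spares mentioning \<open>topspace X\<close> in the sets lying over a part of \<open>T\<close>.
\<close>

lemma subtopology_prod_snd:
  "subtopology (prod_topology X T) (UNIV \<times> A) = prod_topology X (subtopology T A)"
proof -
  have "topspace (prod_topology X T) \<inter> (UNIV \<times> A) = topspace (prod_topology X T) \<inter> (topspace X \<times> A)"
    by auto
  then show ?thesis
    by (metis prod_topology_subtopology(2) subtopology_restrict)
qed

lemma continuous_map_Times:
  assumes "continuous_map T T' \<rho>"
  shows "continuous_map (prod_topology X T) (prod_topology X T') (\<lambda>z. (fst z, \<rho> (snd z)))"
  using continuous_map_compose[OF continuous_map_snd assms] by (simp add: continuous_map_paired continuous_map_fst o_def)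

lemma chain_acyclic_times:
  assumes \<rho>: "continuous_map T (subtopology T S) \<rho>" "\<And>t. t \<in> topspace T \<inter> S \<Longrightarrow> \<rho> t = t"
    and hom: "homotopic_with (\<lambda>_. True) T T id \<rho>"
  shows "chain_acyclic (prod_topology X T) {UNIV \<times> S}"
proof (rule chain_acyclic_retract[where f = "\<lambda>z. (fst z, \<rho> (snd z))"])
  let ?f = "\<lambda>z. (fst z, \<rho> (snd z))"
  have *: "continuous_map (prod_topology X T) (prod_topology X (subtopology T S)) ?f"
    by (rule continuous_map_Times[OF \<rho>(1)])
  then show "continuous_map (prod_topology X T) (subtopology (prod_topology X T) (UNIV \<times> S)) ?f"
    by (simp add: subtopology_prod_snd)
  show "homotopic_with (\<lambda>h. True) (subtopology (prod_topology X T) (UNIV \<times> S))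
      (subtopology (prod_topology X T) (UNIV \<times> S)) ?f id"
  proof (rule homotopic_with_equal)
    have "continuous_map (subtopology T S) (subtopology T S) \<rho>"
      using \<rho>(1) by (rule continuous_map_from_subtopology)
    then show "continuous_map (subtopology (prod_topology X T) (UNIV \<times> S)) (subtopology (prod_topology X T) (UNIV \<times> S)) ?f"
      unfolding subtopology_prod_snd by (rule continuous_map_Times)
  qed (auto simp: \<rho>(2))
  have "homotopic_with (\<lambda>_. True) (prod_topology X T) (prod_topology X T) (\<lambda>z. (id (fst z), id (snd z))) (\<lambda>z. (id (fst z), \<rho> (snd z)))"
    by (rule homotopic_with_prod_topology[OF _ hom]) (auto simp: homotopic_with_refl)
  then show "homotopic_with (\<lambda>k. True) (prod_topology X T) (prod_topology X T) ?f id"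
    by (subst homotopic_with_sym) (simp add: id_def)
qed

definition normalise :: "nat \<Rightarrow> (nat \<Rightarrow> real) \<Rightarrow> nat \<Rightarrow> real"
  where "normalise n x = (\<lambda>i. x i / sqrt (\<Sum>j\<le>n. (x j)\<^sup>2))"

lemma sum_squares_pos:
  fixes x :: "nat \<Rightarrow> real"
  assumes "\<exists>i\<le>n. x i \<noteq> 0" shows "0 < (\<Sum>j\<le>n. (x j)\<^sup>2)"
  using assms sum_pos2[of "{..n}" _ "\<lambda>j. (x j)\<^sup>2"] by auto

lemma topspace_nsphere: "topspace (nsphere n) = {x. (\<Sum>i\<le>n. (x i)\<^sup>2) = 1 \<and> (\<forall>i>n. x i = 0)}"
  by (simp add: nsphere)

lemma normalise_in_nsphere:
  assumes "\<exists>i\<le>n. x i \<noteq> 0" "\<And>i. n < i \<Longrightarrow> x i = 0"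
  shows "normalise n x \<in> topspace (nsphere n)"
proof -
  have "(\<Sum>i\<le>n. (x i / sqrt (\<Sum>j\<le>n. (x j)\<^sup>2))\<^sup>2) = (\<Sum>i\<le>n. (x i)\<^sup>2) / (\<Sum>j\<le>n. (x j)\<^sup>2)"
    by (simp add: power_divide sum_nonneg flip: sum_divide_distrib)
  then show ?thesis
    using sum_squares_pos[OF assms(1)] assms(2) by (simp add: topspace_nsphere normalise_def)
qed

lemma normalise_unit: "x \<in> topspace (nsphere n) \<Longrightarrow> normalise n x = x"
  by (simp add: topspace_nsphere normalise_def)

lemma nsphere_nonzero: "x \<in> topspace (nsphere n) \<Longrightarrow> \<exists>i\<le>n. x i \<noteq> 0"
  by (rule ccontr) (auto simp: topspace_nsphere)

lemma continuous_map_normalise: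
  assumes f: "\<And>i. continuous_map Z euclideanreal (\<lambda>z. f z i)"
    and nz: "\<And>z. z \<in> topspace Z \<Longrightarrow> \<exists>i\<le>n. f z i \<noteq> 0"
    and z: "\<And>z i. z \<in> topspace Z \<Longrightarrow> n < i \<Longrightarrow> f z i = 0"
    and A: "\<And>z. z \<in> topspace Z \<Longrightarrow> normalise n (f z) \<in> A"
  shows "continuous_map Z (subtopology (nsphere n) A) (\<lambda>z. normalise n (f z))"
proof -
  have "continuous_map Z (powertop_real UNIV) (\<lambda>z. normalise n (f z))"
    unfolding continuous_map_componentwise_UNIV normalise_def
    using sum_squares_pos[OF nz] by (intro allI continuous_intros f) (auto simp: less_le)
  moreover have "(\<lambda>z. normalise n (f z)) \<in> topspace Z \<rightarrow> topspace (nsphere n)"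
    using normalise_in_nsphere[OF nz z] by auto
  ultimately show ?thesis
    unfolding continuous_map_in_subtopology using A
    by (auto simp: nsphere continuous_map_in_subtopology)
qed

text \<open>
  A straight line that avoids the origin can be projected to the sphere. The hypothesis that \<open>A\<close> is
  invariant under scaling keeps the projection in \<open>A\<close>, so that all conditions on the homotopy can be
  checked on the straight line itself.
\<close>

lemma straight_line_homotopy_on_nsphere:
  assumes f: "\<And>i. continuous_map (subtopology (nsphere n) A) euclideanreal (\<lambda>x. f x i)"
    and z: "\<And>x i. x \<in> topspace (nsphere n) \<Longrightarrow> x \<in> A \<Longrightarrow> n < i \<Longrightarrow> f x i = 0"
    and line: "\<And>x s. x \<in> topspace (nsphere n) \<Longrightarrow> x \<in> A \<Longrightarrow> 0 \<le> s \<Longrightarrow> s \<le> 1 \<Longrightarrow> (\<lambda>i. (1 - s) * x i + s * f x i) \<in> A"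
    and cone: "\<And>x c. x \<in> A \<Longrightarrow> 0 < c \<Longrightarrow> (\<lambda>i. x i / c) \<in> A"
    and nz: "\<And>x. x \<in> A \<Longrightarrow> \<exists>i\<le>n. x i \<noteq> 0"
  shows "homotopic_with (\<lambda>_. True) (subtopology (nsphere n) A) (subtopology (nsphere n) A) id (\<lambda>x. normalise n (f x))"
proof -
  let ?S = "subtopology (nsphere n) A"
  let ?Z = "prod_topology (top_of_set {0..1::real}) ?S"
  let ?g = "\<lambda>z i. (1 - fst z) * snd z i + fst z * f (snd z) i"
  have "continuous_map ?Z ?S (\<lambda>z. normalise n (?g z))"
  proof (rule continuous_map_normalise)
    fix i
    have fst: "continuous_map ?Z euclideanreal fst"
      by (rule continuous_map_into_fulltopology[OF continuous_map_fst])
    have 1: "continuous_map ?Z euclideanreal (\<lambda>z. snd z i)"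
      using continuous_map_compose[OF continuous_map_snd continuous_map_from_subtopology[OF continuous_map_nsphere_projection]]
      by (simp add: o_def)
    have 2: "continuous_map ?Z euclideanreal (\<lambda>z. f (snd z) i)"
      using continuous_map_compose[OF continuous_map_snd f] by (simp add: o_def)
    show "continuous_map ?Z euclideanreal (\<lambda>z. ?g z i)"
      by (intro continuous_intros fst 1 2)
  next
    fix z assume "z \<in> topspace ?Z"
    then have z': "0 \<le> fst z" "fst z \<le> 1" "snd z \<in> topspace (nsphere n)" "snd z \<in> A"
      by auto
    then have gA: "?g z \<in> A" using line by blast
    then show "\<exists>i\<le>n. ?g z i \<noteq> 0" by (rule nz)
    then have "0 < sqrt (\<Sum>j\<le>n. (?g z j)\<^sup>2)" using sum_squares_pos by simp
    from cone[OF gA this] show "normalise n (?g z) \<in> A" by (simp add: normalise_def)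
    show "?g z i = 0" if "n < i" for i
      using z[OF z'(3,4) that] z'(3) that by (simp add: topspace_nsphere)
  qed
  then show ?thesis
    by (subst homotopic_with) (auto intro!: exI[of _ "\<lambda>z. normalise n (?g z)"] simp: normalise_unit)
qed

text \<open>
  Inside the sphere \<open>nsphere n\<close> and for \<open>\<epsilon> = \<plusminus>1\<close>, this is the complement of the pole opposite to the one
  with last coordinate \<open>\<epsilon>\<close>. It is written as a cone, so that normalising a vector does not leave it.
\<close>

definition cap :: "nat \<Rightarrow> real \<Rightarrow> (nat \<Rightarrow> real) set"
  where "cap n \<epsilon> = {x. 0 < \<epsilon> * x n \<or> (\<exists>i<n. x i \<noteq> 0)}"

lemma cap_Int: "cap n 1 \<inter> cap n (-1) = {x. \<exists>i<n. x i \<noteq> 0}"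
  by (auto simp: cap_def)

lemma nsphere_subset_caps: "topspace (nsphere n) \<subseteq> cap n 1 \<union> cap n (-1)"
proof
  fix x assume "x \<in> topspace (nsphere n)"
  from nsphere_nonzero[OF this] obtain i where "i \<le> n" "x i \<noteq> 0" by blast
  then show "x \<in> cap n 1 \<union> cap n (-1)"
    by (cases "i = n") (auto simp: cap_def)
qed

lemma openin_cap: "openin (nsphere n) (topspace (nsphere n) \<inter> cap n \<epsilon>)"
proof -
  have "openin (nsphere n) {x \<in> topspace (nsphere n). x n \<in> {r. 0 < \<epsilon> * r}}"
    by (rule openin_continuous_map_preimage[OF continuous_map_nsphere_projection])
      (auto intro!: open_Collect_less continuous_intros)
  moreover have "openin (nsphere n) {x \<in> topspace (nsphere n). x i \<in> - {0}}" for i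
    by (rule openin_continuous_map_preimage[OF continuous_map_nsphere_projection]) auto
  moreover have "topspace (nsphere n) \<inter> cap n \<epsilon> = {x \<in> topspace (nsphere n). x n \<in> {r. 0 < \<epsilon> * r}} \<union>
      (\<Union>i<n. {x \<in> topspace (nsphere n). x i \<in> - {0}})"
    by (auto simp: cap_def)
  ultimately show ?thesis
    by auto
qed

lemma contractible_cap:
  assumes "\<bar>\<epsilon>\<bar> = 1"
  shows "contractible_space (subtopology (nsphere n) (cap n \<epsilon>))"
proof -
  let ?N = "\<lambda>i. if i = n then \<epsilon> else 0"
  have \<epsilon>: "\<epsilon> * \<epsilon> = 1"
    using assms by (auto simp: abs_if split: if_splits)
  then have \<epsilon>0: "\<epsilon> \<noteq> 0" by auto
  have "homotopic_with (\<lambda>_. True) (subtopology (nsphere n) (cap n \<epsilon>)) (subtopology (nsphere n) (cap n \<epsilon>)) id (\<lambda>x. normalise n ?N)"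
  proof (rule straight_line_homotopy_on_nsphere)
    fix x :: "nat \<Rightarrow> real" and s :: real
    assume x: "x \<in> cap n \<epsilon>" and s: "0 \<le> s" "s \<le> 1"
    show "(\<lambda>i. (1 - s) * x i + s * ?N i) \<in> cap n \<epsilon>"
    proof (cases "s = 1 \<or> (\<exists>i<n. x i \<noteq> 0)")
      case True
      then show ?thesis using \<epsilon> s by (auto simp: cap_def)
    next
      case False
      with x s have "0 < \<epsilon> * x n" "s < 1" by (auto simp: cap_def)
      then have "0 < (1 - s) * (\<epsilon> * x n) + s * (\<epsilon> * \<epsilon>)"
        using s \<epsilon> by (simp add: add_pos_nonneg)
      then show ?thesis by (simp add: cap_def algebra_simps)
    qed
  next
    fix x :: "nat \<Rightarrow> real" and c :: real assume "x \<in> cap n \<epsilon>" "0 < c"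
    then show "(\<lambda>i. x i / c) \<in> cap n \<epsilon>" by (auto simp: cap_def)
  next
    fix x :: "nat \<Rightarrow> real" assume "x \<in> cap n \<epsilon>"
    then show "\<exists>i\<le>n. x i \<noteq> 0" by (auto simp: cap_def intro: less_imp_le)
  qed auto
  then show ?thesis
    by (auto simp: contractible_space_def)
qed

definition to_equator :: "nat \<Rightarrow> (nat \<Rightarrow> real) \<Rightarrow> nat \<Rightarrow> real"
  where "to_equator n x = normalise n (\<lambda>i. if i < n then x i else 0)"

lemma to_equator_homotopic:
  "homotopic_with (\<lambda>_. True) (subtopology (nsphere n) {x. \<exists>i<n. x i \<noteq> 0}) (subtopology (nsphere n) {x. \<exists>i<n. x i \<noteq> 0}) id (to_equator n)"
  unfolding to_equator_def
proof (rule straight_line_homotopy_on_nsphere)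
  fix i
  show "continuous_map (subtopology (nsphere n) {x. \<exists>i<n. x i \<noteq> 0}) euclideanreal (\<lambda>x. if i < n then x i else 0)"
    using continuous_map_from_subtopology[OF continuous_map_nsphere_projection] by simp
next
  fix x :: "nat \<Rightarrow> real" and s :: real
  assume "x \<in> {x. \<exists>i<n. x i \<noteq> 0}"
  then obtain i where "i < n" "x i \<noteq> 0" by blast
  then show "(\<lambda>i. (1 - s) * x i + s * (if i < n then x i else 0)) \<in> {x. \<exists>i<n. x i \<noteq> 0}"
    by (auto simp: left_diff_distrib intro!: exI[of _ i])
qed (auto intro: less_imp_le)

lemma continuous_map_to_equator:
  "continuous_map (subtopology (nsphere n) {x. \<exists>i<n. x i \<noteq> 0}) (subtopology (nsphere n) {x. x n = 0}) (to_equator n)"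
  unfolding to_equator_def
proof (rule continuous_map_normalise)
  fix i
  show "continuous_map (subtopology (nsphere n) {x. \<exists>i<n. x i \<noteq> 0}) euclideanreal (\<lambda>x. if i < n then x i else 0)"
    using continuous_map_from_subtopology[OF continuous_map_nsphere_projection] by simp
qed (auto simp: normalise_def intro: less_imp_le)

lemma to_equator_fixes: "x \<in> topspace (nsphere n) \<Longrightarrow> x n = 0 \<Longrightarrow> to_equator n x = x"
proof -
  assume x: "x \<in> topspace (nsphere n)" "x n = 0"
  then have "(\<lambda>i. if i < n then x i else 0) = x"
    by (auto simp: topspace_nsphere fun_eq_iff not_less le_less)
  then show ?thesis using normalise_unit[OF x(1)] by (simp add: to_equator_def)
qed

definition basepoint :: "nat \<Rightarrow> real"
  where "basepoint = (\<lambda>i. if i = 0 then 1 else 0)"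

lemma basepoint_in_nsphere: "basepoint \<in> topspace (nsphere n)"
  using in_topspace_nsphere by (simp add: basepoint_def)

lemma continuous_map_const_basepoint:
  assumes "basepoint \<in> topspace T"
  shows "continuous_map T (subtopology T {basepoint}) (\<lambda>_. basepoint)"
  using assms by simp

lemma chain_acyclic_times_contractible:
  assumes "contractible_space T" "t \<in> topspace T"
  shows "chain_acyclic (prod_topology X T) {UNIV \<times> {t}}"
  using assms by (intro chain_acyclic_times[where \<rho> = "\<lambda>_. t"]) (auto simp: contractible_space_alt)

lemma subtopology_nsphere_Suc: "subtopology (nsphere (Suc k)) (topspace (nsphere k)) = nsphere k"
proof -
  have "topspace (nsphere k) = topspace (nsphere (Suc k)) \<inter> {x. x (Suc k) = 0}"
    by (metis subtopology_nsphere_equator topspace_subtopology)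
  then show ?thesis
    by (metis subtopology_nsphere_equator subtopology_restrict)
qed

text \<open>
  The caps are contractible, and their intersection, where some coordinate other than the last is
  non-zero, is deformed to the equator by shrinking the last coordinate. For \<open>Q\<close> one has to take the set
  \<open>topspace (nsphere k)\<close> and not the hyperplane, which is not contained in the caps.
\<close>

lemma suspension_nsphere:
  "suspension (prod_topology X (nsphere (Suc k))) (UNIV \<times> cap (Suc k) 1) (UNIV \<times> cap (Suc k) (-1))
    (UNIV \<times> {basepoint}) (UNIV \<times> topspace (nsphere k))
    (\<lambda>z. (fst z, to_equator (Suc k) (snd z))) (\<lambda>z. (fst z, basepoint))"
proof -
  let ?n = "Suc k" and ?T = "nsphere (Suc k)"
  let ?Y = "prod_topology X ?T" and ?W = "{x :: nat \<Rightarrow> real. \<exists>i<Suc k. x i \<noteq> 0}"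
  have base: "basepoint \<in> cap ?n \<epsilon>" for \<epsilon> by (auto simp: cap_def basepoint_def)
  have op: "openin ?Y (topspace ?Y \<inter> (UNIV \<times> cap ?n \<epsilon>))" for \<epsilon>
  proof -
    have "topspace ?Y \<inter> (UNIV \<times> cap ?n \<epsilon>) = topspace X \<times> (topspace ?T \<inter> cap ?n \<epsilon>)" by auto
    then show ?thesis using openin_cap[of ?n \<epsilon>] by (simp add: openin_prod_Times_iff)
  qed
  have acap: "chain_acyclic (subtopology ?Y (UNIV \<times> cap ?n \<epsilon>)) {UNIV \<times> {basepoint}}" if "\<bar>\<epsilon>\<bar> = 1" for \<epsilon>
    unfolding subtopology_prod_snd
    using contractible_cap[OF that] base basepoint_in_nsphere by (intro chain_acyclic_times_contractible) auto
  have UV: "(UNIV \<times> cap ?n 1) \<inter> (UNIV \<times> cap ?n (-1)) = UNIV \<times> ?W"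
    using cap_Int[of ?n] by blast
  have eq: "topspace (nsphere k) = topspace ?T \<inter> {x. x ?n = 0}"
    by (metis subtopology_nsphere_equator topspace_subtopology)
  have base_subsets: "topspace (nsphere k) \<subseteq> ?W"
    using nsphere_nonzero[of _ k] by (auto simp: less_Suc_eq_le)
  have cont: "continuous_map (subtopology ?T ?W) (subtopology ?T (topspace (nsphere k))) (to_equator ?n)"
    using continuous_map_to_equator[of ?n] by (simp add: subtopology_nsphere_equator subtopology_nsphere_Suc)
  show ?thesis
  proof
    show "chain_acyclic ?Y {UNIV \<times> cap ?n 1, UNIV \<times> cap ?n (-1)}"
      using op nsphere_subset_caps[of ?n] by (intro chain_acyclic_relatively_open_cover) auto
    show "chain_acyclic (subtopology ?Y (UNIV \<times> cap ?n 1)) {UNIV \<times> {basepoint}}"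
      "chain_acyclic (subtopology ?Y (UNIV \<times> cap ?n (-1))) {UNIV \<times> {basepoint}}"
      by (rule acap, simp)+
    show "chain_acyclic (subtopology ?Y ((UNIV \<times> cap ?n 1) \<inter> (UNIV \<times> cap ?n (-1)))) {UNIV \<times> topspace (nsphere k)}"
      unfolding UV subtopology_prod_snd
    proof (rule chain_acyclic_times[where \<rho> = "to_equator ?n"])
      show "continuous_map (subtopology ?T ?W) (subtopology (subtopology ?T ?W) (topspace (nsphere k))) (to_equator ?n)"
        using cont base_subsets by (simp add: subtopology_subtopology Int_absorb1)
    qed (auto simp: eq to_equator_fixes to_equator_homotopic)
    show "continuous_map (subtopology ?Y ((UNIV \<times> cap ?n 1) \<inter> (UNIV \<times> cap ?n (-1)))) (subtopology ?Y (UNIV \<times> topspace (nsphere k)))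
       (\<lambda>z. (fst z, to_equator ?n (snd z)))"
      unfolding UV subtopology_prod_snd by (rule continuous_map_Times[OF cont])
    show "continuous_map ?Y (subtopology ?Y (UNIV \<times> {basepoint})) (\<lambda>z. (fst z, basepoint))"
      unfolding subtopology_prod_snd
      by (rule continuous_map_Times[OF continuous_map_const_basepoint[OF basepoint_in_nsphere]])
    show "UNIV \<times> topspace (nsphere k) \<subseteq> (UNIV \<times> cap ?n 1) \<inter> (UNIV \<times> cap ?n (-1))"
      unfolding UV using base_subsets by blast
    show "UNIV \<times> {basepoint} \<subseteq> UNIV \<times> topspace (nsphere k)"
      using basepoint_in_nsphere by blast
  qed (auto simp: eq to_equator_fixes)
qed

section \<open>Cocycles on the product with a sphere\<close>

definition antipode :: "nat \<Rightarrow> real"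
  where "antipode = (\<lambda>i. if i = 0 then -1 else 0)"

lemma topspace_nsphere_0: "topspace (nsphere 0) = {basepoint, antipode}"
  by (auto simp: topspace_nsphere basepoint_def antipode_def fun_eq_iff power2_eq_1_iff)

lemma basepoint_neq_antipode: "basepoint \<noteq> antipode"
  by (auto simp: basepoint_def antipode_def fun_eq_iff)

text \<open>
  A simplex is connected, and \<open>S\<^sup>0\<close> consists of two points.
\<close>

lemma singular_simplex_times_nsphere_0:
  assumes "singular_simplex n (prod_topology X (nsphere 0)) \<sigma>"
  shows "\<sigma> ` standard_simplex n \<subseteq> UNIV \<times> {basepoint} \<or> \<sigma> ` standard_simplex n \<subseteq> UNIV \<times> {antipode}"
proof -
  let ?D = "subtopology (powertop_real UNIV) (standard_simplex n)"
  have \<sigma>: "continuous_map ?D (prod_topology X (nsphere 0)) \<sigma>"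
    using assms by (simp add: singular_simplex_def)
  then have im: "\<sigma> ` standard_simplex n \<subseteq> topspace X \<times> {basepoint, antipode}"
    using continuous_map_image_subset_topspace[OF \<sigma>] by (simp add: topspace_nsphere_0)
  have "continuous_map ?D euclideanreal (\<lambda>x. snd (\<sigma> x) 0)"
    using continuous_map_compose[OF continuous_map_compose[OF \<sigma> continuous_map_snd] continuous_map_nsphere_projection]
    by (simp add: o_def)
  then have "connected ((\<lambda>x. snd (\<sigma> x) 0) ` standard_simplex n)"
    using connectedin_continuous_map_image[of ?D euclideanreal _ "standard_simplex n"] connectedin_standard_simplex[of n]
    by (simp add: connectedin_subtopology)
  moreover have "(\<lambda>x. snd (\<sigma> x) 0) ` standard_simplex n \<subseteq> {1, -1}"
    using im by (fastforce simp: basepoint_def antipode_def)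
  then have "finite ((\<lambda>x. snd (\<sigma> x) 0) ` standard_simplex n)"
    by (rule finite_subset) simp
  ultimately obtain r where r: "(\<lambda>x. snd (\<sigma> x) 0) ` standard_simplex n \<subseteq> {r}"
    by (metis connected_finite_iff_sing subset_insertI subset_refl)
  have "snd (\<sigma> x) = (if r = 1 then basepoint else antipode)" if "x \<in> standard_simplex n" for x
  proof -
    have "snd (\<sigma> x) \<in> {basepoint, antipode}" "snd (\<sigma> x) 0 = r"
      using im r that by force+
    then show ?thesis by (auto simp: basepoint_def antipode_def)
  qed
  then have "\<sigma> ` standard_simplex n \<subseteq> UNIV \<times> {if r = 1 then basepoint else antipode}"
    by (auto simp: image_subset_iff mem_Times_iff)
  then show ?thesis
    by (simp split: if_splits)
qed

lemma image_not_both: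
  assumes "\<sigma> ` standard_simplex n \<subseteq> UNIV \<times> {basepoint}"
  shows "\<not> \<sigma> ` standard_simplex n \<subseteq> UNIV \<times> {antipode}"
  using assms nonempty_standard_simplex[of n] basepoint_neq_antipode by fastforce

lemma continuous_map_section: "t \<in> topspace T \<Longrightarrow> continuous_map X (prod_topology X T) (\<lambda>x. (x, t))"
  by (simp add: continuous_map_pairedI)

lemma pull_section_fst: "cochain_eq n X (pull n (\<lambda>x. (x, t)) (pull n fst c)) c"
  unfolding pull_compose by (rule pull_cochain_eq_self) simp

lemma simplex_map_section_fst:
  assumes "singular_simplex n (prod_topology X T) \<sigma>" "\<sigma> ` standard_simplex n \<subseteq> UNIV \<times> {t}"
  shows "simplex_map n (\<lambda>x. (x, t)) (simplex_map n fst \<sigma>) = \<sigma>"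
proof -
  have "singular_simplex n (subtopology (prod_topology X T) (UNIV \<times> {t})) \<sigma>"
    using assms by (simp add: singular_simplex_subtopology)
  then have "simplex_map n ((\<lambda>x. (x, t)) \<circ> fst) \<sigma> = \<sigma>"
    by (rule simplex_map_id_gen) auto
  then show ?thesis
    by (simp add: simplex_map_compose)
qed

text \<open>
  Only the copy of \<open>X\<close> over the antipode matters. A primitive there is extended by \<open>0\<close> to the simplices
  over the basepoint; no simplex meets both copies.
\<close>

lemma exact_times_nsphere_0_iff:
  assumes van: "vanishes n (prod_topology X (nsphere 0)) {UNIV \<times> {basepoint}} c"
  shows "exact n (prod_topology X (nsphere 0)) c \<longleftrightarrow> exact n X (pull n (\<lambda>x. (x, antipode)) c)"
proof
  let ?Y = "prod_topology X (nsphere 0)" and ?j = "\<lambda>x. (x, antipode)"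
  have "continuous_map X ?Y ?j"
    by (rule continuous_map_section) (simp add: topspace_nsphere_0)
  then show "exact n ?Y c \<Longrightarrow> exact n X (pull n ?j c)"
    by (rule exact_pull[rotated])
  have base: "c \<sigma> = 0" if "singular_simplex n ?Y \<sigma>" "\<sigma> ` standard_simplex n \<subseteq> UNIV \<times> {basepoint}" for \<sigma>
    using van that by (simp add: vanishes_def small_simplex_def)
  have fst: "singular_simplex n X (simplex_map n fst \<sigma>)" if "singular_simplex n ?Y \<sigma>" for \<sigma>
    using that continuous_map_fst by (rule singular_simplex_simplex_map)
  have anti: "pull n ?j c (simplex_map n fst \<sigma>) = c \<sigma>"
    if "singular_simplex n ?Y \<sigma>" "\<sigma> ` standard_simplex n \<subseteq> UNIV \<times> {antipode}" for \<sigma>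
    using simplex_map_section_fst[OF that] by (simp add: pull_def)
  assume ex: "exact n X (pull n ?j c)"
  show "exact n ?Y c"
  proof (cases n)
    case 0
    have "c \<sigma> = 0" if \<sigma>: "singular_simplex n ?Y \<sigma>" for \<sigma>
      using singular_simplex_times_nsphere_0[OF \<sigma>]
    proof
      assume "\<sigma> ` standard_simplex n \<subseteq> UNIV \<times> {antipode}"
      then show "c \<sigma> = 0"
        using anti[OF \<sigma>] fst[OF \<sigma>] ex by (simp add: 0 exact_rel_0 cochain_eq_def)
    qed (rule base[OF \<sigma>])
    then show ?thesis by (simp add: 0 exact_rel_0 cochain_eq_def)
  next
    case (Suc m)
    then obtain e where e: "cochain_eq n X (pull n ?j c) (cbd m e)"
      using ex by (auto simp: exact_Suc)
    define d where "d = (\<lambda>\<sigma>. if \<sigma> ` standard_simplex m \<subseteq> UNIV \<times> {antipode} then pull m fst e \<sigma> else 0)"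
    have "c \<sigma> = cbd m d \<sigma>" if \<sigma>: "singular_simplex n ?Y \<sigma>" for \<sigma>
      using singular_simplex_times_nsphere_0[OF \<sigma>]
    proof
      assume *: "\<sigma> ` standard_simplex n \<subseteq> UNIV \<times> {antipode}"
      have "d (singular_face (Suc m) k \<sigma>) = pull m fst e (singular_face (Suc m) k \<sigma>)" if "k \<le> Suc m" for k
        using singular_face_image[OF that, of \<sigma>] * by (auto simp: d_def Suc)
      then have "cbd m d \<sigma> = cbd m (pull m fst e) \<sigma>"
        by (rule cbd_cong)
      also have "\<dots> = cbd m e (simplex_map n fst \<sigma>)"
        by (simp flip: pull_cbd Suc) (simp add: pull_def)
      also have "\<dots> = c \<sigma>"
        using e anti[OF \<sigma> *] fst[OF \<sigma>] by (simp add: cochain_eq_def)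
      finally show "c \<sigma> = cbd m d \<sigma>" by simp
    next
      assume *: "\<sigma> ` standard_simplex n \<subseteq> UNIV \<times> {basepoint}"
      have "d (singular_face (Suc m) k \<sigma>) = 0" if "k \<le> Suc m" for k
      proof -
        have "singular_face (Suc m) k \<sigma> ` standard_simplex m \<subseteq> UNIV \<times> {basepoint}"
          using singular_face_image[OF that, of \<sigma>] * by (auto simp: Suc)
        from image_not_both[OF this] show ?thesis by (simp add: d_def)
      qed
      then have "cbd m d \<sigma> = cbd m (\<lambda>_. 0) \<sigma>"
        by (rule cbd_cong)
      then show "c \<sigma> = cbd m d \<sigma>"
        using base[OF \<sigma> *] by (simp add: cbd_zero)
    qed
    then show ?thesis
      unfolding Suc exact_Suc by (intro exI[of _ d]) (simp add: cochain_eq_def Suc)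
  qed
qed

text \<open>
  Both cocycles have the same products with cocycles of \<open>X\<close> on either side, as far as vanishing in
  cohomology is concerned; \<open>f\<close> plays the role of \<open>v\<close> times the fundamental class of the sphere. There are
  multipliers on both sides because \<open>f\<close> will occur in the middle of a product. The signs that come with
  the suspension do not affect exactness.
\<close>

definition corresponds :: "'a topology \<Rightarrow> nat \<Rightarrow> nat \<Rightarrow> ('a, 'c::comm_ring_1) cochain \<Rightarrow> ('a \<times> (nat \<Rightarrow> real), 'c) cochain \<Rightarrow> bool"
  where "corresponds X k m v f \<longleftrightarrow> (\<forall>a u b w. cocycle a X u \<longrightarrow> cocycle b X w \<longrightarrow>
    (exact (a + (m + k + b)) (prod_topology X (nsphere k))
        (cup a (m + k + b) (pull a fst u) (cup (m + k) b f (pull b fst w))) \<longleftrightarrow>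
     exact (a + (m + b)) X (cup a (m + b) u (cup m b v w))))"

lemma corresponds_0:
  fixes v :: "('a, 'c::comm_ring_1) cochain"
  assumes f: "vanishes m (prod_topology X (nsphere 0)) {UNIV \<times> {basepoint}} f"
    and v: "cochain_eq m X (pull m (\<lambda>x. (x, antipode)) f) v"
  shows "corresponds X 0 m v f"
  unfolding corresponds_def
proof (intro allI impI)
  fix a b and u w :: "('a, 'c) cochain" assume "cocycle a X u" "cocycle b X w"
  let ?j = "\<lambda>x. (x, antipode)"
  let ?F = "cup a (m + b) (pull a fst u) (cup m b f (pull b fst w))"
  have "vanishes (a + (m + b)) (prod_topology X (nsphere 0)) {UNIV \<times> {basepoint}} ?F"
    by (intro vanishes_cup_right vanishes_cup_left f)
  then have "exact (a + (m + b)) (prod_topology X (nsphere 0)) ?F \<longleftrightarrow> exact (a + (m + b)) X (pull (a + (m + b)) ?j ?F)"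
    by (rule exact_times_nsphere_0_iff)
  also have "cochain_eq (a + (m + b)) X (pull (a + (m + b)) ?j ?F) (cup a (m + b) u (cup m b v w))"
    unfolding pull_cup by (intro cochain_eq_cup pull_section_fst v)
  then have "exact (a + (m + b)) X (pull (a + (m + b)) ?j ?F) \<longleftrightarrow> exact (a + (m + b)) X (cup a (m + b) u (cup m b v w))"
    by (rule exact_rel_cong)
  finally show "exact (a + (m + 0 + b)) (prod_topology X (nsphere 0)) (cup a (m + 0 + b) (pull a fst u) (cup (m + 0) b f (pull b fst w))) \<longleftrightarrow>
     exact (a + (m + b)) X (cup a (m + b) u (cup m b v w))"
    by simp
qed

text \<open>
  The equator of \<open>S\<^sup>k\<^sup>+\<^sup>1\<close> is \<open>S\<^sup>k\<close>, and a cocycle pulled back from \<open>X\<close> restricts to the one pulled back to the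
  product with the equator. So \<open>exact_susp_iff\<close> can be chained with the correspondence for \<open>S\<^sup>k\<close>.
\<close>

lemma corresponds_Suc:
  fixes X :: "'a topology" and v :: "('a, 'c::comm_ring_1) cochain" and k :: nat
  defines "Y \<equiv> prod_topology X (nsphere (Suc k))"
  assumes c: "corresponds X k m v f'"
    and s: "suspension.susp Y (UNIV \<times> cap (Suc k) 1) (UNIV \<times> cap (Suc k) (-1)) (UNIV \<times> {basepoint})
      (UNIV \<times> topspace (nsphere k)) (m + k) f f'"
    and f: "cocycle (Suc (m + k)) Y f" "vanishes (Suc (m + k)) Y {UNIV \<times> {basepoint}} f"
  shows "corresponds X (Suc k) m v f"
  unfolding corresponds_def
proof (intro allI impI)
  interpret suspension Y "UNIV \<times> cap (Suc k) 1" "UNIV \<times> cap (Suc k) (-1)" "UNIV \<times> {basepoint}"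
    "UNIV \<times> topspace (nsphere k)" "\<lambda>z. (fst z, to_equator (Suc k) (snd z))" "\<lambda>z. (fst z, basepoint)"
    unfolding Y_def by (rule suspension_nsphere)
  fix a b and u w :: "('a, 'c) cochain" assume u: "cocycle a X u" and w: "cocycle b X w"
  have Q: "subtopology Y (UNIV \<times> topspace (nsphere k)) = prod_topology X (nsphere k)"
    by (simp add: Y_def subtopology_prod_snd subtopology_nsphere_Suc)
  have "cocycle a Y (pull a fst u)" "cocycle b Y (pull b fst w)"
    unfolding Y_def using u w by (auto intro: cocycle_pull continuous_map_fst)
  from exact_susp_iff[OF s f this] c u w
  show "exact (a + (m + Suc k + b)) (prod_topology X (nsphere (Suc k)))
        (cup a (m + Suc k + b) (pull a fst u) (cup (m + Suc k) b f (pull b fst w))) \<longleftrightarrow>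
     exact (a + (m + b)) X (cup a (m + b) u (cup m b v w))"
    unfolding Q by (simp add: corresponds_def Y_def)
qed

lemma ex_corresponding_cocycle:
  assumes v: "cocycle m X v"
  shows "\<exists>f. cocycle (m + k) (prod_topology X (nsphere k)) f \<and>
    vanishes (m + k) (prod_topology X (nsphere k)) {UNIV \<times> {basepoint}} f \<and> corresponds X k m v f"
proof (induction k)
  case 0
  let ?Y = "prod_topology X (nsphere 0)" and ?j = "\<lambda>x. (x, antipode)"
  define f where "f = (\<lambda>\<sigma>. if \<sigma> ` standard_simplex m \<subseteq> UNIV \<times> {antipode} then pull m fst v \<sigma> else 0)"
  have van: "vanishes m ?Y {UNIV \<times> {basepoint}} f"
    using image_not_both by (fastforce simp: vanishes_def small_simplex_def f_def)
  have "cbd m f \<sigma> = 0" if \<sigma>: "singular_simplex (Suc m) ?Y \<sigma>" for \<sigma>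
    using singular_simplex_times_nsphere_0[OF \<sigma>]
  proof
    assume *: "\<sigma> ` standard_simplex (Suc m) \<subseteq> UNIV \<times> {antipode}"
    have "f (singular_face (Suc m) k \<sigma>) = pull m fst v (singular_face (Suc m) k \<sigma>)" if "k \<le> Suc m" for k
      using singular_face_image[OF that, of \<sigma>] * by (auto simp: f_def)
    then have "cbd m f \<sigma> = cbd m (pull m fst v) \<sigma>"
      by (rule cbd_cong)
    then show ?thesis
      using cocycle_pull[OF v continuous_map_fst[of X "nsphere 0"]] \<sigma> by (simp add: cocycle_def cochain_eq_def)
  next
    assume "\<sigma> ` standard_simplex (Suc m) \<subseteq> UNIV \<times> {basepoint}"
    then show ?thesis
      using vanishes_cbd[OF van] \<sigma> by (simp add: vanishes_def small_simplex_def)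
  qed
  then have "cocycle m ?Y f"
    by (simp add: cocycle_def cochain_eq_def)
  moreover have "cochain_eq m X (pull m ?j f) v"
  proof -
    have "simplex_map m ?j \<sigma> ` standard_simplex m \<subseteq> UNIV \<times> {antipode}" for \<sigma> :: "(nat \<Rightarrow> real) \<Rightarrow> 'a"
      by (auto simp: simplex_map_def)
    then have "pull m ?j f = pull m ?j (pull m fst v)"
      by (simp add: pull_def f_def)
    then show ?thesis
      using pull_section_fst by simp
  qed
  ultimately show ?case
    using van corresponds_0[OF van] by auto
next
  case (Suc k)
  then obtain f' where f': "cocycle (m + k) (prod_topology X (nsphere k)) f'"
      "vanishes (m + k) (prod_topology X (nsphere k)) {UNIV \<times> {basepoint}} f'" "corresponds X k m v f'"
    by blast
  interpret suspension "prod_topology X (nsphere (Suc k))" "UNIV \<times> cap (Suc k) 1" "UNIV \<times> cap (Suc k) (-1)" "UNIV \<times> {basepoint}"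
    "UNIV \<times> topspace (nsphere k)" "\<lambda>z. (fst z, to_equator (Suc k) (snd z))" "\<lambda>z. (fst z, basepoint)"
    by (rule suspension_nsphere)
  have Q: "subtopology (prod_topology X (nsphere (Suc k))) (UNIV \<times> topspace (nsphere k)) = prod_topology X (nsphere k)"
    by (simp add: subtopology_prod_snd subtopology_nsphere_Suc)
  obtain f where f: "cocycle (Suc (m + k)) (prod_topology X (nsphere (Suc k))) f"
      "vanishes (Suc (m + k)) (prod_topology X (nsphere (Suc k))) {UNIV \<times> {basepoint}} f" "susp (m + k) f f'"
    using suspend[unfolded Q, OF f'(1,2)] .
  then show ?case
    using corresponds_Suc[OF f'(3)] by auto
qed

text \<open>
  Desuspend \<open>k\<close> times. If the degree reaches \<open>0\<close> before, the cocycle is zero, because a cap is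
  connected and contains the basepoint; this is the first alternative.
\<close>

lemma exact_or_corresponds:
  assumes "cocycle n (prod_topology X (nsphere k)) f"
    and "vanishes n (prod_topology X (nsphere k)) {UNIV \<times> {basepoint}} f"
  shows "exact n (prod_topology X (nsphere k)) f \<or>
    (\<exists>m v. n = m + k \<and> cocycle m X v \<and> corresponds X k m v f)"
  using assms
proof (induction k arbitrary: n f)
  case 0
  have "cocycle n X (pull n (\<lambda>x. (x, antipode)) f)"
    using 0(1) by (rule cocycle_pull) (simp add: continuous_map_section topspace_nsphere_0)
  moreover have "corresponds X 0 n (pull n (\<lambda>x. (x, antipode)) f) f"
    using 0(2) by (rule corresponds_0) simp
  ultimately show ?case by auto
next
  case (Suc k)
  interpret suspension "prod_topology X (nsphere (Suc k))" "UNIV \<times> cap (Suc k) 1" "UNIV \<times> cap (Suc k) (-1)" "UNIV \<times> {basepoint}"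
    "UNIV \<times> topspace (nsphere k)" "\<lambda>z. (fst z, to_equator (Suc k) (snd z))" "\<lambda>z. (fst z, basepoint)"
    by (rule suspension_nsphere)
  have Q: "subtopology (prod_topology X (nsphere (Suc k))) (UNIV \<times> topspace (nsphere k)) = prod_topology X (nsphere k)"
    by (simp add: subtopology_prod_snd subtopology_nsphere_Suc)
  show ?case
  proof (cases n)
    case 0
    then show ?thesis using exact_degree_0 Suc.prems by blast
  next
    case n: (Suc n')
    obtain f' where f': "cocycle n' (prod_topology X (nsphere k)) f'"
      "vanishes n' (prod_topology X (nsphere k)) {UNIV \<times> {basepoint}} f'" "susp n' f f'"
      using desuspend[unfolded Q, OF Suc.prems[unfolded n]] .
    from Suc.IH[OF f'(1,2)] show ?thesis
    proof
      assume "exact n' (prod_topology X (nsphere k)) f'"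
      then show ?thesis
        using exact_suspend[unfolded Q, OF f'(3)] Suc.prems unfolding n by blast
    next
      assume "\<exists>m v. n' = m + k \<and> cocycle m X v \<and> corresponds X k m v f'"
      then obtain m v where "n' = m + k" "cocycle m X v" "corresponds X k m v f'" by blast
      then show ?thesis
        using corresponds_Suc[of X k m v f' f] f'(3) Suc.prems n by auto
    qed
  qed
qed

lemma exact_cup_basepoint_vanishing:
  assumes "0 < k" "cocycle n (prod_topology X (nsphere k)) f" "vanishes n (prod_topology X (nsphere k)) {UNIV \<times> {basepoint}} f"
    "cocycle m (prod_topology X (nsphere k)) g" "vanishes m (prod_topology X (nsphere k)) {UNIV \<times> {basepoint}} g"
  shows "exact (n + m) (prod_topology X (nsphere k)) (cup n m f g)"
proof -
  obtain k' where k: "k = Suc k'" using \<open>0 < k\<close> gr0_conv_Suc by auto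
  show ?thesis
    using suspension.exact_cup_relative[OF suspension_nsphere] assms(2-5) unfolding k by blast
qed

section \<open>Products of cocycles of positive degree\<close>

definition total_degree :: "(nat \<times> 'b) list \<Rightarrow> nat"
  where "total_degree l = sum_list (map fst l)"

lemma total_degree_simps [simp]:
  "total_degree [] = 0" "total_degree (x # l) = fst x + total_degree l" "total_degree (l @ l') = total_degree l + total_degree l'"
  by (simp_all add: total_degree_def)

fun cup_list :: "(nat \<times> ('a, 'c::comm_ring_1) cochain) list \<Rightarrow> ('a, 'c) cochain"
  where "cup_list [] = (\<lambda>_. 1)"
  | "cup_list ((n, c) # l) = cup n (total_degree l) c (cup_list l)"

definition cocycles :: "'a topology \<Rightarrow> (nat \<times> ('a, 'c::comm_ring_1) cochain) list \<Rightarrow> bool"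
  where "cocycles X l \<longleftrightarrow> (\<forall>(n, c)\<in>set l. cocycle n X c)"

definition positive_degrees :: "(nat \<times> 'b) list \<Rightarrow> bool"
  where "positive_degrees l \<longleftrightarrow> (\<forall>(n, c)\<in>set l. 0 < n)"

definition pull_list :: "('a \<Rightarrow> 'b) \<Rightarrow> (nat \<times> ('b, 'c) cochain) list \<Rightarrow> (nat \<times> ('a, 'c) cochain) list"
  where "pull_list f = map (\<lambda>(n, c). (n, pull n f c))"

definition nonzero_product :: "'c::comm_ring_1 itself \<Rightarrow> 'a topology \<Rightarrow> nat \<Rightarrow> nat \<Rightarrow> bool"
  where "nonzero_product _ X q n \<longleftrightarrow> (\<exists>l :: (nat \<times> ('a, 'c) cochain) list.
    cocycles X l \<and> positive_degrees l \<and> length l = q \<and> total_degree l = n \<and> \<not> exact n X (cup_list l))"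

lemma cocycles_simps [simp]:
  "cocycles X []" "cocycles X ((n, c) # l) \<longleftrightarrow> cocycle n X c \<and> cocycles X l"
  "cocycles X (l @ l') \<longleftrightarrow> cocycles X l \<and> cocycles X l'"
  by (auto simp: cocycles_def)

lemma positive_degrees_simps [simp]:
  "positive_degrees []" "positive_degrees ((n, c) # l) \<longleftrightarrow> 0 < n \<and> positive_degrees l" "positive_degrees (l @ l') \<longleftrightarrow> positive_degrees l \<and> positive_degrees l'"
  by (auto simp: positive_degrees_def)

lemma pull_list_simps [simp]:
  "pull_list f [] = []" "pull_list f ((n, c) # l) = (n, pull n f c) # pull_list f l"
  "pull_list f (l @ l') = pull_list f l @ pull_list f l'"
  by (simp_all add: pull_list_def)

lemma length_pull_list [simp]: "length (pull_list f l) = length l"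
  by (simp add: pull_list_def)

lemma total_degree_pull_list [simp]: "total_degree (pull_list f l) = total_degree l"
  by (induction l) auto

lemma positive_degrees_pull_list [simp]: "positive_degrees (pull_list f l) \<longleftrightarrow> positive_degrees l"
  by (induction l) auto

lemma cocycles_pull_list: "cocycles Y l \<Longrightarrow> continuous_map X Y f \<Longrightarrow> cocycles X (pull_list f l)"
  by (induction l) (auto intro: cocycle_pull)

lemma cup_list_pull_list: "cup_list (pull_list f l) = pull (total_degree l) f (cup_list l)"
proof (induction l)
  case (Cons x l)
  then show ?case by (cases x) (simp add: pull_cup)
qed (simp add: pull_def)

lemma cocycle_cup_list: "cocycles X l \<Longrightarrow> cocycle (total_degree l) X (cup_list l)"
  by (induction l) (auto intro: cocycle_cup cocycle_one)

lemma cup_one_left: "cochain_eq n X (cup 0 n (\<lambda>_. 1) c) c"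
  by (simp add: cochain_eq_def cup_def back_face_0)

lemma cup_one_right: "cochain_eq n X (cup n 0 c (\<lambda>_. 1)) c"
  by (simp add: cochain_eq_def cup_def front_face_self)

lemma cup_list_append:
  "cochain_eq (total_degree l + total_degree l') X (cup_list (l @ l'))
    (cup (total_degree l) (total_degree l') (cup_list l) (cup_list l'))"
proof (induction l)
  case Nil
  then show ?case using cup_one_left cochain_eq_sym by fastforce
next
  case (Cons x l)
  obtain n c where x: "x = (n, c)" by (cases x)
  have "cochain_eq (n + (total_degree l + total_degree l')) X
      (cup n (total_degree l + total_degree l') c (cup_list (l @ l')))
      (cup n (total_degree l + total_degree l') c (cup (total_degree l) (total_degree l') (cup_list l) (cup_list l')))"
    by (intro cochain_eq_cup Cons.IH cochain_eq_refl)
  then show ?case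
    by (simp add: x cup_assoc add.assoc)
qed

lemma cup_list_append_cong:
  "cup_list s = cup_list s' \<Longrightarrow> total_degree s = total_degree s' \<Longrightarrow> cup_list (l @ s) = cup_list (l @ s')"
  by (induction l) auto

text \<open>
  Pulling back along a retraction is injective in cohomology. This gives the behaviour under a product
  with a further space as well as the invariance under homeomorphisms.
\<close>

lemma nonzero_product_retract:
  assumes "nonzero_product TYPE('c::comm_ring_1) X q n"
    and f: "continuous_map Y X f" and i: "continuous_map X Y i" and fi: "\<And>x. x \<in> topspace X \<Longrightarrow> f (i x) = x"
  shows "nonzero_product TYPE('c) Y q n"
proof -
  obtain l :: "(nat \<times> ('a, 'c) cochain) list" where l: "cocycles X l" "positive_degrees l" "length l = q"
      "total_degree l = n" "\<not> exact n X (cup_list l)"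
    using assms(1) unfolding nonzero_product_def by blast
  have "\<not> exact n Y (cup_list (pull_list f l))"
  proof
    assume "exact n Y (cup_list (pull_list f l))"
    from exact_pull[OF this i] have "exact n X (pull n (f \<circ> i) (cup_list l))"
      by (simp add: cup_list_pull_list l(4) pull_compose)
    moreover have "cochain_eq n X (pull n (f \<circ> i) (cup_list l)) (cup_list l)"
      by (rule pull_cochain_eq_self) (simp add: fi)
    ultimately show False
      using l(5) exact_rel_cong by blast
  qed
  then show ?thesis
    unfolding nonzero_product_def using l cocycles_pull_list[OF l(1) f]
    by (intro exI[of _ "pull_list f l"]) simp
qed

lemma nonzero_product_times:
  "nonzero_product TYPE('c::comm_ring_1) X q n \<Longrightarrow> t \<in> topspace T \<Longrightarrow> nonzero_product TYPE('c) (prod_topology X T) q n"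
  by (rule nonzero_product_retract[where f = fst and i = "\<lambda>x. (x, t)"]) (auto simp: continuous_map_fst continuous_map_section)

text \<open>
  The new factor is a cocycle corresponding to the unit of \<open>X\<close>, in other words a fundamental class of
  the sphere; multiplication by it loses nothing.
\<close>

lemma nonzero_product_times_sphere:
  assumes "nonzero_product TYPE('c::comm_ring_1) X q n" "0 < k"
  shows "nonzero_product TYPE('c) (prod_topology X (nsphere k)) (Suc q) (n + k)"
proof -
  let ?Y = "prod_topology X (nsphere k)"
  obtain l :: "(nat \<times> ('a, 'c) cochain) list" where l: "cocycles X l" "positive_degrees l" "length l = q"
      "total_degree l = n" "\<not> exact n X (cup_list l)"
    using assms(1) unfolding nonzero_product_def by blast
  obtain f where f: "cocycle k ?Y f" "corresponds X k 0 (\<lambda>_. 1 :: 'c) f"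
    using ex_corresponding_cocycle[of 0 X "\<lambda>_. 1 :: 'c" k] cocycle_one by auto
  let ?l = "(k, f) # pull_list fst l"
  have w: "cocycle n X (cup_list l)"
    using cocycle_cup_list[OF l(1)] l(4) by simp
  have "\<not> exact (k + n) ?Y (cup k n f (pull n fst (cup_list l)))"
  proof
    assume ex: "exact (k + n) ?Y (cup k n f (pull n fst (cup_list l)))"
    have eq: "cochain_eq (k + n) ?Y (cup 0 (k + n) (pull 0 fst (\<lambda>_. 1)) (cup k n f (pull n fst (cup_list l))))
        (cup k n f (pull n fst (cup_list l)))"
      unfolding pull_def by (rule cup_one_left)
    have "exact (0 + (0 + k + n)) ?Y (cup 0 (0 + k + n) (pull 0 fst (\<lambda>_. 1)) (cup (0 + k) n f (pull n fst (cup_list l))))"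
      using ex exact_rel_cong[OF eq, of "{}"] by simp
    then have "exact (0 + (0 + n)) X (cup 0 (0 + n) (\<lambda>_. 1) (cup 0 n (\<lambda>_. 1) (cup_list l)))"
      using f(2) cocycle_one[of X] w unfolding corresponds_def by blast
    moreover have "cochain_eq n X (cup 0 n (\<lambda>_. 1) (cup 0 n (\<lambda>_. 1) (cup_list l))) (cup_list l)"
      using cup_one_left cochain_eq_trans by metis
    ultimately show False
      using l(5) exact_rel_cong by fastforce
  qed
  moreover have "cup_list ?l = cup k n f (pull n fst (cup_list l))"
    by (simp add: cup_list_pull_list l(4))
  moreover have "cocycles ?Y ?l"
    using f(1) cocycles_pull_list[OF l(1) continuous_map_fst] by simp
  ultimately show ?thesis
    unfolding nonzero_product_def using l \<open>0 < k\<close> by (intro exI[of _ ?l]) (simp add: add.commute)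
qed

abbreviation base_section :: "'a \<Rightarrow> 'a \<times> (nat \<Rightarrow> real)"
  where "base_section \<equiv> \<lambda>x. (x, basepoint)"

definition fibre_part :: "nat \<Rightarrow> ('a \<times> (nat \<Rightarrow> real), 'c::comm_ring_1) cochain \<Rightarrow> ('a \<times> (nat \<Rightarrow> real), 'c) cochain"
  where "fibre_part n c = (\<lambda>\<sigma>. c \<sigma> - pull n fst (pull n base_section c) \<sigma>)"

lemma fibre_part:
  assumes "cocycle n (prod_topology X (nsphere k)) c"
  shows "cocycle n (prod_topology X (nsphere k)) (fibre_part n c)"
    and "vanishes n (prod_topology X (nsphere k)) {UNIV \<times> {basepoint}} (fibre_part n c)"
proof -
  show "cocycle n (prod_topology X (nsphere k)) (fibre_part n c)"
    unfolding fibre_part_def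
    by (intro cocycle_diff assms cocycle_pull[OF _ continuous_map_fst] cocycle_pull[OF assms] continuous_map_section basepoint_in_nsphere)
  show "vanishes n (prod_topology X (nsphere k)) {UNIV \<times> {basepoint}} (fibre_part n c)"
    using simplex_map_section_fst by (fastforce simp: vanishes_def small_simplex_def fibre_part_def pull_def)
qed

text \<open>
  Some product of \<open>x\<close> with the factors in \<open>l\<close>, one of them replaced by its fibre part and the others by
  their pulled-back parts, is non-zero in cohomology.
\<close>

definition single_fibre_product_survives ::
    "('a \<times> (nat \<Rightarrow> real)) topology \<Rightarrow> nat \<Rightarrow> ('a, 'c::comm_ring_1) cochain \<Rightarrow>
      (nat \<times> ('a \<times> (nat \<Rightarrow> real), 'c) cochain) list \<Rightarrow> bool"
  where "single_fibre_product_survives Y a x l \<longleftrightarrow> (\<exists>l1 n c l2. l = l1 @ (n, c) # l2 \<and>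
    \<not> exact (a + total_degree l1 + (n + total_degree l2)) Y
      (cup (a + total_degree l1) (n + total_degree l2)
        (pull (a + total_degree l1) fst (cup a (total_degree l1) x (cup_list (pull_list base_section l1))))
        (cup n (total_degree l2) (fibre_part n c)
          (pull (total_degree l2) fst (cup_list (pull_list base_section l2))))))"

text \<open>
  Each factor is split as \<open>c = b + f\<close> with \<open>b\<close> pulled back from \<open>X\<close> and \<open>f\<close> vanishing over the basepoint. Up to
  exact terms the product is the product of all the \<open>b\<close> plus \<open>e\<close>, the sum of the products with exactly one
  \<open>f\<close>, as products with two or more are exact. The last clause is what is needed of this sum: when a
  multiple of it is not exact, one of its summands has the same property. The multiplier \<open>x\<close> is there for
  the induction, where it collects the factors to the left.
\<close>

lemma product_expansion:
  fixes X :: "'a topology" and l :: "(nat \<times> ('a \<times> (nat \<Rightarrow> real), 'c::comm_ring_1) cochain) list"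
  assumes k: "0 < k" and "cocycles (prod_topology X (nsphere k)) l"
  defines "Y \<equiv> prod_topology X (nsphere k)"
  obtains e where "cocycle (total_degree l) Y e" "vanishes (total_degree l) Y {UNIV \<times> {basepoint}} e"
    "exact (total_degree l) Y
      (\<lambda>\<sigma>. cup_list l \<sigma> - pull (total_degree l) fst (cup_list (pull_list base_section l)) \<sigma> - e \<sigma>)"
    "\<forall>a x. cocycle a X x \<longrightarrow> \<not> exact (a + total_degree l) Y (cup a (total_degree l) (pull a fst x) e) \<longrightarrow>
      single_fibre_product_survives Y a x l"
  using assms(2) unfolding Y_def[symmetric]
proof (induction l arbitrary: thesis)
  case Nil
  have "cochain_eq 0 Y (\<lambda>\<sigma>. 1 - pull 0 fst (\<lambda>_. 1) \<sigma> - 0) (\<lambda>_. 0 :: 'c)"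
    by (simp add: cochain_eq_def pull_def)
  moreover have "exact (a + 0) Y (cup a 0 (pull a fst x) (\<lambda>_. 0))" for a and x :: "('a, 'c) cochain"
    unfolding cup_def by (simp add: exact_rel_zero)
  ultimately show ?case
    by (intro Nil.prems(1)[of "\<lambda>_. 0"]) (simp_all add: cocycle_zero vanishes_def exact_rel_0)
next
  case (Cons z l)
  obtain n c where z: "z = (n, c)" by (cases z)
  have c: "cocycle n Y c" and l: "cocycles Y l" using Cons.prems z by auto
  let ?d = "total_degree l" and ?B = "cup_list (pull_list base_section l)"
  obtain e where e: "cocycle ?d Y e" "vanishes ?d Y {UNIV \<times> {basepoint}} e"
    and ex: "exact ?d Y (\<lambda>\<sigma>. cup_list l \<sigma> - pull ?d fst ?B \<sigma> - e \<sigma>)"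
    and IH: "\<forall>a x. cocycle a X x \<longrightarrow> \<not> exact (a + ?d) Y (cup a ?d (pull a fst x) e) \<longrightarrow>
      single_fibre_product_survives Y a x l"
    using Cons.IH[OF _ l] by blast
  let ?b = "pull n base_section c" and ?f = "fibre_part n c"
  have sec: "continuous_map X Y base_section"
    unfolding Y_def by (intro continuous_map_section basepoint_in_nsphere)
  have fst: "continuous_map Y X fst"
    unfolding Y_def by (rule continuous_map_fst)
  have f: "cocycle n Y ?f" "vanishes n Y {UNIV \<times> {basepoint}} ?f"
    using fibre_part c unfolding Y_def by blast+
  have b: "cocycle n X ?b" by (rule cocycle_pull[OF c sec])
  have B: "cocycle ?d X ?B"
    using cocycle_cup_list[OF cocycles_pull_list[OF l sec]] by simp
  have pb: "cocycle n Y (pull n fst ?b)" and pB: "cocycle ?d Y (pull ?d fst ?B)"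
    using cocycle_pull[OF b fst] cocycle_pull[OF B fst] .
  let ?e = "\<lambda>\<sigma>. cup n ?d (pull n fst ?b) e \<sigma> + cup n ?d ?f (pull ?d fst ?B) \<sigma>"
  show ?case
  proof (rule Cons.prems(1)[of ?e])
    show "cocycle (total_degree (z # l)) Y ?e"
      using f(1) e(1) pb pB by (simp add: z cocycle_add cocycle_cup)
    show "vanishes (total_degree (z # l)) Y {UNIV \<times> {basepoint}} ?e"
      using f(2) e(2) by (simp add: z vanishes_add vanishes_cup_left vanishes_cup_right)
  next
    let ?r = "\<lambda>\<sigma>. cup_list l \<sigma> - pull ?d fst ?B \<sigma> - e \<sigma>"
    \<comment> \<open>With \<open>B\<close> the product of the pulled-back parts of \<open>l\<close>, \<open>(b + f) (B + e + r) = b B + (b e + f B) + (c r + f e)\<close>.\<close>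
    have "exact (n + ?d) Y (\<lambda>\<sigma>. cup n ?d c ?r \<sigma> + cup n ?d ?f e \<sigma>)"
    proof (rule exact_rel_add)
      show "exact (n + ?d) Y (cup n ?d c ?r)" by (rule exact_cup_right[OF ex c])
      show "exact (n + ?d) Y (cup n ?d ?f e)"
        using exact_cup_basepoint_vanishing[OF k] f e unfolding Y_def by blast
    qed
    moreover have "cup n ?d c ?r \<sigma> + cup n ?d ?f e \<sigma> =
        cup_list (z # l) \<sigma> - pull (n + ?d) fst (cup_list (pull_list base_section (z # l))) \<sigma> - ?e \<sigma>" for \<sigma>
      by (simp add: z pull_cup) (simp add: cup_def fibre_part_def algebra_simps)
    ultimately show "exact (total_degree (z # l)) Y
      (\<lambda>\<sigma>. cup_list (z # l) \<sigma> - pull (total_degree (z # l)) fst (cup_list (pull_list base_section (z # l))) \<sigma> - ?e \<sigma>)"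
      by (simp add: z)
  next
    show "\<forall>a x. cocycle a X x \<longrightarrow> \<not> exact (a + total_degree (z # l)) Y (cup a (total_degree (z # l)) (pull a fst x) ?e) \<longrightarrow>
      single_fibre_product_survives Y a x (z # l)"
    proof (intro allI impI)
      fix a and x :: "('a, 'c) cochain"
      assume x: "cocycle a X x" and ne: "\<not> exact (a + total_degree (z # l)) Y (cup a (total_degree (z # l)) (pull a fst x) ?e)"
      let ?goal = "\<lambda>l1 m c l2. \<not> exact (a + total_degree l1 + (m + total_degree l2)) Y
            (cup (a + total_degree l1) (m + total_degree l2)
              (pull (a + total_degree l1) fst (cup a (total_degree l1) x (cup_list (pull_list base_section l1))))
              (cup m (total_degree l2) (fibre_part m c)
                (pull (total_degree l2) fst (cup_list (pull_list base_section l2)))))"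
      let ?t1 = "cup a (n + ?d) (pull a fst x) (cup n ?d (pull n fst ?b) e)"
      let ?t2 = "cup a (n + ?d) (pull a fst x) (cup n ?d ?f (pull ?d fst ?B))"
      have "cup a (n + ?d) (pull a fst x) ?e = (\<lambda>\<sigma>. ?t1 \<sigma> + ?t2 \<sigma>)"
        by (simp add: cup_def fun_eq_iff algebra_simps)
      then have "\<not> exact (a + (n + ?d)) Y ?t1 \<or> \<not> exact (a + (n + ?d)) Y ?t2"
        using ne exact_rel_add by (fastforce simp: z)
      then show "single_fibre_product_survives Y a x (z # l)"
      proof
        assume ne1: "\<not> exact (a + (n + ?d)) Y ?t1"
        have "?t1 = cup (a + n) ?d (pull (a + n) fst (cup a n x ?b)) e"
          by (simp add: pull_cup cup_assoc)
        with ne1 have "\<not> exact (a + n + ?d) Y (cup (a + n) ?d (pull (a + n) fst (cup a n x ?b)) e)"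
          by (simp add: add.assoc)
        from IH[rule_format, OF cocycle_cup[OF x b] this] obtain l1 m c' l2 where l12: "l = l1 @ (m, c') # l2"
          and ne2: "\<not> exact (a + n + total_degree l1 + (m + total_degree l2)) Y
            (cup (a + n + total_degree l1) (m + total_degree l2)
              (pull (a + n + total_degree l1) fst (cup (a + n) (total_degree l1) (cup a n x ?b) (cup_list (pull_list base_section l1))))
              (cup m (total_degree l2) (fibre_part m c')
                (pull (total_degree l2) fst (cup_list (pull_list base_section l2)))))"
          unfolding single_fibre_product_survives_def by blast
        have "?goal (z # l1) m c' l2"
          using ne2 by (simp add: z cup_assoc add.assoc)
        with l12 show ?thesis
          unfolding single_fibre_product_survives_def
          by (intro exI[of _ "z # l1"] exI[of _ m] exI[of _ c'] exI[of _ l2]) simp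
      next
        assume ne2: "\<not> exact (a + (n + ?d)) Y ?t2"
        have "cochain_eq a Y (pull a fst (cup a 0 x (\<lambda>_. 1))) (pull a fst x)"
          by (rule cochain_eq_pull[OF cup_one_right fst])
        then have "cochain_eq (a + (n + ?d)) Y
            (cup a (n + ?d) (pull a fst (cup a 0 x (\<lambda>_. 1))) (cup n ?d ?f (pull ?d fst ?B))) ?t2"
          by (rule cochain_eq_cup) simp
        with ne2 have "?goal [] n c l"
          using exact_rel_cong by fastforce
        then show ?thesis
          unfolding single_fibre_product_survives_def
          by (intro exI[of _ "[]"] exI[of _ n] exI[of _ c] exI[of _ l]) (simp add: z)
      qed
    qed
  qed
qed

text \<open>
  A factor of degree \<open>0\<close> can be multiplied into a neighbour, whose degree stays positive. If there is no
  neighbour, the factor itself is non-zero, hence so is the unit, which is the empty product.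
\<close>

lemma nonzero_product_absorb_degree_0:
  fixes v :: "('a, 'c::comm_ring_1) cochain"
  assumes l: "cocycles X l1" "positive_degrees l1" "cocycles X l2" "positive_degrees l2" and v: "cocycle 0 X v"
    and ne: "\<not> exact (total_degree l1 + total_degree l2) X (cup_list (l1 @ (0, v) # l2))"
  shows "nonzero_product TYPE('c) X (length l1 + length l2) (total_degree l1 + total_degree l2)"
proof (cases l2)
  case (Cons z l3)
  obtain n c where z: "z = (n, c)" by (cases z)
  let ?l = "l1 @ (n, cup 0 n v c) # l3"
  have "cup_list ((0, v) # l2) = cup_list ((n, cup 0 n v c) # l3)"
    using cup_assoc[of 0 n "total_degree l3" v c "cup_list l3"] by (simp add: Cons z)
  then have "cup_list (l1 @ (0, v) # l2) = cup_list ?l"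
    by (rule cup_list_append_cong) (simp add: Cons z)
  moreover have "cocycles X ?l"
    using l cocycle_cup[OF v, of n c] by (simp add: Cons z)
  ultimately show ?thesis
    using ne l unfolding nonzero_product_def by (intro exI[of _ ?l]) (simp add: Cons z)
next
  case Nil
  show ?thesis
  proof (cases l1 rule: rev_cases)
    case (snoc l3 z)
    obtain n c where z: "z = (n, c)" by (cases z)
    let ?l = "l3 @ [(n, cup n 0 c v)]"
    have "cup_list ([(n, c), (0, v)]) = cup_list [(n, cup n 0 c v)]"
      using cup_assoc[of n 0 0 c v "\<lambda>_. 1"] by simp
    then have "cup_list (l3 @ [(n, c), (0, v)]) = cup_list ?l"
      by (rule cup_list_append_cong) simp
    then have "cup_list (l1 @ (0, v) # l2) = cup_list ?l"
      by (simp add: Nil snoc z)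
    moreover have "cocycles X ?l"
      using l cocycle_cup[of n X c 0 v] v by (simp add: snoc z)
    ultimately show ?thesis
      using ne l unfolding nonzero_product_def by (intro exI[of _ ?l]) (simp add: Nil snoc z)
  next
    case l1: Nil
    have "\<not> exact 0 X (\<lambda>_. 1 :: 'c)"
    proof
      assume "exact 0 X (\<lambda>_. 1 :: 'c)"
      then have "\<not> singular_simplex 0 X \<sigma>" for \<sigma>
        by (simp add: exact_rel_0 cochain_eq_def)
      then show False
        using ne by (simp add: l1 Nil exact_rel_0 cochain_eq_def)
    qed
    then show ?thesis
      unfolding nonzero_product_def by (intro exI[of _ "[]"]) (simp add: l1 Nil)
  qed
qed

text \<open>
  Either the product of the pulled-back parts is not exact, or a product with a single factor \<open>f\<close> is not.
  In the latter case \<open>f\<close> is replaced by the corresponding \<open>v\<close> on \<open>X\<close>, of degree lower by \<open>k\<close>. The number of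
  positive factors drops by one when \<open>v\<close> has degree \<open>0\<close> and stays the same otherwise.
\<close>

lemma nonzero_product_times_sphere_cases:
  assumes "nonzero_product TYPE('c::comm_ring_1) (prod_topology X (nsphere k)) q n" and k: "0 < k"
  shows "nonzero_product TYPE('c) X q n \<or> (\<exists>q' n'. nonzero_product TYPE('c) X q' n' \<and> n = n' + k \<and> q \<le> Suc q')"
proof -
  let ?Y = "prod_topology X (nsphere k)"
  obtain l :: "(nat \<times> ('a \<times> (nat \<Rightarrow> real), 'c) cochain) list" where l: "cocycles ?Y l" "positive_degrees l" "length l = q"
      "total_degree l = n" "\<not> exact n ?Y (cup_list l)"
    using assms(1) unfolding nonzero_product_def by blast
  have sec: "continuous_map X ?Y base_section"
    by (intro continuous_map_section basepoint_in_nsphere)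
  obtain e where e: "cocycle n ?Y e" "vanishes n ?Y {UNIV \<times> {basepoint}} e"
    and ex: "exact n ?Y (\<lambda>\<sigma>. cup_list l \<sigma> - pull n fst (cup_list (pull_list base_section l)) \<sigma> - e \<sigma>)"
    and split: "\<forall>a x. cocycle a X x \<longrightarrow> \<not> exact (a + n) ?Y (cup a n (pull a fst x) e) \<longrightarrow>
      single_fibre_product_survives ?Y a x l"
    using product_expansion[OF k l(1), unfolded l(4)] .
  show ?thesis
  proof (cases "exact n X (cup_list (pull_list base_section l))")
    case False
    then have "nonzero_product TYPE('c) X q n"
      unfolding nonzero_product_def using l cocycles_pull_list[OF l(1) sec]
      by (intro exI[of _ "pull_list base_section l"]) simp
    then show ?thesis ..
  next
    case True
    have "\<not> exact n ?Y e"
    proof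
      assume "exact n ?Y e"
      from exact_rel_add[OF exact_rel_add[OF ex this] exact_pull[OF True continuous_map_fst]] l(5)
      show False by simp
    qed
    moreover have "cochain_eq n ?Y (cup 0 n (pull 0 fst (\<lambda>_. 1)) e) e"
      unfolding pull_def by (rule cup_one_left)
    ultimately have "\<not> exact (0 + n) ?Y (cup 0 n (pull 0 fst (\<lambda>_. 1)) e)"
      using exact_rel_cong by fastforce
    from split[rule_format, OF cocycle_one this] obtain l1 m c l2 where l12: "l = l1 @ (m, c) # l2"
      and ne: "\<not> exact (0 + total_degree l1 + (m + total_degree l2)) ?Y
          (cup (0 + total_degree l1) (m + total_degree l2)
            (pull (0 + total_degree l1) fst (cup 0 (total_degree l1) (\<lambda>_. 1) (cup_list (pull_list base_section l1))))
            (cup m (total_degree l2) (fibre_part m c)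
              (pull (total_degree l2) fst (cup_list (pull_list base_section l2)))))"
      unfolding single_fibre_product_survives_def by blast
    let ?l1 = "pull_list base_section l1" and ?l2 = "pull_list base_section l2"
    let ?u = "cup 0 (total_degree l1) (\<lambda>_. 1) (cup_list ?l1)"
    have c: "cocycle m ?Y c" and ll: "cocycles X ?l1" "cocycles X ?l2" "positive_degrees ?l1" "positive_degrees ?l2"
      using l l12 cocycles_pull_list[OF _ sec] by auto
    have B: "cocycle (total_degree l1) X (cup_list ?l1)" "cocycle (total_degree l2) X (cup_list ?l2)"
      using cocycle_cup_list[OF ll(1)] cocycle_cup_list[OF ll(2)] by simp_all
    have u: "cocycle (0 + total_degree l1) X ?u"
      by (rule cocycle_cup[OF cocycle_one B(1)])
    have "\<not> exact m ?Y (fibre_part m c)"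
    proof
      assume "exact m ?Y (fibre_part m c)"
      then have "exact (0 + total_degree l1 + (m + total_degree l2)) ?Y
          (cup (0 + total_degree l1) (m + total_degree l2) (pull (0 + total_degree l1) fst ?u)
            (cup m (total_degree l2) (fibre_part m c) (pull (total_degree l2) fst (cup_list ?l2))))"
        by (intro exact_cup_right exact_cup_left cocycle_pull[OF _ continuous_map_fst] u B)
      with ne show False by blast
    qed
    then obtain m' v where m: "m = m' + k" and v: "cocycle m' X v" and corr: "corresponds X k m' v (fibre_part m c)"
      using exact_or_corresponds[OF fibre_part[OF c]] by blast
    have ne1: "\<not> exact (0 + total_degree l1 + (m' + total_degree l2)) X
        (cup (0 + total_degree l1) (m' + total_degree l2) ?u (cup m' (total_degree l2) v (cup_list ?l2)))"
      using corr u B(2) ne unfolding corresponds_def m by blast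
    have eq1: "cochain_eq (total_degree l1 + (m' + total_degree l2)) X
        (cup (total_degree l1) (m' + total_degree l2) ?u (cup m' (total_degree l2) v (cup_list ?l2)))
        (cup (total_degree l1) (m' + total_degree l2) (cup_list ?l1) (cup m' (total_degree l2) v (cup_list ?l2)))"
      by (intro cochain_eq_cup cup_one_left cochain_eq_refl)
    have eq2: "cochain_eq (total_degree l1 + (m' + total_degree l2)) X (cup_list (?l1 @ (m', v) # ?l2))
        (cup (total_degree l1) (m' + total_degree l2) (cup_list ?l1) (cup m' (total_degree l2) v (cup_list ?l2)))"
      using cup_list_append[of ?l1 "(m', v) # ?l2" X] by simp
    have ne': "\<not> exact (total_degree l1 + (m' + total_degree l2)) X (cup_list (?l1 @ (m', v) # ?l2))"
      using ne1 unfolding add_0 exact_rel_cong[OF eq1] exact_rel_cong[OF eq2] .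
    have n: "n = total_degree l1 + (m' + total_degree l2) + k"
      using l(4) l12 m by simp
    show ?thesis
    proof (cases "m' = 0")
      case False
      then have "nonzero_product TYPE('c) X q (total_degree l1 + (m' + total_degree l2))"
        unfolding nonzero_product_def using ne' ll v l(3) l12
        by (intro exI[of _ "?l1 @ (m', v) # ?l2"]) simp
      with n show ?thesis
        by (intro disjI2 exI[of _ q] exI[of _ "total_degree l1 + (m' + total_degree l2)"]) simp
    next
      case True
      then have "nonzero_product TYPE('c) X (length l1 + length l2) (total_degree l1 + total_degree l2)"
        using nonzero_product_absorb_degree_0[OF ll(1,3,2,4)] v ne' by simp
      moreover have "q \<le> Suc (length l1 + length l2)"
        using l(3) l12 by simp
      ultimately show ?thesis using n True by auto
    qed
  qed
qed

section \<open>The cohomology ring in terms of cocycles\<close>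

text \<open>
  The element of the cochain ring concentrated in degree \<open>n\<close>, set to zero off the singular simplices as
  its carrier demands.
\<close>

definition homogeneous :: "'a topology \<Rightarrow> nat \<Rightarrow> ('a, 'c::comm_ring_1) cochain \<Rightarrow> nat \<Rightarrow> ('a, 'c) cochain"
  where "homogeneous X n c = (\<lambda>j \<sigma>. if j = n \<and> singular_simplex n X \<sigma> then c \<sigma> else 0)"

definition cohomology_class :: "'a topology \<Rightarrow> (nat \<Rightarrow> ('a, 'c::comm_ring_1) cochain) \<Rightarrow> (nat \<Rightarrow> ('a, 'c) cochain) set"
  where "cohomology_class X z = coboundary_ideal X +>\<^bsub>cocycle_ring X\<^esub> z"

lemma carrier_cochain_ring:
  "c \<in> carrier (cochain_ring X) \<longleftrightarrow> (\<forall>n. singular_cochain n X (c n)) \<and> finite {n. c n \<noteq> (\<lambda>_. 0)}"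
  by (simp add: cochain_ring_def)

lemma carrier_cocycle_ring:
  "c \<in> carrier (cocycle_ring X) \<longleftrightarrow> c \<in> carrier (cochain_ring X) \<and> coboundary X c = (\<lambda>_ _. 0)"
  by (simp add: cocycle_ring_def)

lemma add_cocycle_ring: "c \<oplus>\<^bsub>cocycle_ring X\<^esub> d = (\<lambda>n \<sigma>. c n \<sigma> + d n \<sigma>)"
  by (simp add: cocycle_ring_def cochain_ring_def)

lemma mult_cocycle_ring:
  "(c \<otimes>\<^bsub>cocycle_ring X\<^esub> d) n \<sigma> =
    (if singular_simplex n X \<sigma> then \<Sum>p\<le>n. cup p (n - p) (c p) (d (n - p)) \<sigma> else 0)"
  by (simp add: cocycle_ring_def cochain_ring_def cochain_cup_def cup_def)

lemma coboundary_0: "coboundary X c 0 = (\<lambda>_. 0)"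
  by (simp add: coboundary_def)

lemma coboundary_Suc:
  "coboundary X c (Suc n) \<sigma> = (if singular_simplex (Suc n) X \<sigma> then cbd n (c n) \<sigma> else 0)"
  by (simp add: coboundary_def cochain_coboundary_def cbd_def del: sum.atMost_Suc)

lemma coboundary_add: "coboundary X (\<lambda>n \<sigma>. c n \<sigma> + d n \<sigma>) = (\<lambda>n \<sigma>. coboundary X c n \<sigma> + coboundary X d n \<sigma>)"
proof (intro ext)
  fix n \<sigma> show "coboundary X (\<lambda>n \<sigma>. c n \<sigma> + d n \<sigma>) n \<sigma> = coboundary X c n \<sigma> + coboundary X d n \<sigma>"
    by (cases n) (simp_all add: coboundary_0 coboundary_Suc cbd_add)
qed

lemma coboundary_scale: "coboundary X (\<lambda>n \<sigma>. r * c n \<sigma>) = (\<lambda>n \<sigma>. r * coboundary X c n \<sigma>)"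
proof (intro ext)
  fix n \<sigma> show "coboundary X (\<lambda>n \<sigma>. r * c n \<sigma>) n \<sigma> = r * coboundary X c n \<sigma>"
    by (cases n) (simp_all add: coboundary_0 coboundary_Suc cbd_scale)
qed

lemma cochain_add_closed:
  assumes "c \<in> carrier (cochain_ring X)" "d \<in> carrier (cochain_ring X)"
  shows "(\<lambda>n \<sigma>. c n \<sigma> + d n \<sigma>) \<in> carrier (cochain_ring X)"
proof -
  have "{n. (\<lambda>\<sigma>. c n \<sigma> + d n \<sigma>) \<noteq> (\<lambda>_. 0)} \<subseteq> {n. c n \<noteq> (\<lambda>_. 0)} \<union> {n. d n \<noteq> (\<lambda>_. 0)}"
    by (auto simp: fun_eq_iff)
  then show ?thesis
    using assms by (auto simp: carrier_cochain_ring singular_cochain_def intro: finite_subset)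
qed

lemma cochain_scale_closed:
  assumes "c \<in> carrier (cochain_ring X)"
  shows "(\<lambda>n \<sigma>. r n * c n \<sigma>) \<in> carrier (cochain_ring X)"
proof -
  have "{n. (\<lambda>\<sigma>. r n * c n \<sigma>) \<noteq> (\<lambda>_. 0)} \<subseteq> {n. c n \<noteq> (\<lambda>_. 0)}"
    by auto
  then show ?thesis
    using assms by (auto simp: carrier_cochain_ring singular_cochain_def intro: finite_subset)
qed

lemma cochain_mult_closed:
  assumes "c \<in> carrier (cochain_ring X)" "d \<in> carrier (cochain_ring X)"
  shows "c \<otimes>\<^bsub>cocycle_ring X\<^esub> d \<in> carrier (cochain_ring X)"
proof -
  let ?C = "{n. c n \<noteq> (\<lambda>_. 0)}" and ?D = "{n. d n \<noteq> (\<lambda>_. 0)}"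
  have "n \<in> (\<lambda>(i, j). i + j) ` (?C \<times> ?D)" if n: "(c \<otimes>\<^bsub>cocycle_ring X\<^esub> d) n \<noteq> (\<lambda>_. 0)" for n
  proof -
    obtain \<sigma> where "(c \<otimes>\<^bsub>cocycle_ring X\<^esub> d) n \<sigma> \<noteq> 0"
      using n by (auto simp: fun_eq_iff)
    then have "(\<Sum>p\<le>n. cup p (n - p) (c p) (d (n - p)) \<sigma>) \<noteq> 0"
      by (auto simp: mult_cocycle_ring split: if_splits)
    then obtain p where p: "p \<le> n" "cup p (n - p) (c p) (d (n - p)) \<sigma> \<noteq> 0"
      by (metis (no_types, lifting) atMost_iff sum.neutral)
    then have "c p \<noteq> (\<lambda>_. 0)" "d (n - p) \<noteq> (\<lambda>_. 0)"
      by (auto simp: cup_def)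
    with p(1) show ?thesis
      by (intro image_eqI[of _ _ "(p, n - p)"]) auto
  qed
  then have "{n. (c \<otimes>\<^bsub>cocycle_ring X\<^esub> d) n \<noteq> (\<lambda>_. 0)} \<subseteq> (\<lambda>(i, j). i + j) ` (?C \<times> ?D)"
    by blast
  moreover have "finite ((\<lambda>(i, j). i + j) ` (?C \<times> ?D))"
    using assms by (intro finite_imageI finite_cartesian_product) (simp_all add: carrier_cochain_ring)
  ultimately have "finite {n. (c \<otimes>\<^bsub>cocycle_ring X\<^esub> d) n \<noteq> (\<lambda>_. 0)}"
    by (rule finite_subset)
  then show ?thesis
    unfolding carrier_cochain_ring by (simp add: singular_cochain_def mult_cocycle_ring)
qed

lemma coboundary_in_cocycle_ring:
  assumes c: "c \<in> carrier (cochain_ring X)"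
  shows "coboundary X c \<in> carrier (cocycle_ring X)"
proof -
  have "coboundary X c n = (\<lambda>_. 0)" if "n \<notin> Suc ` {n. c n \<noteq> (\<lambda>_. 0)}" for n
  proof (cases n)
    case (Suc m)
    with that have cm: "c m = (\<lambda>_. 0)" by auto
    show ?thesis by (rule ext) (simp only: Suc coboundary_Suc cm cbd_zero if_cancel)
  qed (simp add: coboundary_0)
  then have "{n. coboundary X c n \<noteq> (\<lambda>_. 0)} \<subseteq> Suc ` {n. c n \<noteq> (\<lambda>_. 0)}"
    by blast
  then have "finite {n. coboundary X c n \<noteq> (\<lambda>_. 0)}"
    by (rule finite_subset) (use c in \<open>simp add: carrier_cochain_ring\<close>)
  moreover have "singular_cochain n X (coboundary X c n)" for n
    by (cases n) (auto simp: singular_cochain_def coboundary_0 coboundary_Suc)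
  moreover have "coboundary X (coboundary X c) n \<sigma> = 0" for n \<sigma>
  proof (cases n)
    case (Suc m)
    show ?thesis
    proof (cases m)
      case 0
      then show ?thesis by (simp add: Suc coboundary_Suc coboundary_0 cbd_zero)
    next
      case m: (Suc l)
      have "cbd m (coboundary X c m) \<sigma> = cbd m (cbd l (c l)) \<sigma>" if "singular_simplex n X \<sigma>"
        using that by (intro cbd_cong) (simp add: m Suc coboundary_Suc singular_simplex_face)
      then show ?thesis
        by (simp add: Suc m coboundary_Suc cbd_cbd)
    qed
  qed (simp add: coboundary_0)
  ultimately show ?thesis
    unfolding carrier_cocycle_ring carrier_cochain_ring by blast
qed

lemma coboundary_ideal_add:
  "a \<in> coboundary_ideal X \<Longrightarrow> b \<in> coboundary_ideal X \<Longrightarrow> (\<lambda>n \<sigma>. a n \<sigma> + b n \<sigma>) \<in> coboundary_ideal X"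
  unfolding coboundary_ideal_def by (auto simp flip: coboundary_add intro: cochain_add_closed)

lemma coboundary_ideal_scale: "a \<in> coboundary_ideal X \<Longrightarrow> (\<lambda>n \<sigma>. r * a n \<sigma>) \<in> coboundary_ideal X"
  unfolding coboundary_ideal_def by (auto simp flip: coboundary_scale intro: cochain_scale_closed)

lemma coboundary_ideal_diff:
  "a \<in> coboundary_ideal X \<Longrightarrow> b \<in> coboundary_ideal X \<Longrightarrow> (\<lambda>n \<sigma>. a n \<sigma> - b n \<sigma>) \<in> coboundary_ideal X"
  using coboundary_ideal_add[of a X "\<lambda>n \<sigma>. (-1) * b n \<sigma>"] coboundary_ideal_scale[of b X "-1"] by simp

lemma coboundary_ideal_zero: "(\<lambda>_ _. 0) \<in> (coboundary_ideal X :: (nat \<Rightarrow> ('a, 'c::comm_ring_1) cochain) set)"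
proof -
  let ?z = "(\<lambda>_ _. 0) :: nat \<Rightarrow> ('a, 'c) cochain"
  have "?z \<in> carrier (cochain_ring X)"
    by (simp add: carrier_cochain_ring singular_cochain_def)
  moreover have "coboundary X ?z = ?z"
    using coboundary_scale[of X 0 ?z] by simp
  ultimately show ?thesis
    unfolding coboundary_ideal_def by (metis imageI)
qed

lemma ideal_subset_cocycle_ring: "a \<in> coboundary_ideal X \<Longrightarrow> a \<in> carrier (cocycle_ring X)"
  using coboundary_in_cocycle_ring by (auto simp: coboundary_ideal_def)

lemma cocycle_of_cocycle_ring: "z \<in> carrier (cocycle_ring X) \<Longrightarrow> cocycle n X (z n)"
  unfolding carrier_cocycle_ring cocycle_def cochain_eq_def by (metis coboundary_Suc)

lemma cbd_mult:
  assumes "singular_simplex (Suc n) X \<sigma>"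
  shows "cbd n ((c \<otimes>\<^bsub>cocycle_ring X\<^esub> d) n) \<sigma> = (\<Sum>p\<le>n. cup (Suc p) (n - p) (cbd p (c p)) (d (n - p)) \<sigma> +
    (-1) ^ p * cup p (Suc (n - p)) (c p) (cbd (n - p) (d (n - p))) \<sigma>)"
proof -
  have "cbd n ((c \<otimes>\<^bsub>cocycle_ring X\<^esub> d) n) \<sigma> = cbd n (\<lambda>\<tau>. \<Sum>p\<le>n. cup p (n - p) (c p) (d (n - p)) \<tau>) \<sigma>"
    using assms by (intro cbd_cong) (simp add: mult_cocycle_ring singular_simplex_face)
  also have "\<dots> = (\<Sum>p\<le>n. cbd n (cup p (n - p) (c p) (d (n - p))) \<sigma>)"
    by (simp only: cbd_def sum_distrib_left) (rule sum.swap)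
  also have "\<dots> = (\<Sum>p\<le>n. cup (Suc p) (n - p) (cbd p (c p)) (d (n - p)) \<sigma> +
    (-1) ^ p * cup p (Suc (n - p)) (c p) (cbd (n - p) (d (n - p))) \<sigma>)"
  proof (rule sum.cong)
    fix p assume "p \<in> {..n}"
    then show "cbd n (cup p (n - p) (c p) (d (n - p))) \<sigma> = cup (Suc p) (n - p) (cbd p (c p)) (d (n - p)) \<sigma> +
      (-1) ^ p * cup p (Suc (n - p)) (c p) (cbd (n - p) (d (n - p))) \<sigma>"
      using cbd_cup[of p "n - p" "c p" "d (n - p)" \<sigma>] by simp
  qed simp
  finally show ?thesis .
qed

text \<open>
  \<open>(\<delta> c) z = \<delta> (c z)\<close> for a cocycle \<open>z\<close>.
\<close>

lemma coboundary_ideal_mult_right: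
  assumes a: "a \<in> coboundary_ideal X" and z: "z \<in> carrier (cocycle_ring X)"
  shows "a \<otimes>\<^bsub>cocycle_ring X\<^esub> z \<in> coboundary_ideal X"
proof -
  obtain c where c: "c \<in> carrier (cochain_ring X)" "a = coboundary X c"
    using a by (auto simp: coboundary_ideal_def)
  have "(a \<otimes>\<^bsub>cocycle_ring X\<^esub> z) n \<sigma> = coboundary X (c \<otimes>\<^bsub>cocycle_ring X\<^esub> z) n \<sigma>" for n \<sigma>
  proof (cases n)
    case 0
    then show ?thesis by (simp add: c(2) coboundary_0 mult_cocycle_ring cup_def)
  next
    case (Suc m)
    show ?thesis
    proof (cases "singular_simplex n X \<sigma>")
      case True
      have 1: "cup p (Suc (m - p)) (c p) (cbd (m - p) (z (m - p))) \<sigma> = 0" if "p \<le> m" for p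
        using cocycle_of_cocycle_ring[OF z, of "m - p"] singular_simplex_back[of p "Suc (m - p)" X \<sigma>] True that
        by (simp add: Suc cocycle_def cochain_eq_def cup_def Suc_diff_le)
      have 2: "cup (Suc p) (m - p) (a (Suc p)) (z (m - p)) \<sigma> = cup (Suc p) (m - p) (cbd p (c p)) (z (m - p)) \<sigma>" if "p \<le> m" for p
        using singular_simplex_front[of n X \<sigma> "Suc p"] True that by (simp add: Suc c(2) coboundary_Suc cup_def)
      have "(a \<otimes>\<^bsub>cocycle_ring X\<^esub> z) n \<sigma> = (\<Sum>p\<le>m. cup (Suc p) (m - p) (a (Suc p)) (z (m - p)) \<sigma>)"
        using True by (simp only: mult_cocycle_ring Suc sum.atMost_Suc_shift) (simp add: c(2) coboundary_0 cup_def)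
      also have "\<dots> = (\<Sum>p\<le>m. cup (Suc p) (m - p) (cbd p (c p)) (z (m - p)) \<sigma> +
          (-1) ^ p * cup p (Suc (m - p)) (c p) (cbd (m - p) (z (m - p))) \<sigma>)"
        by (rule sum.cong) (simp_all add: 1 2)
      also have "\<dots> = coboundary X (c \<otimes>\<^bsub>cocycle_ring X\<^esub> z) n \<sigma>"
        using True cbd_mult[of m X \<sigma> c z] by (simp add: Suc coboundary_Suc)
      finally show ?thesis .
    qed (simp add: Suc coboundary_Suc mult_cocycle_ring)
  qed
  then have "a \<otimes>\<^bsub>cocycle_ring X\<^esub> z = coboundary X (c \<otimes>\<^bsub>cocycle_ring X\<^esub> z)"
    by blast
  moreover have "c \<otimes>\<^bsub>cocycle_ring X\<^esub> z \<in> carrier (cochain_ring X)"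
    using cochain_mult_closed[OF c(1)] z by (simp add: carrier_cocycle_ring)
  ultimately show ?thesis
    by (simp add: coboundary_ideal_def)
qed

text \<open>
  In degree \<open>p\<close> the Leibniz rule has the sign \<open>(-1)\<^sup>p\<close>, so \<open>z (\<delta> c) = \<delta> (z' c)\<close> with the signs of
  \<open>z'\<close> alternating with the degree.
\<close>

lemma coboundary_ideal_mult_left:
  assumes a: "a \<in> coboundary_ideal X" and z: "z \<in> carrier (cocycle_ring X)"
  shows "z \<otimes>\<^bsub>cocycle_ring X\<^esub> a \<in> coboundary_ideal X"
proof -
  obtain c where c: "c \<in> carrier (cochain_ring X)" "a = coboundary X c"
    using a by (auto simp: coboundary_ideal_def)
  let ?z = "\<lambda>n \<sigma>. (-1) ^ n * z n \<sigma>"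
  have "(z \<otimes>\<^bsub>cocycle_ring X\<^esub> a) n \<sigma> = coboundary X (?z \<otimes>\<^bsub>cocycle_ring X\<^esub> c) n \<sigma>" for n \<sigma>
  proof (cases n)
    case 0
    then show ?thesis by (simp add: c(2) coboundary_0 mult_cocycle_ring cup_def)
  next
    case (Suc m)
    show ?thesis
    proof (cases "singular_simplex n X \<sigma>")
      case True
      have 1: "cup (Suc p) (m - p) (cbd p (?z p)) (c (m - p)) \<sigma> = 0" if "p \<le> m" for p
        using cocycle_of_cocycle_ring[OF z, of p] singular_simplex_front[of n X \<sigma> "Suc p"] True that
        by (simp add: Suc cocycle_def cochain_eq_def cup_def cbd_scale)
      have 2: "cup p (Suc (m - p)) (z p) (a (Suc (m - p))) \<sigma> = cup p (Suc (m - p)) (z p) (cbd (m - p) (c (m - p))) \<sigma>" if "p \<le> m" for p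
        using singular_simplex_back[of p "Suc (m - p)" X \<sigma>] True that by (simp add: Suc c(2) coboundary_Suc cup_def)
      have "(z \<otimes>\<^bsub>cocycle_ring X\<^esub> a) n \<sigma> = (\<Sum>p\<le>m. cup p (Suc m - p) (z p) (a (Suc m - p)) \<sigma>)"
        using True by (simp only: mult_cocycle_ring Suc sum.atMost_Suc) (simp add: c(2) coboundary_0 cup_def)
      also have "\<dots> = (\<Sum>p\<le>m. cup (Suc p) (m - p) (cbd p (?z p)) (c (m - p)) \<sigma> +
          (-1) ^ p * cup p (Suc (m - p)) (?z p) (cbd (m - p) (c (m - p))) \<sigma>)"
      proof (rule sum.cong)
        fix p assume "p \<in> {..m}"
        then have p: "p \<le> m" by simp
        have "(-1) ^ p * cup p (Suc (m - p)) (?z p) (cbd (m - p) (c (m - p))) \<sigma> =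
            cup p (Suc (m - p)) (z p) (cbd (m - p) (c (m - p))) \<sigma>"
          by (simp add: cup_def flip: mult.assoc power_add)
        then show "cup p (Suc m - p) (z p) (a (Suc m - p)) \<sigma> = cup (Suc p) (m - p) (cbd p (?z p)) (c (m - p)) \<sigma> +
          (-1) ^ p * cup p (Suc (m - p)) (?z p) (cbd (m - p) (c (m - p))) \<sigma>"
          using 1[OF p] 2[OF p] p by (simp add: Suc_diff_le)
      qed simp
      also have "\<dots> = coboundary X (?z \<otimes>\<^bsub>cocycle_ring X\<^esub> c) n \<sigma>"
        using True cbd_mult[of m X \<sigma> ?z c] by (simp add: Suc coboundary_Suc)
      finally show ?thesis .
    qed (simp add: Suc coboundary_Suc mult_cocycle_ring)
  qed
  then have "z \<otimes>\<^bsub>cocycle_ring X\<^esub> a = coboundary X (?z \<otimes>\<^bsub>cocycle_ring X\<^esub> c)"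
    by blast
  moreover have "?z \<otimes>\<^bsub>cocycle_ring X\<^esub> c \<in> carrier (cochain_ring X)"
    using cochain_mult_closed[OF cochain_scale_closed c(1)] z by (simp add: carrier_cocycle_ring)
  ultimately show ?thesis
    by (simp add: coboundary_ideal_def)
qed

lemma in_cohomology_class: "x \<in> cohomology_class X z \<longleftrightarrow> (\<lambda>n \<sigma>. x n \<sigma> - z n \<sigma>) \<in> coboundary_ideal X"
proof
  assume "x \<in> cohomology_class X z"
  then obtain a where "a \<in> coboundary_ideal X" "x = (\<lambda>n \<sigma>. a n \<sigma> + z n \<sigma>)"
    by (auto simp: cohomology_class_def a_r_coset_def' add_cocycle_ring)
  then show "(\<lambda>n \<sigma>. x n \<sigma> - z n \<sigma>) \<in> coboundary_ideal X" by simp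
next
  assume "(\<lambda>n \<sigma>. x n \<sigma> - z n \<sigma>) \<in> coboundary_ideal X"
  then show "x \<in> cohomology_class X z"
    by (auto simp: cohomology_class_def a_r_coset_def' add_cocycle_ring intro!: bexI[of _ "\<lambda>n \<sigma>. x n \<sigma> - z n \<sigma>"])
qed

lemma cohomology_class_eq_iff: "cohomology_class X z = cohomology_class X w \<longleftrightarrow> (\<lambda>n \<sigma>. z n \<sigma> - w n \<sigma>) \<in> coboundary_ideal X"
proof
  assume "cohomology_class X z = cohomology_class X w"
  moreover have "z \<in> cohomology_class X z" by (simp add: in_cohomology_class coboundary_ideal_zero)
  ultimately show "(\<lambda>n \<sigma>. z n \<sigma> - w n \<sigma>) \<in> coboundary_ideal X" by (simp add: in_cohomology_class)
next
  assume zw: "(\<lambda>n \<sigma>. z n \<sigma> - w n \<sigma>) \<in> coboundary_ideal X"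
  show "cohomology_class X z = cohomology_class X w"
  proof (rule Set.set_eqI)
    fix x
    show "x \<in> cohomology_class X z \<longleftrightarrow> x \<in> cohomology_class X w"
      using coboundary_ideal_add[OF _ zw, of "\<lambda>n \<sigma>. x n \<sigma> - z n \<sigma>"] coboundary_ideal_diff[OF _ zw, of "\<lambda>n \<sigma>. x n \<sigma> - w n \<sigma>"]
      by (auto simp: in_cohomology_class)
  qed
qed

lemma zero_cohomology_ring: "zero (cohomology_ring X) = coboundary_ideal X"
  by (simp add: cohomology_ring_def FactRing_def)

lemma one_cohomology_ring:
  "one (cohomology_ring X) = cohomology_class X (homogeneous X 0 (\<lambda>_. 1 :: 'c::comm_ring_1))"
proof -
  have "one (cocycle_ring X) = homogeneous X 0 (\<lambda>_. 1 :: 'c)"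
    by (auto simp: cocycle_ring_def cochain_ring_def homogeneous_def fun_eq_iff)
  then show ?thesis
    by (simp add: cohomology_ring_def FactRing_def cohomology_class_def)
qed

lemma cohomology_class_eq_zero_iff: "cohomology_class X z = coboundary_ideal X \<longleftrightarrow> z \<in> coboundary_ideal X"
proof -
  have "cohomology_class X (\<lambda>n \<sigma>. 0 * z n \<sigma>) = coboundary_ideal X"
    by (auto simp: in_cohomology_class)
  then show ?thesis
    using cohomology_class_eq_iff[of X z "\<lambda>n \<sigma>. 0 * z n \<sigma>"] by simp
qed

text \<open>
  The product of cosets is defined as a union over representatives; it is a single coset because
  \<open>x y - z w = (x - z) y + z (y - w)\<close> lies in the ideal.
\<close>

lemma mult_cohomology_class:
  assumes z: "z \<in> carrier (cocycle_ring X)" and w: "w \<in> carrier (cocycle_ring X)"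
  shows "mult (cohomology_ring X) (cohomology_class X z) (cohomology_class X w) = cohomology_class X (z \<otimes>\<^bsub>cocycle_ring X\<^esub> w)"
proof -
  have eq: "cohomology_class X (x \<otimes>\<^bsub>cocycle_ring X\<^esub> y) = cohomology_class X (z \<otimes>\<^bsub>cocycle_ring X\<^esub> w)"
    if x: "x \<in> cohomology_class X z" and y: "y \<in> cohomology_class X w" for x y
  proof -
    let ?i = "\<lambda>n \<sigma>. x n \<sigma> - z n \<sigma>" and ?j = "\<lambda>n \<sigma>. y n \<sigma> - w n \<sigma>"
    have i: "?i \<in> coboundary_ideal X" and j: "?j \<in> coboundary_ideal X"
      using x y by (simp_all add: in_cohomology_class)
    have "(\<lambda>n \<sigma>. ?j n \<sigma> + w n \<sigma>) \<in> carrier (cochain_ring X)"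
      using ideal_subset_cocycle_ring[OF j] w by (intro cochain_add_closed) (simp_all add: carrier_cocycle_ring)
    moreover have "coboundary X (\<lambda>n \<sigma>. ?j n \<sigma> + w n \<sigma>) = (\<lambda>_ _. 0)"
      unfolding coboundary_add using ideal_subset_cocycle_ring[OF j] w by (simp add: carrier_cocycle_ring)
    ultimately have "y \<in> carrier (cocycle_ring X)"
      by (simp add: carrier_cocycle_ring)
    then have "(\<lambda>n \<sigma>. (?i \<otimes>\<^bsub>cocycle_ring X\<^esub> y) n \<sigma> + (z \<otimes>\<^bsub>cocycle_ring X\<^esub> ?j) n \<sigma>) \<in> coboundary_ideal X"
      by (intro coboundary_ideal_add coboundary_ideal_mult_right[OF i] coboundary_ideal_mult_left[OF j] z)
    moreover have "(?i \<otimes>\<^bsub>cocycle_ring X\<^esub> y) n \<sigma> + (z \<otimes>\<^bsub>cocycle_ring X\<^esub> ?j) n \<sigma> =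
        (x \<otimes>\<^bsub>cocycle_ring X\<^esub> y) n \<sigma> - (z \<otimes>\<^bsub>cocycle_ring X\<^esub> w) n \<sigma>" for n \<sigma>
      by (simp add: mult_cocycle_ring cup_def algebra_simps flip: sum.distrib sum_subtractf)
    ultimately show ?thesis
      by (simp add: cohomology_class_eq_iff)
  qed
  have "mult (cohomology_ring X) (cohomology_class X z) (cohomology_class X w) =
      (\<Union>x\<in>cohomology_class X z. \<Union>y\<in>cohomology_class X w. cohomology_class X (x \<otimes>\<^bsub>cocycle_ring X\<^esub> y))"
    by (simp add: cohomology_ring_def FactRing_def rcoset_mult_def cohomology_class_def)
  also have "\<dots> = (\<Union>x\<in>cohomology_class X z. \<Union>y\<in>cohomology_class X w. cohomology_class X (z \<otimes>\<^bsub>cocycle_ring X\<^esub> w))"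
    using eq by simp
  also have "\<dots> = cohomology_class X (z \<otimes>\<^bsub>cocycle_ring X\<^esub> w)"
  proof -
    have "z \<in> cohomology_class X z" "w \<in> cohomology_class X w" by (simp_all add: in_cohomology_class coboundary_ideal_zero)
    then show ?thesis by auto
  qed
  finally show ?thesis .
qed

lemma homogeneous_in_cochain_ring: "homogeneous X n c \<in> carrier (cochain_ring X)"
proof -
  have "{j. homogeneous X n c j \<noteq> (\<lambda>_. 0)} \<subseteq> {n}"
    by (auto simp: homogeneous_def fun_eq_iff)
  then have "finite {j. homogeneous X n c j \<noteq> (\<lambda>_. 0)}"
    by (rule finite_subset) simp
  then show ?thesis
    unfolding carrier_cochain_ring by (auto simp: singular_cochain_def homogeneous_def)
qed

lemma coboundary_homogeneous: "coboundary X (homogeneous X n c) = homogeneous X (Suc n) (cbd n c)"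
proof (intro ext)
  fix j \<sigma>
  show "coboundary X (homogeneous X n c) j \<sigma> = homogeneous X (Suc n) (cbd n c) j \<sigma>"
  proof (cases j)
    case (Suc m)
    have "cbd m (homogeneous X n c m) \<sigma> = cbd m (if m = n then c else (\<lambda>_. 0)) \<sigma>" if "singular_simplex (Suc m) X \<sigma>"
      using that by (intro cbd_cong) (auto simp: homogeneous_def singular_simplex_face)
    then show ?thesis
      by (auto simp: Suc coboundary_Suc cbd_zero homogeneous_def[of X "Suc n"])
  qed (simp add: coboundary_0 homogeneous_def)
qed

lemma homogeneous_eq_iff: "homogeneous X n c = homogeneous X n d \<longleftrightarrow> cochain_eq n X c d"
  by (auto simp: homogeneous_def cochain_eq_def fun_eq_iff)

lemma homogeneous_zero: "homogeneous X n (\<lambda>_. 0) = (\<lambda>_ _. 0)"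
  by (auto simp: homogeneous_def fun_eq_iff)

lemma homogeneous_in_cocycle_ring: "homogeneous X n c \<in> carrier (cocycle_ring X) \<longleftrightarrow> cocycle n X c"
  using homogeneous_eq_iff[of X "Suc n" "cbd n c" "\<lambda>_. 0"]
  by (simp add: carrier_cocycle_ring homogeneous_in_cochain_ring coboundary_homogeneous homogeneous_zero cocycle_def)

lemma exact_if_component_in_ideal:
  assumes "a \<in> coboundary_ideal X" shows "exact n X (a n)"
proof -
  obtain b where b: "a = coboundary X b"
    using assms by (auto simp: coboundary_ideal_def)
  show ?thesis
  proof (cases n)
    case 0
    then show ?thesis by (simp add: b coboundary_0 exact_rel_0)
  next
    case (Suc m)
    have "cochain_eq (Suc m) X (a (Suc m)) (cbd m (b m))"
      by (simp add: b cochain_eq_def coboundary_Suc)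
    then show ?thesis unfolding Suc exact_Suc by blast
  qed
qed

lemma homogeneous_self: "cochain_eq n X (homogeneous X n c n) c"
  by (simp add: cochain_eq_def homogeneous_def)

lemma homogeneous_in_ideal: "homogeneous X n c \<in> coboundary_ideal X \<longleftrightarrow> exact n X c"
proof
  assume "homogeneous X n c \<in> coboundary_ideal X"
  from exact_if_component_in_ideal[OF this, of n] show "exact n X c"
    using exact_rel_cong[OF homogeneous_self] by blast
next
  assume c: "exact n X c"
  show "homogeneous X n c \<in> coboundary_ideal X"
  proof (cases n)
    case 0
    with c have "homogeneous X n c = (\<lambda>_ _. 0)"
      using homogeneous_eq_iff[of X n c "\<lambda>_. 0"] by (simp add: exact_rel_0 homogeneous_zero)
    then show ?thesis by (simp add: coboundary_ideal_zero)
  next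
    case (Suc m)
    with c obtain d where "cochain_eq n X c (cbd m d)" by (auto simp: exact_Suc)
    then have "homogeneous X n c = coboundary X (homogeneous X m d)"
      by (simp add: coboundary_homogeneous homogeneous_eq_iff flip: Suc)
    then show ?thesis
      unfolding coboundary_ideal_def using homogeneous_in_cochain_ring by (metis imageI)
  qed
qed

lemma mult_homogeneous:
  "homogeneous X n c \<otimes>\<^bsub>cocycle_ring X\<^esub> homogeneous X m d = homogeneous X (n + m) (cup n m c d)"
proof (intro ext)
  fix j \<sigma>
  let ?t = "\<lambda>p. cup p (j - p) (homogeneous X n c p) (homogeneous X m d (j - p)) \<sigma>"
  show "(homogeneous X n c \<otimes>\<^bsub>cocycle_ring X\<^esub> homogeneous X m d) j \<sigma> = homogeneous X (n + m) (cup n m c d) j \<sigma>"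
  proof (cases "singular_simplex j X \<sigma>")
    case True
    have t: "?t p = (if p = n then if j = n + m then cup n m c d \<sigma> else 0 else 0)" if "p \<le> j" for p
      using that True singular_simplex_front[of j X \<sigma> n] singular_simplex_back[of n m X \<sigma>]
      by (auto simp: homogeneous_def cup_def)
    have "(\<Sum>p\<le>j. ?t p) = (\<Sum>p\<le>j. if p = n then if j = n + m then cup n m c d \<sigma> else 0 else 0)"
      by (rule sum.cong) (simp_all add: t)
    then show ?thesis
      using True by (simp add: mult_cocycle_ring) (auto simp: homogeneous_def)
  qed (auto simp: mult_cocycle_ring homogeneous_def)
qed

lemma cohomology_of_dim_eq:
  "cohomology_of_dim n X = {cohomology_class X (homogeneous X n c) | c. cocycle n X c}"
proof (rule Set.set_eqI, rule iffI)
  fix x assume "x \<in> cohomology_of_dim n X"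
  then obtain z where z: "x = cohomology_class X z" "z \<in> carrier (cocycle_ring X)" "\<forall>j. j \<noteq> n \<longrightarrow> z j = (\<lambda>_. 0)"
    by (auto simp: cohomology_of_dim_def cohomology_class_def)
  have "singular_cochain n X (z n)"
    using z(2) by (simp add: carrier_cocycle_ring carrier_cochain_ring)
  then have zn: "z = homogeneous X n (z n)"
    using z(3) by (fastforce simp: homogeneous_def singular_cochain_def fun_eq_iff)
  have "x = cohomology_class X (homogeneous X n (z n))"
    by (subst zn[symmetric]) (rule z(1))
  then show "x \<in> {cohomology_class X (homogeneous X n c) | c. cocycle n X c}"
    using cocycle_of_cocycle_ring[OF z(2)] by auto
next
  fix x assume "x \<in> {cohomology_class X (homogeneous X n c) | c. cocycle n X c}"
  then obtain c where "x = cohomology_class X (homogeneous X n c)" "cocycle n X c" by blast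
  then show "x \<in> cohomology_of_dim n X"
    unfolding cohomology_of_dim_def cohomology_class_def using homogeneous_in_cocycle_ring
    by (fastforce simp: homogeneous_def)
qed

definition cohomology_classes :: "'a topology \<Rightarrow> (nat \<times> ('a, 'c::comm_ring_1) cochain) list \<Rightarrow> (nat \<Rightarrow> ('a, 'c) cochain) set list"
  where "cohomology_classes X = map (\<lambda>(n, c). cohomology_class X (homogeneous X n c))"

lemma foldr_cohomology_classes:
  assumes "cocycles X l"
  shows "foldr (mult (cohomology_ring X)) (cohomology_classes X l) (one (cohomology_ring X)) =
    cohomology_class X (homogeneous X (total_degree l) (cup_list l))"
  using assms
proof (induction l)
  case Nil
  then show ?case by (simp add: cohomology_classes_def one_cohomology_ring)
next
  case (Cons z l)
  obtain n c where z: "z = (n, c)" by (cases z)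
  have "foldr (mult (cohomology_ring X)) (cohomology_classes X (z # l)) (one (cohomology_ring X)) =
      mult (cohomology_ring X) (cohomology_class X (homogeneous X n c)) (cohomology_class X (homogeneous X (total_degree l) (cup_list l)))"
    using Cons by (simp add: cohomology_classes_def z)
  also have "\<dots> = cohomology_class X (homogeneous X (n + total_degree l) (cup n (total_degree l) c (cup_list l)))"
    using Cons.prems z cocycle_cup_list[of X l]
    by (subst mult_cohomology_class) (auto simp: homogeneous_in_cocycle_ring mult_homogeneous)
  finally show ?case by (simp add: z)
qed

lemma positive_dimensional_iff_cohomology_classes:
  "(\<forall>x\<in>set as. \<exists>n>0. x \<in> cohomology_of_dim n X) \<longleftrightarrow> (\<exists>l. cocycles X l \<and> positive_degrees l \<and> as = cohomology_classes X l)"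
proof
  show "\<forall>x\<in>set as. \<exists>n>0. x \<in> cohomology_of_dim n X \<Longrightarrow> \<exists>l. cocycles X l \<and> positive_degrees l \<and> as = cohomology_classes X l"
  proof (induction as)
    case Nil
    show ?case by (intro exI[of _ "[]"]) (simp add: cohomology_classes_def)
  next
    case (Cons x as)
    then obtain l where l: "cocycles X l" "positive_degrees l" "as = cohomology_classes X l" by auto
    obtain n c where "0 < n" "cocycle n X c" "x = cohomology_class X (homogeneous X n c)"
      using Cons.prems by (auto simp: cohomology_of_dim_eq)
    with l show ?case by (intro exI[of _ "(n, c) # l"]) (simp add: cohomology_classes_def)
  qed
next
  assume "\<exists>l. cocycles X l \<and> positive_degrees l \<and> as = cohomology_classes X l"
  then obtain l where l: "cocycles X l" "positive_degrees l" "as = cohomology_classes X l" by blast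
  show "\<forall>x\<in>set as. \<exists>n>0. x \<in> cohomology_of_dim n X"
  proof
    fix x assume "x \<in> set as"
    then obtain n c where "(n, c) \<in> set l" "x = cohomology_class X (homogeneous X n c)"
      using l(3) by (auto simp: cohomology_classes_def)
    then show "\<exists>n>0. x \<in> cohomology_of_dim n X"
      using l(1,2) unfolding cohomology_of_dim_eq cocycles_def positive_degrees_def by blast
  qed
qed

text \<open>
  A non-zero homogeneous class has only one dimension, as coboundaries are tested degree by degree.
\<close>

lemma dim_of_nonzero:
  assumes c: "cocycle n X c" and ne: "\<not> exact n X c"
  shows "cohomology_class X (homogeneous X n c) \<in> cohomology_of_dim m X \<longleftrightarrow> m = n"
proof
  assume "cohomology_class X (homogeneous X n c) \<in> cohomology_of_dim m X"
  then obtain d where "cohomology_class X (homogeneous X n c) = cohomology_class X (homogeneous X m d)"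
    by (auto simp: cohomology_of_dim_eq)
  then have "(\<lambda>j \<sigma>. homogeneous X n c j \<sigma> - homogeneous X m d j \<sigma>) \<in> coboundary_ideal X"
    by (simp add: cohomology_class_eq_iff)
  then have ex: "exact n X (\<lambda>\<sigma>. homogeneous X n c n \<sigma> - homogeneous X m d n \<sigma>)"
    by (rule exact_if_component_in_ideal)
  show "m = n"
  proof (rule ccontr)
    assume "m \<noteq> n"
    then have "(\<lambda>\<sigma>. homogeneous X n c n \<sigma> - homogeneous X m d n \<sigma>) = homogeneous X n c n"
      by (simp add: homogeneous_def fun_eq_iff)
    with ex have "exact n X c"
      using exact_rel_cong[OF homogeneous_self] by metis
    with ne show False ..
  qed
next
  show "m = n \<Longrightarrow> cohomology_class X (homogeneous X n c) \<in> cohomology_of_dim m X"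
    using c by (auto simp: cohomology_of_dim_eq)
qed

lemma p_length_eq:
  "p_length TYPE('c::comm_ring_1) m p X = (GREATEST q. \<exists>n. nonzero_product TYPE('c) X q n \<and> n + p \<le> m)"
proof -
  have "(\<exists>as :: (nat \<Rightarrow> ('a, 'c) cochain) set list.
       let H = cohomology_ring X; a = foldr (mult H) as (one H)
       in length as = q \<and> (\<forall>x \<in> set as. \<exists>n>0. x \<in> cohomology_of_dim n X) \<and>
          a \<noteq> zero H \<and> (\<exists>n. a \<in> cohomology_of_dim n X \<and> n + p \<le> m)) \<longleftrightarrow>
      (\<exists>n. nonzero_product TYPE('c) X q n \<and> n + p \<le> m)" (is "?L \<longleftrightarrow> ?R") for q
  proof -
    have len: "length (cohomology_classes X l) = length l" for l :: "(nat \<times> ('a, 'c) cochain) list"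
      by (simp add: cohomology_classes_def)
    have reindex: "(\<exists>as. A as \<and> (\<exists>l. B l \<and> C l \<and> as = f l) \<and> D as) \<longleftrightarrow> (\<exists>l. B l \<and> C l \<and> A (f l) \<and> D (f l))"
      for A D :: "'x \<Rightarrow> bool" and B C :: "'y \<Rightarrow> bool" and f
      by blast
    let ?F = "\<lambda>as. foldr (mult (cohomology_ring X)) as (one (cohomology_ring X)) :: (nat \<Rightarrow> ('a, 'c) cochain) set"
    have "?L \<longleftrightarrow> (\<exists>l :: (nat \<times> ('a, 'c) cochain) list. cocycles X l \<and> positive_degrees l \<and> length (cohomology_classes X l) = q \<and>
        ?F (cohomology_classes X l) \<noteq> coboundary_ideal X \<and> (\<exists>n. ?F (cohomology_classes X l) \<in> cohomology_of_dim n X \<and> n + p \<le> m))"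
      unfolding Let_def positive_dimensional_iff_cohomology_classes zero_cohomology_ring by (rule reindex)
    also have "\<dots> \<longleftrightarrow> (\<exists>l :: (nat \<times> ('a, 'c) cochain) list. cocycles X l \<and> positive_degrees l \<and> length l = q \<and>
        cohomology_class X (homogeneous X (total_degree l) (cup_list l)) \<noteq> coboundary_ideal X \<and>
        (\<exists>n. cohomology_class X (homogeneous X (total_degree l) (cup_list l)) \<in> cohomology_of_dim n X \<and> n + p \<le> m))"
      by (simp add: foldr_cohomology_classes len cong: conj_cong)
    also have "\<dots> \<longleftrightarrow> (\<exists>l :: (nat \<times> ('a, 'c) cochain) list. cocycles X l \<and> positive_degrees l \<and> length l = q \<and>
        \<not> exact (total_degree l) X (cup_list l) \<and> total_degree l + p \<le> m)"
      unfolding cohomology_class_eq_zero_iff homogeneous_in_ideal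
      by (simp add: dim_of_nonzero cocycle_cup_list cong: conj_cong)
    also have "\<dots> \<longleftrightarrow> ?R"
      unfolding nonzero_product_def by blast
    finally show ?thesis .
  qed
  then show ?thesis
    unfolding p_length_def by presburger
qed

section \<open>The p-length of a product of spheres\<close>

lemma sum_alternating: "(\<Sum>k\<le>n. (-1) ^ k :: 'c::comm_ring_1) = (if even n then 1 else 0)"
  by (induction n) auto

text \<open>
  There is one simplex in each degree, and the coboundary from degree \<open>m\<close> to \<open>m + 1\<close> is the alternating
  sum of \<open>m + 2\<close> ones: the identity for odd \<open>m\<close> and zero for even \<open>m\<close>.
\<close>

lemma exact_on_point:
  assumes X: "topspace X = {a}" and c: "cocycle n X c" and n: "0 < n"
  shows "exact n X c"
proof -
  let ?\<sigma> = "\<lambda>n. restrict (\<lambda>_. a) (standard_simplex n)"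
  have simplex: "singular_simplex n X \<sigma> \<longleftrightarrow> \<sigma> = ?\<sigma> n" for n \<sigma>
    using singular_simplex_singleton[OF X] .
  have cbd: "cbd m d (?\<sigma> (Suc m)) = (if odd m then 1 else 0) * d (?\<sigma> m)" for m and d :: "('a, 'b) cochain"
  proof -
    have "singular_face (Suc m) k (?\<sigma> (Suc m)) = ?\<sigma> m" if "k \<le> Suc m" for k
      using singular_simplex_face[of m X "?\<sigma> (Suc m)" k] that by (simp add: simplex)
    then have "cbd m d (?\<sigma> (Suc m)) = (\<Sum>k\<le>Suc m. (-1) ^ k * d (?\<sigma> m))"
      unfolding cbd_def by (intro sum.cong) simp_all
    also have "\<dots> = (\<Sum>k\<le>Suc m. (-1) ^ k) * d (?\<sigma> m)"
      by (simp only: sum_distrib_right)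
    finally show ?thesis by (simp only: sum_alternating) simp
  qed
  show ?thesis
  proof (cases "odd n")
    case True
    then have "c (?\<sigma> n) = 0"
      using c cbd[of n c] by (simp add: cocycle_def cochain_eq_def simplex)
    then have "cochain_eq n X c (\<lambda>_. 0)"
      by (simp add: cochain_eq_def simplex)
    then show ?thesis using exact_rel_cong exact_rel_zero by blast
  next
    case False
    obtain m where m: "n = Suc m" using n gr0_conv_Suc by auto
    have "cochain_eq n X c (cbd m (\<lambda>_. c (?\<sigma> n)))"
      using False cbd[of m "\<lambda>_. c (?\<sigma> n)"] by (simp add: cochain_eq_def simplex m)
    then show ?thesis unfolding m exact_Suc by blast
  qed
qed

lemma total_degree_pos: "positive_degrees l \<Longrightarrow> l \<noteq> [] \<Longrightarrow> 0 < total_degree l"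
  by (cases l) (auto simp: positive_degrees_def)

lemma nonzero_product_point_iff:
  assumes X: "topspace X = {a}"
  shows "nonzero_product TYPE('c::comm_ring_1) X q n \<longleftrightarrow> q = 0 \<and> n = 0"
proof
  assume "nonzero_product TYPE('c) X q n"
  then obtain l :: "(nat \<times> ('a, 'c) cochain) list" where l: "cocycles X l" "positive_degrees l" "length l = q"
      "total_degree l = n" "\<not> exact n X (cup_list l)"
    unfolding nonzero_product_def by blast
  have "\<not> 0 < n"
    using exact_on_point[OF X] cocycle_cup_list[OF l(1)] l(4,5) by blast
  with l total_degree_pos show "q = 0 \<and> n = 0" by fastforce
next
  assume "q = 0 \<and> n = 0"
  moreover have "\<not> exact 0 X (\<lambda>_. 1 :: 'c)"
    using singular_simplex_singleton[OF X, of 0] by (auto simp: exact_rel_0 cochain_eq_def)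
  ultimately show "nonzero_product TYPE('c) X q n"
    unfolding nonzero_product_def by (intro exI[of _ "[]"]) simp
qed

lemma nonzero_product_insert_factor:
  fixes S :: "'i \<Rightarrow> 'b topology"
  assumes j: "j \<notin> I"
  shows "nonzero_product TYPE('c::comm_ring_1) (product_topology S (insert j I)) q n \<longleftrightarrow>
    nonzero_product TYPE('c) (prod_topology (product_topology S I) (S j)) q n"
proof -
  let ?A = "product_topology S (insert j I)" and ?B = "prod_topology (product_topology S I) (S j)"
  let ?f = "\<lambda>x. (restrict x I, x j)" and ?g = "\<lambda>(x, t). x(j := t)"
  have "continuous_map ?A (product_topology S I) (\<lambda>x. restrict x I)"
    by (auto simp: continuous_map_componentwise intro: continuous_map_product_projection)
  then have f: "continuous_map ?A ?B ?f"
    by (simp add: continuous_map_pairedI continuous_map_product_projection)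
  have g: "continuous_map ?B ?A ?g"
    unfolding continuous_map_componentwise
  proof (intro conjI ballI)
    show "?g ` topspace ?B \<subseteq> extensional (insert j I)"
      by (auto simp: PiE_def extensional_def)
    fix i assume i: "i \<in> insert j I"
    show "continuous_map ?B (S i) (\<lambda>z. ?g z i)"
    proof (cases "i = j")
      case True
      then show ?thesis by (simp add: case_prod_unfold continuous_map_snd)
    next
      case False
      then have "continuous_map ?B (S i) ((\<lambda>x. x i) \<circ> fst)"
        using i by (intro continuous_map_compose[OF continuous_map_fst] continuous_map_product_projection) auto
      then show ?thesis
        using False by (simp add: case_prod_unfold o_def)
    qed
  qed
  have gf: "?g (?f x) = x" if "x \<in> topspace ?A" for x
    using that by (auto simp: fun_eq_iff PiE_def extensional_def)
  have fg: "?f (?g z) = z" if "z \<in> topspace ?B" for z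
    using that j by (auto simp: fun_eq_iff PiE_def extensional_def)
  show ?thesis
  proof
    show "nonzero_product TYPE('c) ?A q n \<Longrightarrow> nonzero_product TYPE('c) ?B q n"
      by (rule nonzero_product_retract[OF _ g f gf])
    show "nonzero_product TYPE('c) ?B q n \<Longrightarrow> nonzero_product TYPE('c) ?A q n"
      by (rule nonzero_product_retract[OF _ f g]) (auto simp: fg)
  qed
qed

text \<open>
  \<open>J\<close> consists of the spheres at which the second alternative of \<open>nonzero_product_times_sphere_cases\<close>
  occurs. Only these lower the degree, and only these can lower the number of factors.
\<close>

lemma nonzero_product_sphere_product_imp:
  assumes "finite I" "\<And>i. i \<in> I \<Longrightarrow> 0 < k i"
    and "nonzero_product TYPE('c::comm_ring_1) (product_topology (\<lambda>i. nsphere (k i)) I) q n"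
  shows "\<exists>J\<subseteq>I. q \<le> card J \<and> (\<Sum>i\<in>J. k i) = n"
  using assms
proof (induction I arbitrary: q n rule: finite_induct)
  case empty
  then show ?case
    using nonzero_product_point_iff[where ?'c = 'c and X = "product_topology (\<lambda>i. nsphere (k i)) {}"] by simp
next
  case (insert j I)
  have "nonzero_product TYPE('c) (prod_topology (product_topology (\<lambda>i. nsphere (k i)) I) (nsphere (k j))) q n"
    using insert.prems(2) nonzero_product_insert_factor[where ?'c = 'c, OF insert.hyps(2), where S = "\<lambda>i. nsphere (k i)"] by simp
  moreover have "0 < k j"
    using insert.prems(1) by simp
  ultimately have "nonzero_product TYPE('c) (product_topology (\<lambda>i. nsphere (k i)) I) q n \<or>
      (\<exists>q' n'. nonzero_product TYPE('c) (product_topology (\<lambda>i. nsphere (k i)) I) q' n' \<and> n = n' + k j \<and> q \<le> Suc q')"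
    by (rule nonzero_product_times_sphere_cases)
  then show ?case
  proof (elim disjE exE conjE)
    assume "nonzero_product TYPE('c) (product_topology (\<lambda>i. nsphere (k i)) I) q n"
    then obtain J where "J \<subseteq> I" "q \<le> card J" "(\<Sum>i\<in>J. k i) = n"
      using insert.IH[of q n] insert.prems(1) by auto
    then show ?thesis by (intro exI[of _ J]) auto
  next
    fix q' n'
    assume *: "nonzero_product TYPE('c) (product_topology (\<lambda>i. nsphere (k i)) I) q' n'" "n = n' + k j" "q \<le> Suc q'"
    then obtain J where J: "J \<subseteq> I" "q' \<le> card J" "(\<Sum>i\<in>J. k i) = n'"
      using insert.IH[of q' n'] insert.prems(1) by auto
    then have "finite J" "j \<notin> J"
      using insert.hyps finite_subset by auto
    with J * show ?thesis
      by (intro exI[of _ "insert j J"]) auto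
  qed
qed

lemma nonzero_product_sphere_product:
  assumes "finite I" "\<And>i. i \<in> I \<Longrightarrow> 0 < k i" "J \<subseteq> I"
  shows "nonzero_product TYPE('c::comm_ring_1) (product_topology (\<lambda>i. nsphere (k i)) I) (card J) (\<Sum>i\<in>J. k i)"
  using assms
proof (induction I arbitrary: J rule: finite_induct)
  case empty
  then show ?case
    using nonzero_product_point_iff[where ?'c = 'c and X = "product_topology (\<lambda>i. nsphere (k i)) {}"] by simp
next
  case (insert j I)
  let ?X = "product_topology (\<lambda>i. nsphere (k i)) I"
  have IH: "nonzero_product TYPE('c) ?X (card (J - {j})) (\<Sum>i\<in>J - {j}. k i)"
    using insert.prems by (intro insert.IH) auto
  have "finite J"
    using insert.hyps(1) insert.prems(2) finite_subset by blast
  have "nonzero_product TYPE('c) (prod_topology ?X (nsphere (k j))) (card J) (\<Sum>i\<in>J. k i)"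
  proof (cases "j \<in> J")
    case True
    then have "Suc (card (J - {j})) = card J" "(\<Sum>i\<in>J - {j}. k i) + k j = (\<Sum>i\<in>J. k i)"
      using card.remove[OF \<open>finite J\<close> True] sum.remove[OF \<open>finite J\<close> True, of k] by linarith+
    then show ?thesis
      using nonzero_product_times_sphere[OF IH, of "k j"] insert.prems(1) by simp
  next
    case False
    then show ?thesis
      using nonzero_product_times[OF IH basepoint_in_nsphere] by simp
  qed
  then show ?case
    using nonzero_product_insert_factor[where ?'c = 'c, OF insert.hyps(2), where S = "\<lambda>i. nsphere (k i)"] by simp
qed

text \<open>
  Non-zero products in dimension at most \<open>m - p\<close> amount to sets \<open>J\<close> whose complement \<open>I\<close> has
  \<open>p \<le> (\<Sum>i\<in>I. k i)\<close>; the length of the longest product is \<open>r\<close> minus the least \<open>card I\<close>.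
\<close>

lemma p_length_sphere_product:
  fixes r p :: nat and k :: "nat \<Rightarrow> nat"
  assumes k: "\<And>i. i \<in> {1..r} \<Longrightarrow> 0 < k i" and p: "p \<le> (\<Sum>i=1..r. k i)"
  shows "p_length TYPE('c::comm_ring_1) (\<Sum>i=1..r. k i) p (product_topology (\<lambda>i. nsphere (k i)) {1..r}) = r - min_l r k p"
proof -
  let ?X = "product_topology (\<lambda>i. nsphere (k i)) {1..r}" and ?m = "\<Sum>i=1..r. k i"
  let ?L = "{card I |I. I \<subseteq> {1..r} \<and> p \<le> (\<Sum>i\<in>I. k i)}"
  have compl: "card ({1..r} - J) = r - card J" "(\<Sum>i\<in>{1..r} - J. k i) + (\<Sum>i\<in>J. k i) = ?m" "card J \<le> r"
    if "J \<subseteq> {1..r}" for J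
  proof -
    have "finite J" using that finite_subset by blast
    then show "card ({1..r} - J) = r - card J" using that by (simp add: card_Diff_subset)
    show "(\<Sum>i\<in>{1..r} - J. k i) + (\<Sum>i\<in>J. k i) = ?m"
      using sum.subset_diff[OF that, of k] by simp
    show "card J \<le> r" using card_mono[OF _ that] by simp
  qed
  have "?L \<subseteq> {..r}" using compl(3) by blast
  then have fin: "finite ?L" by (rule finite_subset) simp
  have "?L \<noteq> {}" using p by blast
  then have "min_l r k p \<in> ?L"
    unfolding min_l_def using Min_in[OF fin] by blast
  then obtain I where I: "I \<subseteq> {1..r}" "p \<le> (\<Sum>i\<in>I. k i)" "min_l r k p = card I" by blast
  show ?thesis
    unfolding p_length_eq
  proof (rule Greatest_equality)
    have "nonzero_product TYPE('c) ?X (card ({1..r} - I)) (\<Sum>i\<in>{1..r} - I. k i)"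
      by (rule nonzero_product_sphere_product) (use k in auto)
    moreover have "(\<Sum>i\<in>{1..r} - I. k i) + p \<le> ?m"
      using compl(2)[OF I(1)] I(2) by linarith
    ultimately show "\<exists>n. nonzero_product TYPE('c) ?X (r - min_l r k p) n \<and> n + p \<le> ?m"
      using compl(1)[OF I(1)] I(3) by auto
  next
    fix q assume "\<exists>n. nonzero_product TYPE('c) ?X q n \<and> n + p \<le> ?m"
    then obtain n where n: "nonzero_product TYPE('c) ?X q n" "n + p \<le> ?m" by blast
    obtain J where J: "J \<subseteq> {1..r}" "q \<le> card J" "(\<Sum>i\<in>J. k i) = n"
      using nonzero_product_sphere_product_imp[OF _ _ n(1)] k by blast
    have "p \<le> (\<Sum>i\<in>{1..r} - J. k i)"
      using compl(2)[OF J(1)] J(3) n(2) by linarith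
    then have "card ({1..r} - J) \<in> ?L" by blast
    then have "min_l r k p \<le> r - card J"
      unfolding min_l_def compl(1)[OF J(1), symmetric] by (rule Min_le[OF fin])
    then show "q \<le> r - min_l r k p"
      using J(2) compl(3)[OF J(1)] by linarith
  qed
qed

theorem theorem1p7:
  fixes r p :: nat and k :: "nat \<Rightarrow> nat"
    and M :: "(nat \<Rightarrow> nat \<Rightarrow> real) topology"
  assumes "\<And>i. i \<in> {1..r} \<Longrightarrow> 1 \<le> k i"
    and "M = product_topology (\<lambda>i. nsphere (k i)) {1..r}"
    and "p \<le> (\<Sum>i=1..r. k i)"
  shows "p_length TYPE(int) (\<Sum>i=1..r. k i) p M = r - min_l r k p \<and>
         p_length TYPE(real) (\<Sum>i=1..r. k i) p M = r - min_l r k p"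
proof -
  have "0 < k i" if "i \<in> {1..r}" for i
    using assms(1)[OF that] by simp
  then show ?thesis
    unfolding assms(2) using assms(3) by (intro conjI p_length_sphere_product)
qed

end
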